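(* Let $\mathbb{K}$ be a number field, let $k\ge1$, and let $F(T_1,\dots,T_k)\in\mathbb{K}[T_1,\dots,T_k]$ be a multilinear polynomial with split variables. Let $f(X)\in\mathbb{K}(X)$ be a rational function of degree $d\ge2$. (a) The set of $\alpha\in\overline{\mathbb{K}}$ for which there exists a $k$-tuple of distinct non-negative integers $(n_1,\dots,n_k)$ with $F(f^{(n_1)}(\alpha),\dots,f^{(n_k)}(\alpha))=0$ is a set of bounded (absolute Weil) height. (b) If $d\ge3$, then every $\alpha$ as in (a) satisfies $$h(\alpha)\le\frac{2k}{d^{k-1}}h(F)+\frac73C_1(f)+\frac29\log2,$$ where $C_1(f)$ is a constant such that $|\hat h_f(\gamma)-h(\gamma)|\le C_1(f)$ for all $\gamma\in\mathbb{P}^1(\overline{\mathbb{K}})$. (c) Let $\alpha\in\operatorname{Wander}_\mathbb{K}(f)$ be such that $0\notin\{f^{(n)}(\alpha):n\ge0\}$. Then there are only finitely many $k$-tuples of integers $n_1>n_2>\dots>n_k\ge0$ with $F(f^{(n_1)}(\alpha),\dots,f^{(n_k)}(\alpha))=0$, and the number of such solutions is bounded by a quantity depending only on $\mathbb{K}$, $f$ and $F$, independent of $\alpha$.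
   Context: $f^{(n)}$ denotes the $n$-th iterate of $f$ ($f^{(0)}(X)=X$). A polynomial $F\in\mathbb{K}[T_1,\dots,T_k]$ is a multilinear polynomial with split variables if there are $c_1,\dots,c_r\in\mathbb{K}^*$ and a partition $J_1\cup\dots\cup J_r=\{1,\dots,k\}$ into disjoint sets such that $F=\sum_{i=1}^r c_i\prod_{j\in J_i}T_j$; its height is $h(F)=\max_{1\le i\le r}h(c_i)$. Here $h$ is the absolute logarithmic Weil height. $\hat h_f:\mathbb{P}^1(\overline{\mathbb{K}})\to[0,\infty)$ is the canonical height of $f$, the unique function such that $\hat h_f-h$ is bounded and $\hat h_f(f(\gamma))=d\,\hat h_f(\gamma)$ for all $\gamma$. $\operatorname{Wander}_\mathbb{K}(f)$ is the set of points of $\mathbb{P}^1(\mathbb{K})$ with infinite forward orbit under $f$. *)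

theory Defs
  imports
    "HOL-Analysis.Analysis"
    "HOL-Computational_Algebra.Polynomial"
    "HOL-Computational_Algebra.Primes"
    "HOL-Library.Poly_Mapping"
    "HOL-Library.Disjoint_Sets"
begin

section \<open>Number fields\<close>

text \<open>
  Number fields are taken inside the complex numbers, so that the algebraic closure of every one
  of them is the field of all algebraic numbers.
\<close>

definition number_field :: "complex set \<Rightarrow> bool" where
  "number_field K \<longleftrightarrow>
     1 \<in> K \<and> (\<forall>x\<in>K. \<forall>y\<in>K. x - y \<in> K \<and> x * y \<in> K) \<and> (\<forall>x\<in>K. inverse x \<in> K) \<and>
     (\<exists>B. finite B \<and> B \<subseteq> K \<and> (\<forall>x\<in>K. \<exists>a :: complex \<Rightarrow> rat. x = (\<Sum>b\<in>B. of_rat (a b) * b)))"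

definition Qbar :: "complex set" where
  "Qbar = {x. algebraic x}"

section \<open>The absolute logarithmic Weil height\<close>

definition padic_abs :: "nat \<Rightarrow> rat \<Rightarrow> real" where
  "padic_abs p x =
     (if x = 0 then 0
      else real p powi (int (multiplicity (int p) (snd (quotient_of x)))
                        - int (multiplicity (int p) (fst (quotient_of x)))))"

definition absolute_value_on :: "complex set \<Rightarrow> (complex \<Rightarrow> real) \<Rightarrow> bool" where
  "absolute_value_on L v \<longleftrightarrow>
     (\<forall>x\<in>L. 0 \<le> v x \<and> (v x = 0 \<longleftrightarrow> x = 0)) \<and>
     (\<forall>x\<in>L. \<forall>y\<in>L. v (x * y) = v x * v y \<and> v (x + y) \<le> v x + v y)"

text \<open>
  A fixed extension of the p-adic absolute value to the algebraic numbers, i.e. the absolute value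
  obtained from a fixed embedding of the algebraic numbers into an algebraic closure of the
  p-adic numbers. Two extensions differ by a field automorphism, which permutes the conjugates of
  every number; hence the height below does not depend on the choice.
\<close>

definition padic_abs_ext :: "nat \<Rightarrow> complex \<Rightarrow> real" where
  "padic_abs_ext p =
     (SOME v. absolute_value_on Qbar v \<and> (\<forall>r. v (of_rat r) = padic_abs p r))"

definition conjugates :: "complex \<Rightarrow> complex set" where
  "conjugates x =
     {y. \<exists>P :: rat poly. irreducible P \<and> poly (map_poly of_rat P) x = 0 \<and>
                         poly (map_poly of_rat P) y = 0}"

text \<open>
  With \<open>L = \<rat>(x)\<close>, the height of \<open>x\<close> is the sum over the places \<open>w\<close> of \<open>L\<close> of
  \<open>[L\<^sub>w : \<rat>\<^sub>v] / [L : \<rat>] * ln (max 1 \<bar>x\<bar>\<^sub>w)\<close>, where \<open>v\<close> is the place of \<open>\<rat>\<close> below \<open>w\<close>.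
  The places \<open>w\<close> above \<open>v\<close> are the restrictions of \<open>v\<close> (extended to the algebraic numbers) along
  the embeddings of \<open>L\<close>, each \<open>w\<close> arising from exactly \<open>[L\<^sub>w : \<rat>\<^sub>v]\<close> embeddings. So the sum is
  written as a sum over the places \<open>v\<close> of \<open>\<rat>\<close> and the embeddings of \<open>L\<close>, which correspond to the
  conjugates of \<open>x\<close>.
\<close>

definition weil_height :: "complex \<Rightarrow> real" where
  "weil_height x =
     ((\<Sum>y\<in>conjugates x. ln (max 1 (cmod y))) +
      (\<Sum>\<^sub>\<infinity>p\<in>{p :: nat. prime p}. \<Sum>y\<in>conjugates x. ln (max 1 (padic_abs_ext p y))))
     / real (card (conjugates x))"

section \<open>The projective line and rational maps\<close>

datatype proj_line = Fin complex | Infty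

definition P1 :: "complex set \<Rightarrow> proj_line set" where
  "P1 K = insert Infty (Fin ` K)"

fun P1_height :: "proj_line \<Rightarrow> real" where
  "P1_height (Fin x) = weil_height x"
| "P1_height Infty = 0"

text \<open>
  A rational function is given as a quotient \<open>p / q\<close> in lowest terms (\<open>coprime p q\<close>); the
  definitions below are only meant for this case.
\<close>

definition rat_degree :: "complex poly \<Rightarrow> complex poly \<Rightarrow> nat" where
  "rat_degree p q = max (degree p) (degree q)"

fun rat_map :: "complex poly \<Rightarrow> complex poly \<Rightarrow> proj_line \<Rightarrow> proj_line" where
  "rat_map p q (Fin x) = (if poly q x = 0 then Infty else Fin (poly p x / poly q x))"
| "rat_map p q Infty =
     (let d = rat_degree p q
      in if coeff q d = 0 then Infty else Fin (coeff p d / coeff q d))"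

definition is_canonical_height ::
    "complex poly \<Rightarrow> complex poly \<Rightarrow> (proj_line \<Rightarrow> real) \<Rightarrow> bool" where
  "is_canonical_height p q H \<longleftrightarrow>
     (\<forall>\<gamma>\<in>P1 Qbar. 0 \<le> H \<gamma>) \<and>
     (\<exists>B. \<forall>\<gamma>\<in>P1 Qbar. \<bar>H \<gamma> - P1_height \<gamma>\<bar> \<le> B) \<and>
     (\<forall>\<gamma>\<in>P1 Qbar. H (rat_map p q \<gamma>) = real (rat_degree p q) * H \<gamma>)"

text \<open>
  The value 0 outside \<open>P1 Qbar\<close>, where the canonical height is not defined, makes it unique as a
  total function.
\<close>

definition canonical_height :: "complex poly \<Rightarrow> complex poly \<Rightarrow> proj_line \<Rightarrow> real" where
  "canonical_height p q =
     (THE H. is_canonical_height p q H \<and> (\<forall>\<gamma>. \<gamma> \<notin> P1 Qbar \<longrightarrow> H \<gamma> = 0))"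

definition Wander :: "complex set \<Rightarrow> complex poly \<Rightarrow> complex poly \<Rightarrow> proj_line set" where
  "Wander K p q = {\<gamma>\<in>P1 K. infinite (range (\<lambda>n. (rat_map p q ^^ n) \<gamma>))}"

section \<open>Multilinear polynomials with split variables\<close>

text \<open>
  Polynomials are finitely supported maps from exponent vectors to coefficients, with the
  convolution product. The variables of a polynomial in \<open>k\<close> variables are numbered from \<open>0\<close>
  to \<open>k - 1\<close>.
\<close>

type_synonym mpoly = "(nat \<Rightarrow>\<^sub>0 nat) \<Rightarrow>\<^sub>0 complex"

definition mvar :: "nat \<Rightarrow> mpoly" where
  "mvar j = Poly_Mapping.single (Poly_Mapping.single j 1) 1"

definition mconst :: "complex \<Rightarrow> mpoly" where
  "mconst c = Poly_Mapping.single 0 c"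

definition meval :: "mpoly \<Rightarrow> (nat \<Rightarrow> complex) \<Rightarrow> complex" where
  "meval F x =
     (\<Sum>m\<in>Poly_Mapping.keys F.
        Poly_Mapping.lookup F m * (\<Prod>j\<in>Poly_Mapping.keys m. x j ^ Poly_Mapping.lookup m j))"

text \<open>The blocks of a partition are nonempty and index their own coefficients.\<close>

definition split_form ::
    "complex set \<Rightarrow> nat \<Rightarrow> mpoly \<Rightarrow> nat set set \<Rightarrow> (nat set \<Rightarrow> complex) \<Rightarrow> bool" where
  "split_form K k F \<J> c \<longleftrightarrow>
     partition_on {..<k} \<J> \<and> (\<forall>J\<in>\<J>. c J \<in> K - {0}) \<and>
     F = (\<Sum>J\<in>\<J>. mconst (c J) * (\<Prod>j\<in>J. mvar j))"

definition split_multilinear :: "complex set \<Rightarrow> nat \<Rightarrow> mpoly \<Rightarrow> bool" where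
  "split_multilinear K k F \<longleftrightarrow> (\<exists>\<J> c. split_form K k F \<J> c)"

definition mpoly_height :: "mpoly \<Rightarrow> real" where
  "mpoly_height F = Max ((\<lambda>m. weil_height (Poly_Mapping.lookup F m)) ` Poly_Mapping.keys F)"

lemma prod_mvar:
  assumes "finite J"
  shows "(\<Prod>j\<in>J. mvar j) = Poly_Mapping.single (\<Sum>j\<in>J. Poly_Mapping.single j 1) 1"
  using assms
proof (induction J rule: finite_induct)
  case empty
  show ?case by simp
next
  case (insert j J)
  then show ?case by (simp add: mvar_def mult_single)
qed

lemma lookup_sum_single:
  assumes "finite J"
  shows "Poly_Mapping.lookup (\<Sum>j\<in>J. Poly_Mapping.single j (1 :: nat)) i = (if i \<in> J then 1 else 0)"
  using assms
  by (induction J rule: finite_induct) (auto simp: lookup_add lookup_single when_def)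

lemma mpoly_height_split_form:
  assumes "split_form K k F \<J> c"
  shows "mpoly_height F = Max ((\<lambda>J. weil_height (c J)) ` \<J>)"
proof -
  define e where "e = (\<lambda>J :: nat set. \<Sum>j\<in>J. Poly_Mapping.single j (1 :: nat))"
  have part: "partition_on {..<k} \<J>" and nz: "\<And>J. J \<in> \<J> \<Longrightarrow> c J \<noteq> 0"
    and F: "F = (\<Sum>J\<in>\<J>. mconst (c J) * (\<Prod>j\<in>J. mvar j))"
    using assms by (auto simp: split_form_def)
  have finP: "finite \<J>"
    using part by (rule finite_elements[OF finite_lessThan])
  have finJ: "finite J" if "J \<in> \<J>" for J
    using part that by (metis Union_upper finite_lessThan finite_subset partition_onD1)
  have inj: "inj_on e \<J>"
  proof (rule inj_onI)
    fix I J assume I: "I \<in> \<J>" and J: "J \<in> \<J>" and eq: "e I = e J"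
    have "(if i \<in> I then 1 else 0) = (if i \<in> J then 1 else (0 :: nat))" for i
      using arg_cong[OF eq, of "\<lambda>m. Poly_Mapping.lookup m i"]
      unfolding e_def lookup_sum_single[OF finJ[OF I]] lookup_sum_single[OF finJ[OF J]] .
    then have "i \<in> I \<longleftrightarrow> i \<in> J" for i
      by (metis zero_neq_one)
    then show "I = J" by blast
  qed
  have F2: "F = (\<Sum>J\<in>\<J>. Poly_Mapping.single (e J) (c J))"
    unfolding F
    by (rule sum.cong) (simp_all add: prod_mvar finJ mconst_def mult_single e_def)
  have look: "Poly_Mapping.lookup F m = (\<Sum>J\<in>\<J>. c J when e J = m)" for m
    unfolding F2 by (simp add: lookup_sum lookup_single)
  have at: "Poly_Mapping.lookup F (e J) = c J" if J: "J \<in> \<J>" for J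
  proof -
    have "Poly_Mapping.lookup F (e J) = (\<Sum>I\<in>\<J>. if I = J then c I else 0)"
      unfolding look
    proof (rule sum.cong)
      fix I assume "I \<in> \<J>"
      then have "e I = e J \<longleftrightarrow> I = J" using J by (rule inj_on_eq_iff[OF inj])
      then show "(c I when e I = e J) = (if I = J then c I else 0)" by (simp add: when_def)
    qed (rule refl)
    then show ?thesis using finP J by simp
  qed
  have keys: "Poly_Mapping.keys F = e ` \<J>"
  proof
    show "e ` \<J> \<subseteq> Poly_Mapping.keys F"
      using at nz by (auto simp: in_keys_iff)
    show "Poly_Mapping.keys F \<subseteq> e ` \<J>"
    proof
      fix m assume "m \<in> Poly_Mapping.keys F"
      then have "(\<Sum>J\<in>\<J>. c J when e J = m) \<noteq> 0"
        unfolding in_keys_iff look .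
      then obtain J where "J \<in> \<J>" "(c J when e J = m) \<noteq> 0"
        by (rule sum.not_neutral_contains_not_neutral)
      then show "m \<in> e ` \<J>" by (auto simp: when_def split: if_splits)
    qed
  qed
  have "(\<lambda>m. weil_height (Poly_Mapping.lookup F m)) ` Poly_Mapping.keys F
      = (\<lambda>J. weil_height (c J)) ` \<J>"
    unfolding keys image_image by (rule image_cong) (simp_all add: at)
  then show ?thesis by (simp add: mpoly_height_def)
qed

section \<open>Vanishing along an orbit\<close>

text \<open>
  \<open>F\<close> takes a value only if all the iterates are finite; earlier points of the orbit may be
  infinite.
\<close>

definition orbit_zero ::
    "mpoly \<Rightarrow> complex poly \<Rightarrow> complex poly \<Rightarrow> proj_line \<Rightarrow> nat list \<Rightarrow> bool" where
  "orbit_zero F p q \<gamma> ns \<longleftrightarrow>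
     (\<exists>x. (\<forall>i<length ns. (rat_map p q ^^ (ns ! i)) \<gamma> = Fin (x i)) \<and> meval F x = 0)"

definition exceptional_set :: "nat \<Rightarrow> mpoly \<Rightarrow> complex poly \<Rightarrow> complex poly \<Rightarrow> complex set" where
  "exceptional_set k F p q =
     {\<alpha>\<in>Qbar. \<exists>ns. length ns = k \<and> distinct ns \<and> orbit_zero F p q (Fin \<alpha>) ns}"

end

(*
Heights are handled through a common family of absolute values: for finitely many algebraic
numbers, a finite set of embeddings of Qbar permutes all their conjugates uniformly, so every
height is an average of local terms ln (max 1 |x|_w) over the same index set, and the product
formula holds on it. Inequalities between heights are then proved one absolute value at a time.
Both the extension of the p-adic absolute value to Qbar and the embeddings come from Zorn's lemma.

If F vanishes at (f^(n_1)(a), ..., f^(n_k)(a)) with all iterates nonzero, solve F = 0 for the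
iterate of largest index N, which lies in one block only: its height is at most the sum of the
other heights plus a constant S(F). Passing to the canonical height H turns this into
(d^N - sum of the other d^(n_j)) H(a) <= S(F) + k C_1, and the left factor is at least
d^(N-k+1), respectively d^N / 2 if d >= 3. This bounds H(a). For wandering a in K, Northcott's
theorem bounds H(a) from below by a positive constant, so N is bounded independently of a.
*)
theory Submission
  imports
    Defs
    "HOL-Computational_Algebra.Field_as_Ring"
    "HOL-Computational_Algebra.Polynomial_Factorial"
    "HOL-Computational_Algebra.Fundamental_Theorem_Algebra"
begin

section \<open>Algebraic numbers\<close>

text \<open>The split form is decisive: each variable occurs in one block and to the first power, so
  after solving for one iterate every other height enters with coefficient 1. Distinct exponents
  below N satisfy (d - 1) * sum + d^(N-k+1) <= d^N, so their powers stay short of d^N even for d =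
  2. For d >= 3 at least half of d^N survives, and N >= k - 1; this is the source of the factor 2 k
  / d^(k-1). Solving requires nonzero iterates; an orbit through 0 is treated apart, since d^n H(a)
  = H(0) bounds H(a) at once. The height is defined conjugate by conjugate, without a field
  containing several numbers at once. Even h(x y) <= h(x) + h(y) compares averages over different
  index sets, and this is the obstacle that the common family of absolute values removes. Its
  product formula reduces to the one over the rationals, because a number fixed by all embeddings is
  its own only conjugate and hence rational. The estimate h(f(x)) = d h(x) + O(1) behind the
  canonical height gets its lower half from two Bezout identities with algebraic coefficients, one
  for the affine chart and one for the chart at infinity.\<close>

definition poly_over :: "complex set \<Rightarrow> complex poly \<Rightarrow> bool" where
  "poly_over L P \<longleftrightarrow> (\<forall>i. coeff P i \<in> L)"

text \<open>Dimension arguments over the rationals decide which numbers are algebraic.\<close>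

interpretation Q: vector_space "\<lambda>(r::rat) (x::complex). of_rat r * x"
  by unfold_locales (auto simp: algebra_simps of_rat_add of_rat_mult)

text \<open>More than \<open>card B\<close> vectors in the span of \<open>B\<close> are dependent,
  so the powers up to \<open>card B\<close> satisfy a relation. The degree bound is kept for
  Northcott's theorem.\<close>

lemma rational_relation_of_powers:
  assumes B: "finite B" and sp: "\<And>n. x ^ n \<in> Q.span B"
  obtains P where "poly_over \<rat> P" "P \<noteq> 0" "poly P x = 0" "degree P \<le> card B"
proof (cases "inj_on (\<lambda>n. x ^ n) {..card B}")
  case False
  then obtain i j where "i \<le> card B" "j \<le> card B" "i \<noteq> j" "x ^ i = x ^ j"
    by (auto simp: inj_on_def)
  then obtain i j where ij: "i \<le> card B" "j \<le> card B" "i < j" "x ^ i = x ^ j"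
    by (metis linorder_neqE_nat)
  \<comment> \<open>Coinciding powers give a relation at once; linear dependence speaks of sets and
    would not see it.\<close>
  let ?P = "monom 1 j - monom 1 i :: complex poly"
  have "coeff ?P j = 1" using ij by (simp add: coeff_diff)
  then have "?P \<noteq> 0" by (metis coeff_0 zero_neq_one)
  moreover have "degree ?P \<le> card B"
    using ij by (intro degree_diff_le) (auto simp: degree_monom_eq)
  ultimately show ?thesis
    using ij by (intro that[of ?P]) (auto simp: poly_over_def poly_monom)
next
  case True
  let ?S = "(\<lambda>n. x ^ n) ` {..card B}"
  have "card ?S = Suc (card B)" using True by (simp add: card_image)
  then have "Q.dependent ?S"
    using Q.independent_span_bound[OF B, of ?S] sp by auto
  then obtain u v where u: "(\<Sum>v\<in>?S. of_rat (u v) * v) = 0" and v: "v \<in> ?S" "u v \<noteq> 0"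
    using Q.dependent_finite[of ?S] by auto
  define P :: "complex poly" where "P = (\<Sum>i\<le>card B. monom (of_rat (u (x ^ i))) i)"
  have cP: "coeff P i = (if i \<le> card B then of_rat (u (x ^ i)) else 0)" for i
    by (simp add: P_def coeff_sum)
  have "poly P x = (\<Sum>i\<le>card B. of_rat (u (x ^ i)) * x ^ i)"
    by (simp add: P_def poly_sum poly_monom)
  also have "\<dots> = 0" using u by (simp add: sum.reindex[OF True])
  finally have "poly P x = 0" .
  moreover have "P \<noteq> 0"
  proof -
    obtain i where "i \<le> card B" "v = x ^ i" using v(1) by auto
    then have "coeff P i \<noteq> 0" using v(2) by (simp add: cP)
    then show ?thesis by auto
  qed
  moreover have "degree P \<le> card B" by (rule degree_le) (simp add: cP)
  ultimately show ?thesis by (intro that[of P]) (auto simp: poly_over_def cP)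
qed

text \<open>A relation of degree n, multiplied by x^(k-n), expresses x^k through lower
  powers.\<close>

lemma algebraic_imp_powers_in_span:
  assumes "algebraic (x :: complex)"
  shows "\<exists>n. \<forall>k. x ^ k \<in> Q.span ((\<lambda>i. x ^ i) ` {..<n})"
proof -
  obtain P where P: "P \<noteq> 0" "poly P x = 0" "\<And>i. coeff P i \<in> \<rat>"
    using assms by (auto simp: algebraic_altdef)
  define n where "n = degree P"
  have lc: "coeff P n \<noteq> 0" using P(1) by (simp add: n_def)
  have "x ^ k \<in> Q.span ((\<lambda>i. x ^ i) ` {..<n})" for k
  proof (induction k rule: less_induct)
    case (less k)
    show ?case
    proof (cases "k < n")
      case True then show ?thesis by (intro Q.span_base) auto
    next
      case False
      have "0 = (\<Sum>i\<le>n. coeff P i * x ^ i) * x ^ (k - n)"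
        using P(2) by (simp add: poly_altdef n_def)
      also have "\<dots> = (\<Sum>i\<le>n. coeff P i * x ^ (i + (k - n)))"
        by (simp add: sum_distrib_right power_add mult.assoc)
      also have "\<dots> = coeff P n * x ^ k + (\<Sum>i<n. coeff P i * x ^ (i + (k - n)))"
        using False by (simp add: lessThan_Suc_atMost[symmetric])
      finally have "coeff P n * x ^ k = - (\<Sum>i<n. coeff P i * x ^ (i + (k - n)))"
        by (simp add: eq_neg_iff_add_eq_0)
      then have "x ^ k = - (\<Sum>i<n. coeff P i * x ^ (i + (k - n))) / coeff P n"
        using lc by (simp add: field_simps)
      also have "\<dots> = (\<Sum>i<n. (- coeff P i / coeff P n) * x ^ (i + (k - n)))"
        by (simp add: sum_divide_distrib sum_negf)
      also have "\<dots> \<in> Q.span ((\<lambda>i. x ^ i) ` {..<n})"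
      proof (rule Q.span_sum)
        fix i assume i: "i \<in> {..<n}"
        have "- coeff P i / coeff P n \<in> \<rat>" using P(3) by (auto intro: Rats_divide)
        then obtain r where r: "- coeff P i / coeff P n = of_rat r" by (rule Rats_cases)
        have "x ^ (i + (k - n)) \<in> Q.span ((\<lambda>i. x ^ i) ` {..<n})"
          using i False by (intro less) auto
        then show "- coeff P i / coeff P n * x ^ (i + (k - n)) \<in> Q.span ((\<lambda>i. x ^ i) ` {..<n})"
          unfolding r by (rule Q.span_scale)
      qed
      finally show ?thesis .
    qed
  qed
  then show ?thesis by blast
qed

lemma algebraic_if_powers_in_span:
  assumes "finite B" "\<And>n. x ^ n \<in> Q.span B"
  shows "algebraic (x :: complex)"
  by (rule rational_relation_of_powers[OF assms]) (auto simp: poly_over_def intro: algebraicI')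

lemma span_mult_closed:
  assumes "u \<in> Q.span A" "v \<in> Q.span B"
  shows "u * v \<in> Q.span ((\<lambda>(a, b). a * b) ` (A \<times> B))"
proof -
  let ?C = "(\<lambda>(a, b). a * b) ` (A \<times> B)"
  have "a * v \<in> Q.span ?C" if "a \<in> A" for a
    using assms(2)
  proof (induction rule: Q.span_induct_alt)
    case base then show ?case using Q.span_zero[of ?C] by simp
  next
    case (step c b y)
    have "of_rat c * (a * b) + a * y \<in> Q.span ?C"
      using step that by (intro Q.span_add[OF Q.span_scale[OF Q.span_base]]) auto
    then show ?case by (simp add: algebra_simps)
  qed
  note a = this
  show ?thesis using assms(1)
  proof (induction rule: Q.span_induct_alt)
    case base then show ?case using Q.span_zero[of ?C] by simp
  next
    case (step c b y)
    have "of_rat c * (b * v) + y * v \<in> Q.span ?C"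
      using step a by (intro Q.span_add Q.span_scale) auto
    then show ?case by (simp add: algebra_simps)
  qed
qed

text \<open>The products x^a y^b with bounded exponents span a finite-dimensional space that
  contains every power of x y and, by the binomial theorem, of x - y.\<close>

lemma algebraic_mult_diff:
  assumes "algebraic x" "algebraic y"
  shows "algebraic (x * y :: complex)" "algebraic (x - y)"
proof -
  obtain n where n: "\<And>k. x ^ k \<in> Q.span ((\<lambda>i. x ^ i) ` {..<n})"
    using algebraic_imp_powers_in_span[OF assms(1)] by auto
  obtain m where m: "\<And>k. y ^ k \<in> Q.span ((\<lambda>i. y ^ i) ` {..<m})"
    using algebraic_imp_powers_in_span[OF assms(2)] by auto
  let ?C = "(\<lambda>(a, b). a * b) ` (((\<lambda>i. x ^ i) ` {..<n}) \<times> ((\<lambda>i. y ^ i) ` {..<m}))"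
  have sp: "x ^ a * y ^ b \<in> Q.span ?C" for a b by (rule span_mult_closed[OF n m])
  show "algebraic (x * y)"
    by (rule algebraic_if_powers_in_span[of ?C]) (auto simp: power_mult_distrib sp)
  have "(x - y) ^ k \<in> Q.span ?C" for k
  proof -
    have "(x - y) ^ k = (\<Sum>i\<le>k. of_nat (k choose i) * x ^ i * (- y) ^ (k - i))"
      using binomial_ring[of x "-y" k] by simp
    also have "\<dots> = (\<Sum>i\<le>k. of_rat (of_nat (k choose i) * (-1) ^ (k - i)) * (x ^ i * y ^ (k - i)))"
      by (intro sum.cong) (auto simp: of_rat_mult of_rat_power of_rat_minus power_minus[of y])
    also have "\<dots> \<in> Q.span ?C" by (intro Q.span_sum Q.span_scale sp)
    finally show ?thesis .
  qed
  then show "algebraic (x - y)" by (intro algebraic_if_powers_in_span[of ?C]) auto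
qed

section \<open>Subrings and subfields of the complex numbers\<close>

definition subring :: "complex set \<Rightarrow> bool" where
  "subring L \<longleftrightarrow> 1 \<in> L \<and> (\<forall>x\<in>L. \<forall>y\<in>L. x - y \<in> L \<and> x * y \<in> L)"

definition subfield :: "complex set \<Rightarrow> bool" where
  "subfield L \<longleftrightarrow> subring L \<and> (\<forall>x\<in>L. inverse x \<in> L)"

context
  fixes L assumes L: "subring L"
begin

lemma subring_1: "1 \<in> L" and subring_diff: "x \<in> L \<Longrightarrow> y \<in> L \<Longrightarrow> x - y \<in> L"
  and subring_mult: "x \<in> L \<Longrightarrow> y \<in> L \<Longrightarrow> x * y \<in> L"
  using L by (auto simp: subring_def)

lemma subring_0: "0 \<in> L" using subring_diff[OF subring_1 subring_1] by simp

lemma subring_minus: "x \<in> L \<Longrightarrow> - x \<in> L" using subring_diff[OF subring_0, of x] by simp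

lemma subring_add: "x \<in> L \<Longrightarrow> y \<in> L \<Longrightarrow> x + y \<in> L"
  using subring_diff[of x "-y"] subring_minus by simp

lemma subring_sum: "(\<And>i. i \<in> I \<Longrightarrow> f i \<in> L) \<Longrightarrow> sum f I \<in> L"
  by (induction I rule: infinite_finite_induct) (auto simp: subring_0 subring_add)

lemma subring_prod: "(\<And>i. i \<in> I \<Longrightarrow> f i \<in> L) \<Longrightarrow> prod f I \<in> L"
  by (induction I rule: infinite_finite_induct) (auto simp: subring_1 subring_mult)

lemma subring_power: "x \<in> L \<Longrightarrow> x ^ n \<in> L"
  by (induction n) (auto simp: subring_1 subring_mult)

lemma subring_of_nat: "of_nat n \<in> L"
  by (induction n) (auto simp: subring_0 subring_1 subring_add)

lemma subring_of_int: "of_int n \<in> L"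
  by (cases n rule: int_cases2) (auto simp: subring_of_nat subring_minus)

lemma subring_poly: "poly_over L P \<Longrightarrow> x \<in> L \<Longrightarrow> poly P x \<in> L"
  unfolding poly_altdef
  by (intro subring_sum subring_mult subring_power) (auto simp: poly_over_def)

lemma poly_over_diff: "poly_over L P \<Longrightarrow> poly_over L Q \<Longrightarrow> poly_over L (P - Q)"
  by (auto simp: poly_over_def subring_diff)

lemma poly_over_mult: "poly_over L P \<Longrightarrow> poly_over L Q \<Longrightarrow> poly_over L (P * Q)"
  by (auto simp: poly_over_def coeff_mult intro!: subring_sum subring_mult)

lemma poly_over_pCons: "c \<in> L \<Longrightarrow> poly_over L P \<Longrightarrow> poly_over L (pCons c P)"
  by (auto simp: poly_over_def coeff_pCons split: nat.splits)

lemma poly_over_0: "poly_over L 0"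
  by (auto simp: poly_over_def subring_0)

lemma poly_over_const: "c \<in> L \<Longrightarrow> poly_over L [:c:]"
  by (intro poly_over_pCons poly_over_0)

lemma subring_adjoin: "subring {poly P x |P. poly_over L P}"
proof -
  have "\<exists>R. poly P x - poly Q x = poly R x \<and> poly_over L R"
    "\<exists>R. poly P x * poly Q x = poly R x \<and> poly_over L R"
    if "poly_over L P" "poly_over L Q" for P Q
    using that poly_over_diff poly_over_mult by (metis poly_diff, metis poly_mult)
  moreover have "\<exists>P. 1 = poly P x \<and> poly_over L P"
    by (rule exI[of _ "[:1:]"]) (auto intro: poly_over_const subring_1)
  ultimately show ?thesis by (auto simp: subring_def)
qed

end

lemma subfield_imp_subring: "subfield L \<Longrightarrow> subring L"
  and subfield_inverse: "subfield L \<Longrightarrow> x \<in> L \<Longrightarrow> inverse x \<in> L"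
  by (auto simp: subfield_def)

lemma subfield_divide: "subfield L \<Longrightarrow> x \<in> L \<Longrightarrow> y \<in> L \<Longrightarrow> x / y \<in> L"
  by (simp add: divide_inverse subring_mult subfield_imp_subring subfield_inverse)

lemma number_field_imp_subfield: "number_field K \<Longrightarrow> subfield K"
  by (auto simp: number_field_def subfield_def subring_def)

lemma subfield_Qbar: "subfield Qbar"
  by (auto simp: subfield_def subring_def Qbar_def intro: algebraic_mult_diff)

lemmas subring_Qbar = subfield_imp_subring[OF subfield_Qbar]

lemma subfield_Rats: "subfield \<rat>"
  by (auto simp: subfield_def subring_def)

lemmas subring_Rats = subfield_imp_subring[OF subfield_Rats]

lemmas Qbar_closed [simp, intro] =
  subring_1[OF subring_Qbar] subring_0[OF subring_Qbar] subring_diff[OF subring_Qbar]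
  subring_mult[OF subring_Qbar] subfield_inverse[OF subfield_Qbar]
  subring_minus[OF subring_Qbar] subring_add[OF subring_Qbar] subfield_divide[OF subfield_Qbar]
  subring_sum[OF subring_Qbar] subring_prod[OF subring_Qbar] subring_power[OF subring_Qbar]

lemma Rats_subset_Qbar: "\<rat> \<subseteq> Qbar"
  by (auto simp: Qbar_def intro: rat_imp_algebraic)

lemma of_rat_Qbar [simp]: "of_rat r \<in> Qbar"
  using Rats_subset_Qbar by auto

lemma of_int_Qbar [simp]: "of_int r \<in> Qbar"
  using Rats_subset_Qbar by auto

lemma of_nat_Qbar [simp]: "of_nat r \<in> Qbar"
  using Rats_subset_Qbar by auto

lemma mem_QbarE:
  assumes "x \<in> Qbar"
  obtains P where "poly_over \<rat> P" "P \<noteq> 0" "poly P x = 0"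
  using assms by (auto simp: Qbar_def algebraic_altdef poly_over_def)

lemma mem_QbarI: "poly_over \<rat> P \<Longrightarrow> P \<noteq> 0 \<Longrightarrow> poly P x = 0 \<Longrightarrow> x \<in> Qbar"
  by (auto simp: Qbar_def algebraic_altdef poly_over_def)

text \<open>All powers of an element of \<open>K\<close> lie in the span of one finite set, whose
  size bounds the degrees uniformly. Northcott's theorem relies on this uniformity.\<close>

lemma number_field_degree_bound:
  assumes "number_field K"
  shows "\<exists>D. \<forall>x\<in>K. \<exists>P. poly_over \<rat> P \<and> P \<noteq> 0 \<and> poly P x = 0 \<and> degree P \<le> D"
proof -
  obtain B where B: "finite B" "\<And>x. x \<in> K \<Longrightarrow> \<exists>a :: complex \<Rightarrow> rat. x = (\<Sum>b\<in>B. of_rat (a b) * b)"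
    using assms by (auto simp: number_field_def)
  have sp: "x \<in> Q.span B" if "x \<in> K" for x
    using B(2)[OF that] by (auto intro!: Q.span_sum Q.span_scale intro: Q.span_base)
  have "\<exists>P. poly_over \<rat> P \<and> P \<noteq> 0 \<and> poly P x = 0 \<and> degree P \<le> card B" if "x \<in> K" for x
    using sp[OF subring_power[OF subfield_imp_subring[OF number_field_imp_subfield[OF assms]] that]]
    by (rule rational_relation_of_powers[OF B(1)]) blast
  then show ?thesis by blast
qed

lemma number_field_subset_Qbar: "number_field K \<Longrightarrow> K \<subseteq> Qbar"
  using number_field_degree_bound[of K] by (auto intro: mem_QbarI)

text \<open>
  Hence subrings of \<open>Qbar\<close> containing \<open>\<rat>\<close> are fields, and ring homomorphisms between them are
  injective.
\<close>

lemma algebraic_inverse_polynomial: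
  assumes "x \<in> Qbar" "x \<noteq> 0"
  obtains P where "poly_over \<rat> P" "poly P x * x = 1"
proof -
  have "algebraic x" using assms by (simp add: Qbar_def)
  then obtain p :: "int poly" where p: "coeff p 0 \<noteq> 0" "poly (map_poly of_int p) x = 0"
    using algebraicE'_nonzero[OF _ assms(2)] by blast
  \<comment> \<open>As c is nonzero, the relation c + x r(x) = 0 exhibits - r(x) / c as the inverse
    of x.\<close>
  obtain c r where r: "map_poly of_int p = pCons c (r :: complex poly)" by (cases "map_poly of_int p :: complex poly")
  have c: "c = of_int (coeff p 0)" using arg_cong[OF r, of "\<lambda>q. coeff q 0"] by (simp add: coeff_map_poly)
  have ri: "coeff r i = of_int (coeff p (Suc i))" for i
    using arg_cong[OF r, of "\<lambda>q. coeff q (Suc i)"] by (simp add: coeff_map_poly)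
  have "c \<noteq> 0" using p c by simp
  have eq: "c + x * poly r x = 0" using p(2) by (simp add: r)
  show ?thesis
  proof (rule that[of "smult (- 1 / c) r"])
    show "poly_over \<rat> (smult (- 1 / c) r)" by (auto simp: poly_over_def ri c)
    show "poly (smult (- 1 / c) r) x * x = 1"
    proof -
      have "x * poly r x = - c" using eq by (simp add: eq_neg_iff_add_eq_0 add.commute)
      then show ?thesis using \<open>c \<noteq> 0\<close> by (simp add: field_simps)
    qed
  qed
qed

section \<open>Extension of the p-adic absolute value\<close>

text \<open>
  A subring of \<open>Qbar\<close> that is maximal among those not containing \<open>1/p\<close> is a valuation ring.
\<close>

definition pring :: "nat \<Rightarrow> complex set \<Rightarrow> bool" where
  "pring p R \<longleftrightarrow> subring R \<and> R \<subseteq> Qbar \<and> inverse (of_nat p) \<notin> R"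

text \<open>For both applications of Zorn's lemma: a binary operation on the union of a chain takes
  place inside one of its members.\<close>

lemma chain_pair:
  assumes C: "subset.chain A C" and x: "x \<in> \<Union>C" and y: "y \<in> \<Union>C"
  shows "\<exists>S\<in>C. x \<in> S \<and> y \<in> S"
proof -
  obtain S T where ST: "S \<in> C" "T \<in> C" "x \<in> S" "y \<in> T" using x y by auto
  then have "S \<subseteq> T \<or> T \<subseteq> S" using C by (simp add: subset_chain_def)
  then show ?thesis using ST by auto
qed

lemma ex_maximal_pring:
  assumes p: "prime p"
  shows "\<exists>R. pring p R \<and> (\<forall>R'. pring p R' \<longrightarrow> R \<subseteq> R' \<longrightarrow> R' = R)"
proof -
  have "\<exists>M\<in>Collect (pring p). \<forall>X\<in>Collect (pring p). M \<subseteq> X \<longrightarrow> X = M"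
  proof (rule subset_Zorn_nonempty)
    \<comment> \<open>The ring of integers is the member that makes the family nonempty.\<close>
    have "inverse (of_nat p :: complex) \<notin> \<int>"
    proof
      assume "inverse (of_nat p :: complex) \<in> \<int>"
      then obtain m where "inverse (of_nat p :: complex) = of_int m" by (rule Ints_cases)
      then have "of_int (m * int p) = (1 :: complex)"
        using prime_gt_0_nat[OF p] by (simp add: field_simps)
      then have "m * int p = 1" by (simp only: of_int_eq_1_iff)
      then show False using prime_gt_1_nat[OF p] by (simp add: zmult_eq_1_iff)
    qed
    then have "pring p \<int>"
      by (auto simp: pring_def subring_def elim!: Ints_cases)
    then show "Collect (pring p) \<noteq> {}" by auto
  next
    fix C assume C: "C \<noteq> {}" "subset.chain (Collect (pring p)) C"
    then have Cp: "\<And>R. R \<in> C \<Longrightarrow> pring p R" by (auto simp: subset.chain_def)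
    have "x - y \<in> \<Union>C \<and> x * y \<in> \<Union>C" if xy: "x \<in> \<Union>C" "y \<in> \<Union>C" for x y
    proof -
      obtain S where S: "S \<in> C" "x \<in> S" "y \<in> S" using chain_pair[OF C(2) xy] by blast
      then show ?thesis using Cp[OF S(1)] subring_diff[of S x y] subring_mult[of S x y]
        by (auto simp: pring_def)
    qed
    moreover have "1 \<in> \<Union>C" using C(1) Cp by (auto simp: pring_def subring_def)
    ultimately show "\<Union>C \<in> Collect (pring p)"
      using Cp by (auto simp: pring_def subring_def)
  qed
  then show ?thesis by auto
qed

section \<open>A maximal ring without 1/p is a valuation ring\<close>

context
  fixes p :: nat and R :: "complex set"
  assumes p: "prime p" and R: "pring p R"
    and maximal: "\<And>R'. pring p R' \<Longrightarrow> R \<subseteq> R' \<Longrightarrow> R' = R"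
begin

lemma pring_subring: "subring R" and pring_Qbar: "R \<subseteq> Qbar" and pring_inverse_p: "inverse (of_nat p) \<notin> R"
  using R by (auto simp: pring_def)

lemma pring_p_nonzero: "of_nat p \<noteq> (0 :: complex)"
  using p by (simp add: prime_gt_0_nat)

lemmas pring_closed = subring_1[OF pring_subring] subring_0[OF pring_subring] subring_diff[OF pring_subring]
  subring_mult[OF pring_subring] subring_add[OF pring_subring] subring_minus[OF pring_subring]
  subring_power[OF pring_subring] subring_of_nat[OF pring_subring] subring_of_int[OF pring_subring]

text \<open>Adjoin the inverse of u = 1 - p b. Every power of u has the form 1 - p c with c in
  \<open>R\<close>, so an equation 1/p = a / u^k would give 1/p = a + c in \<open>R\<close>. Hence
  the larger ring still omits 1/p and equals \<open>R\<close> by maximality.\<close>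

lemma pring_unit:
  assumes b: "b \<in> R"
  shows "1 - of_nat p * b \<noteq> 0" "inverse (1 - of_nat p * b) \<in> R"
proof -
  define u where "u = 1 - of_nat p * b"
  have uR: "u \<in> R" using b by (auto simp: u_def intro!: pring_closed)
  show u0: "1 - of_nat p * b \<noteq> 0"
  proof
    assume "1 - of_nat p * b = 0"
    then have "b = inverse (of_nat p)" using pring_p_nonzero by (simp add: field_simps)
    then show False using b pring_inverse_p by simp
  qed
  then have u0: "u \<noteq> 0" by (simp add: u_def)
  let ?S = "{a / u ^ k |a k. a \<in> R}"
  have "subring ?S"
    unfolding subring_def
  proof (intro conjI ballI)
    have "1 = 1 / u ^ 0" "1 \<in> R" by (auto intro: pring_closed)
    then show "1 \<in> ?S" by blast
  next
    fix x y assume "x \<in> ?S" "y \<in> ?S"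
    then obtain a k c l where xy: "x = a / u ^ k" "y = c / u ^ l" "a \<in> R" "c \<in> R" by auto
    have "x - y = (a * u ^ l - c * u ^ k) / u ^ (k + l)"
      using u0 by (simp add: xy field_simps power_add)
    moreover have "a * u ^ l - c * u ^ k \<in> R" using xy uR by (auto intro!: pring_closed)
    ultimately show "x - y \<in> ?S" by blast
    have "x * y = (a * c) / u ^ (k + l)"
      using u0 by (simp add: xy field_simps power_add)
    moreover have "a * c \<in> R" using xy uR by (auto intro!: pring_closed)
    ultimately show "x * y \<in> ?S" by blast
  qed
  moreover have "?S \<subseteq> Qbar" using pring_Qbar uR by auto
  moreover have "inverse (of_nat p) \<notin> ?S"
  proof
    assume "inverse (of_nat p) \<in> ?S"
    then obtain a k where a: "inverse (of_nat p) = a / u ^ k" "a \<in> R" by auto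
    then have ak: "u ^ k = of_nat p * a" using u0 pring_p_nonzero by (simp add: field_simps)
    have "\<exists>c\<in>R. u ^ k = 1 - of_nat p * c" for k
    proof (induction k)
      case 0 then show ?case by (auto intro!: bexI[of _ 0] pring_closed)
    next
      case (Suc k)
      then obtain c where c: "c \<in> R" "u ^ k = 1 - of_nat p * c" by auto
      have "u ^ Suc k = 1 - of_nat p * (c + b - of_nat p * (c * b))"
      proof -
        have "u ^ Suc k = (1 - of_nat p * b) * (1 - of_nat p * c)"
          by (simp only: power_Suc c(2)) (simp only: u_def)
        then show ?thesis by (simp add: algebra_simps)
      qed
      moreover have "c + b - of_nat p * (c * b) \<in> R" using b c by (auto intro!: pring_closed)
      ultimately show ?case by blast
    qed
    then obtain c where c: "c \<in> R" "u ^ k = 1 - of_nat p * c" by auto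
    then have "inverse (of_nat p) = a + c" using ak pring_p_nonzero by (simp add: field_simps)
    then show False using pring_inverse_p a c pring_closed by auto
  qed
  ultimately have "pring p ?S" by (simp add: pring_def)
  moreover have "R \<subseteq> ?S"
  proof
    fix x assume "x \<in> R"
    moreover have "x = x / u ^ 0" by simp
    ultimately show "x \<in> ?S" by blast
  qed
  ultimately have "?S = R" by (rule maximal)
  moreover have "inverse u \<in> ?S"
  proof -
    have "inverse u = 1 / u ^ 1" by (simp add: divide_inverse)
    then show ?thesis using pring_closed(1) by blast
  qed
  ultimately show "inverse (1 - of_nat p * b) \<in> R" by (simp add: u_def)
qed

text \<open>By maximality the ring R[x], being larger than \<open>R\<close>, must contain
  1/p.\<close>

lemma pring_adjoin:
  assumes x: "x \<in> Qbar" "x \<notin> R"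
  shows "\<exists>P. poly_over R P \<and> poly P x = inverse (of_nat p)"
proof (rule ccontr)
  assume no: "\<not> ?thesis"
  let ?S = "{poly P x |P. poly_over R P}"
  have "?S \<subseteq> Qbar"
    using x(1) subsetD[OF pring_Qbar] by (auto intro!: subring_poly[OF subring_Qbar] simp: poly_over_def)
  then have "pring p ?S"
    using no subring_adjoin[OF pring_subring, of x] by (auto simp: pring_def)
  moreover have "R \<subseteq> ?S"
  proof
    fix r assume "r \<in> R"
    then show "r \<in> ?S" by (auto intro!: exI[of _ "[:r:]"] poly_over_const pring_subring)
  qed
  ultimately have "?S = R" by (rule maximal)
  moreover have "x \<in> ?S"
    by (auto intro!: exI[of _ "[:0, 1:]"] poly_over_pCons poly_over_0 pring_subring pring_closed)
  ultimately show False using x by simp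
qed

text \<open>Multiplied by x^n, where n is the degree of \<open>P\<close>, the relation for
  \<open>Q\<close> has the term (1/p - q_0) x^n. As 1 - p q_0 is a unit, x^n becomes an
  \<open>R\<close>-combination of lower powers of x. Substituting this for the top power in
  \<open>P\<close> gives a relation of smaller degree.\<close>

lemma pring_minimal_contradiction:
  assumes x: "x \<noteq> 0" and P: "poly_over R P" "poly P x = inverse (of_nat p)"
    and Pmin: "\<And>P'. poly_over R P' \<Longrightarrow> poly P' x = inverse (of_nat p) \<Longrightarrow> degree P \<le> degree P'"
    and Q: "poly_over R Q" "poly Q (inverse x) = inverse (of_nat p)" "degree Q \<le> degree P"
  shows False
proof -
  define n where "n = degree P"
  define a where "a = coeff P"
  define q where "q = coeff Q"
  have aR: "a i \<in> R" and qR: "q i \<in> R" for i using P Q by (auto simp: poly_over_def a_def q_def)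
  define u where "u = inverse (1 - of_nat p * q 0)"
  have uR: "u \<in> R" and u: "1 - of_nat p * q 0 \<noteq> 0"
    using pring_unit[OF qR] by (auto simp: u_def)
  have n: "n > 0"
  proof (rule ccontr)
    assume "\<not> n > 0"
    then obtain c where c: "P = [:c:]" using degree_eq_zeroE[of P] by (auto simp: n_def)
    then have "c = inverse (of_nat p)" using P by simp
    moreover have "c = a 0" by (simp add: a_def c)
    ultimately show False using aR[of 0] pring_inverse_p by simp
  qed
  have "inverse (of_nat p) = (\<Sum>j\<le>degree Q. q j * inverse x ^ j)"
    using Q(2) by (simp add: poly_altdef q_def)
  also have "\<dots> = (\<Sum>j\<le>n. q j * inverse x ^ j)"
    using Q(3) by (intro sum.mono_neutral_left) (auto simp: n_def q_def coeff_eq_0)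
  finally have "inverse (of_nat p) * x ^ n = (\<Sum>j\<le>n. q j * (inverse x ^ j * x ^ n))"
    by (simp add: sum_distrib_right mult.assoc)
  also have "\<dots> = (\<Sum>j\<le>n. q j * x ^ (n - j))"
    using x by (intro sum.cong) (auto simp: power_diff field_simps)
  also have "\<dots> = (\<Sum>i\<le>n. q (n - i) * x ^ i)"
    by (rule sum.reindex_bij_witness[of _ "\<lambda>i. n - i" "\<lambda>i. n - i"]) auto
  also have "\<dots> = q 0 * x ^ n + (\<Sum>i<n. q (n - i) * x ^ i)"
    by (simp add: lessThan_Suc_atMost[symmetric])
  finally have "inverse (of_nat p) * x ^ n - q 0 * x ^ n = (\<Sum>i<n. q (n - i) * x ^ i)"
    by simp
  then have "(1 - of_nat p * q 0) * x ^ n = of_nat p * (\<Sum>i<n. q (n - i) * x ^ i)"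
    using pring_p_nonzero by (simp add: field_simps)
  then have xn: "x ^ n = (\<Sum>i<n. u * of_nat p * q (n - i) * x ^ i)"
  proof -
    have "x ^ n = u * ((1 - of_nat p * q 0) * x ^ n)" using u by (simp add: u_def)
    also have "\<dots> = (\<Sum>i<n. u * of_nat p * q (n - i) * x ^ i)"
      unfolding \<open>(1 - of_nat p * q 0) * x ^ n = of_nat p * (\<Sum>i<n. q (n - i) * x ^ i)\<close>
      by (simp add: sum_distrib_left mult.assoc)
    finally show ?thesis .
  qed
  define P' where "P' = (\<Sum>i<n. monom (a i + a n * (u * of_nat p * q (n - i))) i)"
  have cP: "coeff P' i = (if i < n then a i + a n * (u * of_nat p * q (n - i)) else 0)" for i
    by (simp add: P'_def coeff_sum)
  have "poly_over R P'"
    using aR qR uR by (auto simp: poly_over_def cP intro!: pring_closed)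
  moreover have "poly P' x = poly P x"
  proof -
    have "poly P' x = (\<Sum>i<n. a i * x ^ i) + a n * (\<Sum>i<n. u * of_nat p * q (n - i) * x ^ i)"
      by (simp add: P'_def poly_sum poly_monom algebra_simps sum.distrib sum_distrib_left)
    also have "\<dots> = (\<Sum>i\<le>n. a i * x ^ i)"
      by (simp add: xn[symmetric] lessThan_Suc_atMost[symmetric])
    finally show ?thesis by (simp add: poly_altdef a_def n_def)
  qed
  ultimately have "n \<le> degree P'" using Pmin P by (simp add: n_def)
  moreover have "degree P' \<le> n - 1" by (rule degree_le) (auto simp: cP)
  ultimately show False using n by linarith
qed

text \<open>If x and 1/x were both outside \<open>R\<close>, each would have a relation of least
  degree with value 1/p. The preceding lemma refutes this in either order of the two
  degrees.\<close>

lemma pring_valuation: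
  assumes x: "x \<in> Qbar"
  shows "x \<in> R \<or> inverse x \<in> R"
proof (rule ccontr)
  assume no: "\<not> ?thesis"
  then have x0: "x \<noteq> 0" using pring_closed by auto
  define f where "f = (\<lambda>y. arg_min degree (\<lambda>P. poly_over R P \<and> poly P y = inverse (of_nat p)))"
  have f: "poly_over R (f y)" "poly (f y) y = inverse (of_nat p)"
    "\<And>P. poly_over R P \<Longrightarrow> poly P y = inverse (of_nat p) \<Longrightarrow> degree (f y) \<le> degree P"
    if y: "y \<in> Qbar" "y \<notin> R" for y
  proof -
    obtain P where P: "poly_over R P \<and> poly P y = inverse (of_nat p)"
      using pring_adjoin[OF y] by blast
    show "poly_over R (f y)" "poly (f y) y = inverse (of_nat p)"
      using arg_min_natI[of "\<lambda>P. poly_over R P \<and> poly P y = inverse (of_nat p)", OF P]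
      by (auto simp: f_def)
    show "\<And>P. poly_over R P \<Longrightarrow> poly P y = inverse (of_nat p) \<Longrightarrow> degree (f y) \<le> degree P"
      unfolding f_def by (rule arg_min_nat_le) auto
  qed
  have y: "inverse x \<in> Qbar" using x by auto
  note fx = f[OF x] f[OF y]
  show False
  proof (cases "degree (f (inverse x)) \<le> degree (f x)")
    case True
    show False
      by (rule pring_minimal_contradiction[of x "f x" "f (inverse x)"]) (use True no fx x0 in auto)
  next
    case False
    show False
      by (rule pring_minimal_contradiction[of "inverse x" "f (inverse x)" "f x"])
        (use False no fx x0 in auto)
  qed
qed

text \<open>By Bezout some multiple of n has the form 1 - p b, which is a unit of
  \<open>R\<close>.\<close>

lemma pring_unit_int:
  assumes "coprime n (int p)"
  shows "inverse (of_int n) \<in> R"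
proof -
  obtain a b where "a * n + b * int p = 1"
    using bezout_int[of n "int p"] assms by auto
  then have "a * n = 1 - int p * b" by (simp add: mult.commute)
  then have "of_int (a * n) = (1 - of_nat p * of_int b :: complex)" by simp
  then have "of_int a * of_int n \<noteq> (0::complex)" "inverse (of_int a * of_int n) \<in> R"
    using pring_unit[of "of_int b"] pring_closed by auto
  then have "of_int a * inverse (of_int a * of_int n) \<in> R" by (intro pring_closed)
  moreover have "of_int a * inverse (of_int a * of_int n) = inverse (of_int n :: complex)"
    using \<open>of_int a * of_int n \<noteq> (0::complex)\<close> by (auto simp: divide_simps)
  ultimately show ?thesis by metis
qed

lemma prime_power_decomposition:
  assumes a: "a \<noteq> 0"
  shows "\<exists>b. a = int p ^ multiplicity (int p) a * b \<and> coprime b (int p) \<and> b \<noteq> 0"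
proof -
  have "\<not> is_unit (int p)" using prime_gt_1_nat[OF p] by (simp add: zdvd1_eq)
  then obtain b where b: "a = int p ^ multiplicity (int p) a * b" "\<not> int p dvd b"
    using multiplicity_decompose'[OF a] by metis
  then have "coprime b (int p)"
    using p prime_imp_coprime[of "int p" b] by (simp add: coprime_commute)
  then show ?thesis using b by auto
qed

text \<open>
  As \<open>R\<close> is a valuation ring, the fractions \<open>m / n\<close> with \<open>x ^ n / p ^ m \<in> R\<close> form a Dedekind cut; its
  supremum is the valuation of \<open>x\<close>. So no structure theory of the value group is needed.
\<close>

definition val_cut :: "complex \<Rightarrow> real set" where
  "val_cut x = {real_of_int m / real n |m n. n > 0 \<and> x ^ n * of_nat p powi (- m) \<in> R}"

lemma val_cut_rescale:
  assumes "x ^ n * of_nat p powi (- m) \<in> R"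
  shows "x ^ (n * l) * of_nat p powi (- (m * int l)) \<in> R"
proof -
  have "(x ^ n * of_nat p powi (- m)) ^ l \<in> R" by (intro pring_closed assms)
  also have "(x ^ n * of_nat p powi (- m)) ^ l = x ^ (n * l) * of_nat p powi (- m * int l)"
    by (simp only: power_mult_distrib power_mult power_int_mult power_int_of_nat)
  finally show ?thesis by simp
qed

text \<open>Some x p^e lies in \<open>R\<close>. If x is not in \<open>R\<close>, then 1/x is, and
  an integral relation divided by x^(n-1) puts the product of x with the leading coefficient into
  \<open>R\<close>; the part of that coefficient prime to p is a unit.\<close>

lemma val_cut_nonempty:
  assumes x: "x \<in> Qbar"
  shows "val_cut x \<noteq> {}"
proof -
  have "\<exists>e::nat. x * of_nat p ^ e \<in> R"
  proof (cases "x \<in> R")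
    case True
    then show ?thesis by (intro exI[of _ 0]) simp
  next
    case False
    then have ix: "inverse x \<in> R" using pring_valuation[OF x] by auto
    have x0: "x \<noteq> 0" using False pring_closed by auto
    obtain P where P: "\<And>i. coeff P i \<in> \<int>" "P \<noteq> 0" "poly P x = 0"
      using x by (auto simp: Qbar_def algebraic_def)
    define n where "n = degree P"
    have "coeff P n \<noteq> 0" using P by (simp add: n_def)
    have "n > 0"
    proof (rule ccontr)
      assume "\<not> n > 0"
      then obtain c where "P = [:c:]" using degree_eq_zeroE[of P] by (auto simp: n_def)
      then show False using P by simp
    qed
    obtain a where a: "coeff P n = of_int a" using P(1)[of n] by (rule Ints_cases)
    have a0: "a \<noteq> 0" using \<open>coeff P n \<noteq> 0\<close> a by auto
    obtain b where b: "a = int p ^ multiplicity (int p) a * b" "coprime b (int p)" "b \<noteq> 0"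
      using prime_power_decomposition[OF a0] by blast
    have ib: "inverse (of_int b) \<in> R" using b(2) by (rule pring_unit_int)
    have "0 = (\<Sum>i\<le>n. coeff P i * x ^ i) * inverse x ^ (n - 1)"
      using P(3) by (simp add: poly_altdef n_def)
    also have "\<dots> = (\<Sum>i<n. coeff P i * x ^ i) * inverse x ^ (n - 1)
        + coeff P n * (x ^ n * inverse x ^ (n - 1))"
      by (simp add: lessThan_Suc_atMost[symmetric] algebra_simps)
    also have "(\<Sum>i<n. coeff P i * x ^ i) * inverse x ^ (n - 1)
        = (\<Sum>i<n. coeff P i * inverse x ^ (n - 1 - i))"
      unfolding sum_distrib_right
      using x0 by (intro sum.cong) (auto simp: power_diff field_simps)
    also have "x ^ n * inverse x ^ (n - 1) = x"
      using x0 \<open>n > 0\<close> by (cases n) (auto simp: field_simps)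
    finally have "coeff P n * x = - (\<Sum>i<n. coeff P i * inverse x ^ (n - 1 - i))"
      by (simp add: eq_neg_iff_add_eq_0 add.commute)
    also have "\<dots> \<in> R"
    proof -
      have "coeff P i \<in> R" for i using P(1)[of i] by (elim Ints_cases) (simp add: pring_closed)
      then show ?thesis using ix by (intro pring_closed subring_sum[OF pring_subring])
    qed
    finally have "inverse (of_int b) * (coeff P n * x) \<in> R"
      by (rule subring_mult[OF pring_subring ib])
    also have "inverse (of_int b) * (coeff P n * x) = x * of_nat p ^ multiplicity (int p) a"
      using b(3) by (subst a, subst b(1)) (simp add: field_simps)
    finally show ?thesis by blast
  qed
  then obtain e where "x * of_nat p ^ e \<in> R" by blast
  then have "real_of_int (- int e) / real 1 \<in> val_cut x"
    unfolding val_cut_def by (intro CollectI exI[of _ "- int e"] exI[of _ 1]) simp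
  then show ?thesis by auto
qed

text \<open>If a + b were positive, the product of suitable powers of the two membership relations
  would be a negative power of p lying in \<open>R\<close>, and with it 1/p.\<close>

lemma val_cut_inverse_le:
  assumes x: "x \<noteq> 0" and a: "a \<in> val_cut x" and b: "b \<in> val_cut (inverse x)"
  shows "a + b \<le> 0"
proof -
  obtain m n where a: "a = real_of_int m / real n" "n > 0" "x ^ n * of_nat p powi (- m) \<in> R"
    using a by (auto simp: val_cut_def)
  obtain m' n' where b: "b = real_of_int m' / real n'" "n' > 0"
    "inverse x ^ n' * of_nat p powi (- m') \<in> R"
    using b by (auto simp: val_cut_def)
  have "x ^ (n * n') * of_nat p powi (- (m * int n'))
      * (inverse x ^ (n' * n) * of_nat p powi (- (m' * int n))) \<in> R"
    by (intro pring_closed val_cut_rescale a b)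
  also have "x ^ (n * n') * of_nat p powi (- (m * int n'))
      * (inverse x ^ (n' * n) * of_nat p powi (- (m' * int n)))
      = of_nat p powi (- (m * int n' + m' * int n))"
    using x pring_p_nonzero by (simp add: power_int_add[symmetric] field_simps power_inverse mult.commute[of n])
  finally have *: "of_nat p powi (- (m * int n' + m' * int n)) \<in> R" .
  have "m * int n' + m' * int n \<le> 0"
  proof (rule ccontr)
    assume "\<not> ?thesis"
    then obtain k where k: "m * int n' + m' * int n = int (Suc k)"
      by (metis linorder_not_le zero_less_imp_eq_int Suc_pred)
    have "of_nat p ^ k * of_nat p powi (- int (Suc k)) \<in> R"
      using * unfolding k by (intro pring_closed) (auto intro: pring_closed)
    also have "of_nat p ^ k * of_nat p powi (- int (Suc k)) = (inverse (of_nat p) :: complex)"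
      unfolding power_int_minus power_int_of_nat using pring_p_nonzero by (simp add: field_simps)
    finally show False using pring_inverse_p by simp
  qed
  then have "real_of_int (m * int n' + m' * int n) \<le> 0" by (rule iffD2[OF of_int_le_0_iff])
  moreover have "a + b = real_of_int (m * int n' + m' * int n) / (real n * real n')"
    using a(2) b(2) by (simp add: a(1) b(1) add_frac_eq)
  ultimately show ?thesis by (simp add: divide_nonpos_nonneg)
qed

lemma val_cut_dichotomy:
  assumes x: "x \<in> Qbar" "x \<noteq> 0" and n: "n > 0"
  shows "real_of_int m / real n \<in> val_cut x \<or> - (real_of_int m / real n) \<in> val_cut (inverse x)"
proof -
  have "x ^ n * of_nat p powi (- m) \<in> Qbar" using x by (auto simp: power_int_def)
  then have "x ^ n * of_nat p powi (- m) \<in> R \<or> inverse (x ^ n * of_nat p powi (- m)) \<in> R"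
    by (rule pring_valuation)
  moreover have "inverse (x ^ n * of_nat p powi (- m)) = inverse x ^ n * of_nat p powi (- (- m))"
    by (simp add: power_inverse power_int_minus)
  moreover have "- (real_of_int m / real n) = real_of_int (- m) / real n" by simp
  ultimately show ?thesis unfolding val_cut_def using n by (metis (mono_tags, lifting) mem_Collect_eq)
qed

section \<open>The valuation of the cut and the absolute value it defines\<close>

definition val :: "complex \<Rightarrow> real" where
  "val x = Sup (val_cut x)"

lemma val_cut_bdd:
  assumes x: "x \<in> Qbar" "x \<noteq> 0"
  shows "bdd_above (val_cut x)"
proof -
  obtain b where "b \<in> val_cut (inverse x)" using val_cut_nonempty[of "inverse x"] x by auto
  then show ?thesis using val_cut_inverse_le[OF x(2)] by (intro bdd_aboveI[of _ "- b"]) force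
qed

lemma val_ge: "x \<in> Qbar \<Longrightarrow> x \<noteq> 0 \<Longrightarrow> a \<in> val_cut x \<Longrightarrow> a \<le> val x"
  unfolding val_def by (intro cSup_upper val_cut_bdd)

text \<open>One inequality separates the two cuts. For the other, a rational number r strictly
  between \<open>val x\<close> and \<open>- val (inverse x)\<close> would violate the dichotomy,
  since r or -r lies in the respective cut.\<close>

lemma val_inverse:
  assumes x: "x \<in> Qbar" "x \<noteq> 0"
  shows "val (inverse x) = - val x"
proof (rule antisym)
  have "b \<le> - a" if "a \<in> val_cut x" "b \<in> val_cut (inverse x)" for a b
    using val_cut_inverse_le[OF x(2) that] by simp
  then have "val (inverse x) \<le> - a" if "a \<in> val_cut x" for a
    unfolding val_def using x that by (intro cSup_least val_cut_nonempty) auto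
  then have "a \<le> - val (inverse x)" if "a \<in> val_cut x" for a using that by force
  then have "val x \<le> - val (inverse x)"
    unfolding val_def[of x] using x by (intro cSup_least val_cut_nonempty) auto
  then show "val (inverse x) \<le> - val x" by simp
next
  show "- val x \<le> val (inverse x)"
  proof (rule ccontr)
    assume "\<not> ?thesis"
    then have "val x < - val (inverse x)" by simp
    then obtain r where r: "val x < of_rat r" "of_rat r < - val (inverse x)"
      using of_rat_dense by blast
    obtain m n where mn: "r = of_int m / of_int n" "n > 0"
      by (metis quotient_of_denom_pos' quotient_of_div surjective_pairing)
    define k where "k = nat n"
    have "real_of_rat r = real_of_int m / real k" "k > 0"
      using mn by (auto simp: of_rat_divide k_def)
    then have "real_of_rat r \<in> val_cut x \<or> - real_of_rat r \<in> val_cut (inverse x)"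
      using val_cut_dichotomy[OF x, of k m] by simp
    then show False
      using r val_ge[of x "of_rat r"] val_ge[of "inverse x" "- of_rat r"] x by auto
  qed
qed

lemma val_cut_mult:
  assumes a: "a \<in> val_cut x" and b: "b \<in> val_cut y"
  shows "a + b \<in> val_cut (x * y)"
proof -
  obtain m n where a: "a = real_of_int m / real n" "n > 0" "x ^ n * of_nat p powi (- m) \<in> R"
    using a by (auto simp: val_cut_def)
  obtain m' n' where b: "b = real_of_int m' / real n'" "n' > 0"
    "y ^ n' * of_nat p powi (- m') \<in> R"
    using b by (auto simp: val_cut_def)
  have "x ^ (n * n') * of_nat p powi (- (m * int n'))
      * (y ^ (n' * n) * of_nat p powi (- (m' * int n))) \<in> R"
    by (intro pring_closed val_cut_rescale a b)
  also have "x ^ (n * n') * of_nat p powi (- (m * int n'))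
      * (y ^ (n' * n) * of_nat p powi (- (m' * int n)))
      = (x * y) ^ (n * n') * of_nat p powi (- (m * int n' + m' * int n))"
  proof -
    have "of_nat p powi (- (m * int n' + m' * int n))
        = (of_nat p powi (- (m * int n')) * of_nat p powi (- (m' * int n)) :: complex)"
      using pring_p_nonzero by (simp add: power_int_add[symmetric])
    then show ?thesis by (simp only: power_mult_distrib ac_simps)
  qed
  finally have "real_of_int (m * int n' + m' * int n) / real (n * n') \<in> val_cut (x * y)"
    unfolding val_cut_def using a(2) b(2)
    by (intro CollectI exI[of _ "m * int n' + m' * int n"] exI[of _ "n * n'"]) auto
  moreover have "real_of_int (m * int n' + m' * int n) / real (n * n') = a + b"
    using a(2) b(2) by (simp add: a(1) b(1) add_frac_eq)
  ultimately show ?thesis by simp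
qed

text \<open>Adding cuts gives only one inequality; applied to the inverses it gives the
  other.\<close>

lemma val_mult:
  assumes x: "x \<in> Qbar" "x \<noteq> 0" and y: "y \<in> Qbar" "y \<noteq> 0"
  shows "val (x * y) = val x + val y"
proof -
  have ge: "val x + val y \<le> val (x * y)"
    if x: "x \<in> Qbar" "x \<noteq> 0" and y: "y \<in> Qbar" "y \<noteq> 0" for x y
  proof -
    have *: "a + b \<le> val (x * y)" if "a \<in> val_cut x" "b \<in> val_cut y" for a b
      using val_cut_mult[OF that] x y by (intro val_ge) auto
    then have "a \<le> val (x * y) - b" if "a \<in> val_cut x" "b \<in> val_cut y" for a b using that by force
    then have "val x \<le> val (x * y) - b" if "b \<in> val_cut y" for b
      unfolding val_def[of x] using x that by (intro cSup_least val_cut_nonempty) auto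
    then have "b \<le> val (x * y) - val x" if "b \<in> val_cut y" for b using that by force
    then have "val y \<le> val (x * y) - val x"
      unfolding val_def[of y] using y by (intro cSup_least val_cut_nonempty) auto
    then show ?thesis by simp
  qed
  have "val (inverse x) + val (inverse y) \<le> val (inverse x * inverse y)"
    using x y by (intro ge) auto
  also have "inverse x * inverse y = inverse (x * y)" by simp
  finally have "val (x * y) \<le> val x + val y"
    using x y val_inverse[of x] val_inverse[of y] val_inverse[of "x * y"] by simp
  with ge[OF x y] show ?thesis by simp
qed

lemma val_nonneg: "x \<in> R \<Longrightarrow> x \<noteq> 0 \<Longrightarrow> 0 \<le> val x"
proof -
  assume x: "x \<in> R" "x \<noteq> 0"
  then have "real_of_int 0 / real 1 \<in> val_cut x"
    unfolding val_cut_def by (intro CollectI exI[of _ 0] exI[of _ 1]) simp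
  then have "0 \<in> val_cut x" by simp
  then show ?thesis using x pring_Qbar by (intro val_ge) auto
qed

lemma val_p: "val (of_nat p) = 1"
proof -
  have "real_of_int 1 / real 1 \<in> val_cut (of_nat p)"
    unfolding val_cut_def using pring_p_nonzero pring_closed(1)
    by (intro CollectI exI[of _ 1]) (simp add: power_int_minus)
  moreover have "real_of_int (- 1) / real 1 \<in> val_cut (inverse (of_nat p))"
    unfolding val_cut_def using pring_p_nonzero pring_closed(1) by (intro CollectI exI[of _ "-1"] exI[of _ 1]) simp
  ultimately have "1 \<le> val (of_nat p)" "-1 \<le> val (inverse (of_nat p))"
    using pring_p_nonzero by (auto intro!: val_ge)
  then show ?thesis using val_inverse[of "of_nat p"] pring_p_nonzero by simp
qed

text \<open>By the valuation ring property x/y or y/x lies in \<open>R\<close>. In the first case x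
  + y = y (1 + x/y), and the second factor has nonnegative valuation.\<close>

lemma val_add:
  assumes "x \<in> Qbar" "y \<in> Qbar" "x \<noteq> 0" "y \<noteq> 0" "x + y \<noteq> 0"
  shows "min (val x) (val y) \<le> val (x + y)"
proof -
  have *: "val y \<le> val (x + y)"
    if x: "x \<in> Qbar" "x \<noteq> 0" and y: "y \<in> Qbar" "y \<noteq> 0" and xy: "x + y \<noteq> 0"
      and R: "x / y \<in> R" for x y
  proof -
    have eq: "x + y = y * (1 + x / y)" using y by (simp add: field_simps)
    then have nz: "1 + x / y \<noteq> 0" using xy by auto
    have "1 + x / y \<in> R" using R by (intro pring_closed)
    then have "0 \<le> val (1 + x / y)" using nz by (rule val_nonneg)
    moreover have "val (x + y) = val y + val (1 + x / y)"
      unfolding eq using x y nz by (intro val_mult) auto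
    ultimately show ?thesis by simp
  qed
  have "x / y \<in> R \<or> inverse (x / y) \<in> R" using assms by (intro pring_valuation) auto
  then show ?thesis
    using *[of x y] *[of y x] assms by (auto simp: add.commute)
qed

lemma val_coprime_int:
  assumes n: "coprime n (int p)"
  shows "val (of_int n) = 0"
proof -
  have n0: "n \<noteq> 0" using n prime_gt_1_nat[OF p] by auto
  have "0 \<le> val (of_int n)" "0 \<le> val (inverse (of_int n))"
    using n0 by (auto intro!: val_nonneg pring_unit_int[OF n] pring_closed)
  then show ?thesis using val_inverse[of "of_int n"] n0 by simp
qed

lemma val_of_int:
  assumes a0: "a \<noteq> 0"
  shows "val (of_int a) = real (multiplicity (int p) a)"
proof -
  obtain b where b: "a = int p ^ multiplicity (int p) a * b" "coprime b (int p)" "b \<noteq> 0"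
    using prime_power_decomposition[OF a0] by blast
  have pow: "val (of_nat p ^ e) = real e" for e
  proof (induction e)
    case 0
    show ?case using val_coprime_int[of 1] by simp
  next
    case (Suc e)
    then show ?case using pring_p_nonzero by (simp add: val_mult val_p)
  qed
  have "of_int a = (of_nat p ^ multiplicity (int p) a * of_int b :: complex)"
    by (subst b(1)) simp
  then have "val (of_int a) = val (of_nat p ^ multiplicity (int p) a) + val (of_int b)"
    using b(3) pring_p_nonzero by (simp add: val_mult)
  then show ?thesis by (simp add: pow val_coprime_int[OF b(2)])
qed

lemma ex_padic_abs_extension_aux:
  "\<exists>v. absolute_value_on Qbar v \<and> (\<forall>r. v (of_rat r) = padic_abs p r)"
proof (intro exI conjI allI)
  \<comment> \<open>With \<open>val p = 1\<close>, the base p yields the normalization |p| = 1/p of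
    \<open>padic_abs\<close>.\<close>
  define v where "v = (\<lambda>x. if x = 0 then 0 else real p powr (- val x))"
  have p1: "real p > 1" using prime_gt_1_nat[OF p] by simp
  show "absolute_value_on Qbar v"
    unfolding absolute_value_on_def
  proof (intro conjI ballI)
    fix x y assume xy: "x \<in> Qbar" "y \<in> Qbar"
    show "v (x * y) = v x * v y"
      using xy by (auto simp: v_def val_mult powr_add[symmetric])
    show "v (x + y) \<le> v x + v y"
    proof (cases "x = 0 \<or> y = 0 \<or> x + y = 0")
      case True then show ?thesis by (auto simp: v_def)
    next
      case False
      then have "min (val x) (val y) \<le> val (x + y)" using xy by (intro val_add) auto
      then have "v (x + y) \<le> real p powr (- min (val x) (val y))"
        using False p1 by (auto simp: v_def)
      also have "\<dots> \<le> v x + v y"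
        using False by (auto simp: v_def min_def)
      finally show ?thesis .
    qed
  qed (use p1 in \<open>auto simp: v_def\<close>)
  fix r
  obtain a b where ab: "quotient_of r = (a, b)" by force
  then have r: "r = of_int a / of_int b" and b: "b > 0"
    by (auto simp: quotient_of_div quotient_of_denom_pos)
  show "v (of_rat r) = padic_abs p r"
  proof (cases "r = 0")
    case False
    then have a: "a \<noteq> 0" using r by auto
    have "of_rat r * of_int b = (of_int a :: complex)"
      using b by (simp add: r of_rat_divide)
    then have "val (of_rat r) + val (of_int b) = val (of_int a)"
      using b False val_mult[of "of_rat r" "of_int b"] by simp
    then have "- val (of_rat r) = real_of_int (int (multiplicity (int p) b) - int (multiplicity (int p) a))"
      using a b by (simp add: val_of_int)
    then show ?thesis using False p1
      by (simp add: v_def padic_abs_def ab del: of_int_diff) (subst powr_real_of_int', auto)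
  qed (simp add: v_def padic_abs_def)
qed

end

lemma padic_abs_ext:
  assumes p: "prime p"
  shows "absolute_value_on Qbar (padic_abs_ext p)" "padic_abs_ext p (of_rat r) = padic_abs p r"
proof -
  obtain R where "pring p R" "\<And>R'. pring p R' \<Longrightarrow> R \<subseteq> R' \<Longrightarrow> R' = R"
    using ex_maximal_pring[OF p] by blast
  then have "\<exists>v. absolute_value_on Qbar v \<and> (\<forall>r. v (of_rat r) = padic_abs p r)"
    by (rule ex_padic_abs_extension_aux[OF p])
  from someI_ex[OF this]
  show "absolute_value_on Qbar (padic_abs_ext p)" "padic_abs_ext p (of_rat r) = padic_abs p r"
    by (auto simp: padic_abs_ext_def)
qed

section \<open>Conjugates and embeddings\<close>

text \<open>These maps play the part of the absolute Galois group. They are total functions with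
  arbitrary values outside \<open>Qbar\<close>.\<close>

definition qhom :: "(complex \<Rightarrow> complex) \<Rightarrow> bool" where
  "qhom \<sigma> \<longleftrightarrow> \<sigma> 1 = 1 \<and>
     (\<forall>x\<in>Qbar. \<sigma> x \<in> Qbar \<and> (\<forall>y\<in>Qbar. \<sigma> (x - y) = \<sigma> x - \<sigma> y \<and> \<sigma> (x * y) = \<sigma> x * \<sigma> y))"

context
  fixes \<sigma> assumes s: "qhom \<sigma>"
begin

lemma qhom_1: "\<sigma> 1 = 1" and qhom_Qbar: "x \<in> Qbar \<Longrightarrow> \<sigma> x \<in> Qbar"
  and qhom_diff: "x \<in> Qbar \<Longrightarrow> y \<in> Qbar \<Longrightarrow> \<sigma> (x - y) = \<sigma> x - \<sigma> y"
  and qhom_mult: "x \<in> Qbar \<Longrightarrow> y \<in> Qbar \<Longrightarrow> \<sigma> (x * y) = \<sigma> x * \<sigma> y"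
  using s by (auto simp: qhom_def)

lemma qhom_0: "\<sigma> 0 = 0"
  using qhom_diff[of 1 1] by simp

lemma qhom_add: "x \<in> Qbar \<Longrightarrow> y \<in> Qbar \<Longrightarrow> \<sigma> (x + y) = \<sigma> x + \<sigma> y"
  using qhom_diff[of x "0 - y"] qhom_diff[of 0 y] by (auto simp: qhom_0)

lemma qhom_sum: "(\<And>i. i \<in> I \<Longrightarrow> f i \<in> Qbar) \<Longrightarrow> \<sigma> (sum f I) = (\<Sum>i\<in>I. \<sigma> (f i))"
  by (induction I rule: infinite_finite_induct) (auto simp: qhom_0 qhom_add)

lemma qhom_prod: "(\<And>i. i \<in> I \<Longrightarrow> f i \<in> Qbar) \<Longrightarrow> \<sigma> (prod f I) = (\<Prod>i\<in>I. \<sigma> (f i))"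
  by (induction I rule: infinite_finite_induct) (auto simp: qhom_1 qhom_mult)

lemma qhom_power: "x \<in> Qbar \<Longrightarrow> \<sigma> (x ^ n) = \<sigma> x ^ n"
  by (induction n) (auto simp: qhom_1 qhom_mult)

lemma qhom_nonzero: "x \<in> Qbar \<Longrightarrow> x \<noteq> 0 \<Longrightarrow> \<sigma> x \<noteq> 0"
  using qhom_mult[of x "inverse x"] by (auto simp: qhom_1)

lemma qhom_inj: "inj_on \<sigma> Qbar"
proof (rule inj_onI, rule ccontr)
  fix x y assume "x \<in> Qbar" "y \<in> Qbar" "\<sigma> x = \<sigma> y" "x \<noteq> y"
  then show False using qhom_nonzero[of "x - y"] qhom_diff[of x y] by auto
qed

lemma qhom_of_nat: "\<sigma> (of_nat n) = of_nat n"
  by (induction n) (auto simp: qhom_0 qhom_1 qhom_add)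

lemma qhom_of_int: "\<sigma> (of_int n) = of_int n"
  using qhom_diff[of 0] by (cases n rule: int_cases2) (auto simp: qhom_0 qhom_of_nat)

lemma qhom_inverse: "x \<in> Qbar \<Longrightarrow> \<sigma> (inverse x) = inverse (\<sigma> x)"
  using qhom_mult[of x "inverse x"] by (cases "x = 0") (auto simp: qhom_0 qhom_1 inverse_unique)

lemma qhom_divide: "x \<in> Qbar \<Longrightarrow> y \<in> Qbar \<Longrightarrow> \<sigma> (x / y) = \<sigma> x / \<sigma> y"
  by (simp add: divide_inverse qhom_mult qhom_inverse)

lemma qhom_of_rat: "\<sigma> (of_rat r) = of_rat r"
  by (cases r) (simp add: Fract_of_int_quotient of_rat_divide qhom_divide qhom_of_int)

lemma qhom_Rats: "x \<in> \<rat> \<Longrightarrow> \<sigma> x = x"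
  by (auto elim!: Rats_cases simp: qhom_of_rat)

lemma qhom_poly: "poly_over Qbar P \<Longrightarrow> x \<in> Qbar \<Longrightarrow> \<sigma> (poly P x) = (\<Sum>i\<le>degree P. \<sigma> (coeff P i) * \<sigma> x ^ i)"
  by (simp add: poly_altdef poly_over_def qhom_sum qhom_mult qhom_power)

lemma qhom_rat_poly:
  assumes "poly_over \<rat> P" "x \<in> Qbar"
  shows "\<sigma> (poly P x) = poly P (\<sigma> x)"
proof -
  have "poly_over Qbar P" using assms Rats_subset_Qbar by (auto simp: poly_over_def)
  from qhom_poly[OF this assms(2)] show ?thesis
    using assms by (simp add: poly_altdef poly_over_def qhom_Rats)
qed

end

lemma qhom_comp: "qhom \<sigma> \<Longrightarrow> qhom \<tau> \<Longrightarrow> qhom (\<sigma> \<circ> \<tau>)"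
  by (auto simp: qhom_def)

lemma qhom_id: "qhom (\<lambda>x. x)"
  by (auto simp: qhom_def)

section \<open>Irreducible rational polynomials and conjugates\<close>

lemma map_poly_of_rat_mult:
  "map_poly of_rat (P * Q) = (map_poly of_rat P * map_poly of_rat Q :: complex poly)"
  by (rule poly_eqI) (simp add: coeff_map_poly coeff_mult of_rat_sum of_rat_mult)

lemma map_poly_of_rat_add:
  "map_poly of_rat (P + Q) = (map_poly of_rat P + map_poly of_rat Q :: complex poly)"
  by (rule poly_eqI) (simp add: coeff_map_poly of_rat_add)

lemma poly_over_Rats_map_poly: "poly_over \<rat> (map_poly of_rat P)"
  by (simp add: poly_over_def coeff_map_poly)

lemma poly_over_RatsE:
  assumes "poly_over \<rat> P" obtains P' where "P = map_poly of_rat P'"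
  using ratpolyE[of P] assms by (auto simp: poly_over_def)

text \<open>Otherwise \<open>P\<close> and \<open>Q\<close> are coprime, and their Bezout identity,
  evaluated at the common root x, reads 0 = 1.\<close>

lemma irreducible_root_dvd:
  fixes P Q :: "rat poly"
  assumes P: "irreducible P" "poly (map_poly of_rat P) x = (0::complex)"
    and Q: "poly (map_poly of_rat Q) x = 0"
  shows "P dvd Q"
proof (rule ccontr)
  assume "\<not> P dvd Q"
  then have "coprime P Q"
    using P(1) by (intro prime_elem_imp_coprime irreducible_imp_prime_poly) auto
  moreover obtain u v where "bezout_coefficients P Q = (u, v)" by force
  ultimately have "u * P + v * Q = 1"
    using bezout_coefficients[of P Q u v] by simp
  then have "map_poly of_rat (u * P + v * Q) = (1 :: complex poly)" by simp
  then have "poly (map_poly of_rat u * map_poly of_rat P + map_poly of_rat v * map_poly of_rat Q) x = (1 :: complex)"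
    unfolding map_poly_of_rat_add map_poly_of_rat_mult by simp
  then show False using P(2) Q by simp
qed

lemma ex_irreducible_root:
  assumes "x \<in> Qbar"
  shows "\<exists>P :: rat poly. irreducible P \<and> poly (map_poly of_rat P) x = 0"
proof -
  obtain P0 where "poly_over \<rat> P0" "P0 \<noteq> 0" "poly P0 x = 0" using mem_QbarE[OF assms] .
  moreover from this(1) obtain P1 :: "rat poly" where "P0 = map_poly of_rat P1"
    by (rule poly_over_RatsE)
  ultimately have P1: "P1 \<noteq> 0 \<and> poly (map_poly of_rat P1) x = 0" by auto
  define P where "P = arg_min degree (\<lambda>P :: rat poly. P \<noteq> 0 \<and> poly (map_poly of_rat P) x = 0)"
  have P: "P \<noteq> 0 \<and> poly (map_poly of_rat P) x = 0"
    unfolding P_def by (rule arg_min_natI[of "\<lambda>P. P \<noteq> 0 \<and> poly (map_poly of_rat P) x = 0", OF P1])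
  have Pmin: "degree P \<le> degree Q" if "Q \<noteq> 0" "poly (map_poly of_rat Q) x = 0" for Q
    unfolding P_def by (rule arg_min_nat_le) (use that in auto)
  have "irreducible P"
  proof (rule irreducibleI)
    show "P \<noteq> 0" using P by simp
    show "\<not> P dvd 1"
    proof
      assume "P dvd 1"
      then obtain c where "P = [:c:]" by (auto simp: is_unit_poly_iff)
      then show False using P by (simp add: map_poly_pCons)
    qed
  next
    fix A B assume AB: "P = A * B"
    then have nz: "A \<noteq> 0" "B \<noteq> 0" and deg: "degree P = degree A + degree B"
      using P by (auto simp: degree_mult_eq)
    have "poly (map_poly of_rat A) x = (0::complex) \<or> poly (map_poly of_rat B) x = (0::complex)"
      using P by (auto simp: AB map_poly_of_rat_mult)
    then have "degree A = 0 \<or> degree B = 0"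
      using Pmin[OF nz(1)] Pmin[OF nz(2)] deg by linarith
    then show "A dvd 1 \<or> B dvd 1" using nz by (auto simp: is_unit_iff_degree)
  qed
  then show ?thesis using P by blast
qed

text \<open>All rational relations in place of one irreducible polynomial: in this form conjugacy
  passes along embeddings immediately and is exactly the well-definedness of P(x) -> P(y).\<close>

lemma conjugates_iff:
  assumes "x \<in> Qbar"
  shows "y \<in> conjugates x \<longleftrightarrow> (\<forall>P. poly_over \<rat> P \<longrightarrow> poly P x = 0 \<longrightarrow> poly P y = 0)"
proof
  assume "y \<in> conjugates x"
  then obtain P :: "rat poly" where P: "irreducible P" "poly (map_poly of_rat P) x = 0"
    "poly (map_poly of_rat P) y = 0" by (auto simp: conjugates_def)
  show "\<forall>Q. poly_over \<rat> Q \<longrightarrow> poly Q x = 0 \<longrightarrow> poly Q y = 0"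
  proof (intro allI impI)
    fix Q assume "poly_over \<rat> Q" "poly Q x = 0"
    then obtain Q' where Q': "Q = map_poly of_rat Q'" "poly (map_poly of_rat Q') x = 0"
      by (elim poly_over_RatsE) auto
    then obtain R where "Q' = P * R" using irreducible_root_dvd[OF P(1,2)] by (auto elim: dvdE)
    then show "poly Q y = 0" using P(3) Q'(1) by (simp add: map_poly_of_rat_mult)
  qed
next
  assume *: "\<forall>P. poly_over \<rat> P \<longrightarrow> poly P x = 0 \<longrightarrow> poly P y = 0"
  obtain P :: "rat poly" where "irreducible P" "poly (map_poly of_rat P) x = 0"
    using ex_irreducible_root[OF assms] by blast
  with * show "y \<in> conjugates x"
    by (auto simp: conjugates_def poly_over_Rats_map_poly)
qed

lemma conjugates_refl: "x \<in> Qbar \<Longrightarrow> x \<in> conjugates x"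
  by (simp add: conjugates_iff)

lemma conjugates_sym: "y \<in> conjugates x \<Longrightarrow> x \<in> conjugates y"
  by (auto simp: conjugates_def)

lemma finite_conjugates: "x \<in> Qbar \<Longrightarrow> finite (conjugates x)"
  and conjugates_subset_Qbar: "x \<in> Qbar \<Longrightarrow> conjugates x \<subseteq> Qbar"
  and card_conjugates_le:
    "x \<in> Qbar \<Longrightarrow> poly_over \<rat> P \<Longrightarrow> P \<noteq> 0 \<Longrightarrow> poly P x = 0 \<Longrightarrow> card (conjugates x) \<le> degree P"
proof -
  assume x: "x \<in> Qbar"
  have sub: "conjugates x \<subseteq> {y. poly P y = 0}" if "poly_over \<rat> P" "poly P x = 0" for P
    using that by (auto simp: conjugates_iff[OF x])
  obtain P0 where P0: "poly_over \<rat> P0" "P0 \<noteq> 0" "poly P0 x = 0" using mem_QbarE[OF x] .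
  show "finite (conjugates x)"
    using sub[OF P0(1,3)] poly_roots_finite[OF P0(2)] by (rule finite_subset)
  show "conjugates x \<subseteq> Qbar"
    using sub[OF P0(1,3)] P0 by (auto intro: mem_QbarI)
  assume P: "poly_over \<rat> P" "P \<noteq> 0" "poly P x = 0"
  have "card (conjugates x) \<le> card {y. poly P y = 0}"
    by (intro card_mono sub P poly_roots_finite)
  also have "\<dots> \<le> degree P" using P(2) by (rule card_poly_roots_bound)
  finally show "card (conjugates x) \<le> degree P" .
qed

lemma qhom_conjugates: "qhom \<sigma> \<Longrightarrow> x \<in> Qbar \<Longrightarrow> \<sigma> x \<in> conjugates x"
  by (auto simp: conjugates_iff qhom_rat_poly[symmetric] qhom_0)

lemma conjugates_trans: "x \<in> Qbar \<Longrightarrow> y \<in> conjugates x \<Longrightarrow> z \<in> conjugates y \<Longrightarrow> z \<in> conjugates x"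
  using conjugates_subset_Qbar[of x] by (auto simp: conjugates_iff subset_iff)

lemma conjugates_eq:
  assumes "x \<in> Qbar" "y \<in> conjugates x"
  shows "conjugates y = conjugates x"
  using assms conjugates_trans conjugates_sym conjugates_subset_Qbar by blast

text \<open>
  Embeddings of subfields of \<open>Qbar\<close> are represented by their graphs, which makes the union of a
  chain an embedding again.
\<close>

definition hom_graph :: "(complex \<times> complex) set \<Rightarrow> bool" where
  "hom_graph R \<longleftrightarrow> R \<subseteq> Qbar \<times> Qbar \<and> (\<forall>r\<in>\<rat>. (r, r) \<in> R) \<and> (\<forall>b. (0, b) \<in> R \<longrightarrow> b = 0) \<and>
     (\<forall>a b c d. (a, b) \<in> R \<longrightarrow> (c, d) \<in> R \<longrightarrow> (a - c, b - d) \<in> R \<and> (a * c, b * d) \<in> R)"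

text \<open>\<open>B\<close> is the polynomial that the embedding with graph \<open>R\<close> makes
  of \<open>A\<close>, coefficient by coefficient.\<close>

definition poly_graph :: "(complex \<times> complex) set \<Rightarrow> complex poly \<Rightarrow> complex poly \<Rightarrow> bool" where
  "poly_graph R A B \<longleftrightarrow> (\<forall>i. (coeff A i, coeff B i) \<in> R)"

section \<open>Embedding graphs and their extension by one element\<close>

context
  fixes R assumes R: "hom_graph R"
begin

lemma hom_graph_Qbar: "(a, b) \<in> R \<Longrightarrow> a \<in> Qbar \<and> b \<in> Qbar"
  and hom_graph_Rats: "r \<in> \<rat> \<Longrightarrow> (r, r) \<in> R"
  and hom_graph_zero: "(0, b) \<in> R \<Longrightarrow> b = 0"
  and hom_graph_diff: "(a, b) \<in> R \<Longrightarrow> (c, d) \<in> R \<Longrightarrow> (a - c, b - d) \<in> R"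
  and hom_graph_mult: "(a, b) \<in> R \<Longrightarrow> (c, d) \<in> R \<Longrightarrow> (a * c, b * d) \<in> R"
  using R by (auto simp: hom_graph_def)

lemma hom_graph_00: "(0, 0) \<in> R" and hom_graph_11: "(1, 1) \<in> R"
  by (auto intro: hom_graph_Rats)

lemma hom_graph_minus: "(a, b) \<in> R \<Longrightarrow> (- a, - b) \<in> R"
  using hom_graph_diff[OF hom_graph_00, of a b] by simp

lemma hom_graph_add: "(a, b) \<in> R \<Longrightarrow> (c, d) \<in> R \<Longrightarrow> (a + c, b + d) \<in> R"
  using hom_graph_diff[of a b "-c" "-d"] hom_graph_minus by simp

lemma hom_graph_sum: "(\<And>i. i \<in> I \<Longrightarrow> (f i, g i) \<in> R) \<Longrightarrow> (sum f I, sum g I) \<in> R"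
  by (induction I rule: infinite_finite_induct) (auto simp: hom_graph_00 hom_graph_add)

lemma hom_graph_power: "(a, b) \<in> R \<Longrightarrow> (a ^ n, b ^ n) \<in> R"
  by (induction n) (auto simp: hom_graph_11 hom_graph_mult)

text \<open>Closure under inverses is automatic: 1/a is a rational polynomial in a, and the same
  polynomial evaluated at b inverts b.\<close>

lemma hom_graph_inverse:
  assumes ab: "(a, b) \<in> R" and a: "a \<noteq> 0"
  shows "(inverse a, inverse b) \<in> R" "b \<noteq> 0"
proof -
  obtain P where P: "poly_over \<rat> P" "poly P a * a = 1"
    using algebraic_inverse_polynomial[of a] hom_graph_Qbar[OF ab] a by blast
  have Pab: "(poly P a, poly P b) \<in> R"
    unfolding poly_altdef using P(1) ab
    by (intro hom_graph_sum hom_graph_mult hom_graph_power hom_graph_Rats) (auto simp: poly_over_def)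
  have "(poly P a * a - 1, poly P b * b - 1) \<in> R"
    using hom_graph_diff[OF hom_graph_mult[OF Pab ab] hom_graph_11] .
  then have "poly P b * b = 1" using hom_graph_zero[of "poly P b * b - 1"] P(2) by simp
  then show "b \<noteq> 0" by auto
  then show "(inverse a, inverse b) \<in> R"
    using Pab P(2) \<open>poly P b * b = 1\<close> by (metis inverse_unique mult.commute)
qed

lemma poly_graph_diff: "poly_graph R A B \<Longrightarrow> poly_graph R C D \<Longrightarrow> poly_graph R (A - C) (B - D)"
  by (auto simp: poly_graph_def hom_graph_diff)

lemma poly_graph_add: "poly_graph R A B \<Longrightarrow> poly_graph R C D \<Longrightarrow> poly_graph R (A + C) (B + D)"
  by (auto simp: poly_graph_def hom_graph_add)

lemma poly_graph_mult: "poly_graph R A B \<Longrightarrow> poly_graph R C D \<Longrightarrow> poly_graph R (A * C) (B * D)"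
  by (auto simp: poly_graph_def coeff_mult intro!: hom_graph_sum hom_graph_mult)

lemma poly_graph_monom: "(a, b) \<in> R \<Longrightarrow> poly_graph R (monom a n) (monom b n)"
  by (auto simp: poly_graph_def hom_graph_00)

lemma poly_graph_0: "poly_graph R 0 B \<Longrightarrow> B = 0"
  by (auto simp: poly_graph_def poly_eq_iff intro: hom_graph_zero)

lemma poly_graph_00: "poly_graph R 0 0"
  by (auto simp: poly_graph_def hom_graph_00)

lemma poly_graph_rat: "poly_over \<rat> P \<Longrightarrow> poly_graph R P P"
  by (auto simp: poly_graph_def poly_over_def hom_graph_Rats)

text \<open>Long division with the same steps on both sides. Only the left degree is controlled, but
  a remainder \<open>S = 0\<close> forces \<open>S' = 0\<close> because \<open>R\<close> relates 0
  to 0 alone.\<close>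

lemma poly_graph_division:
  assumes M: "poly_graph R M M'" "M \<noteq> 0" and A: "poly_graph R A B"
  shows "\<exists>Q Q' S S'. poly_graph R Q Q' \<and> poly_graph R S S' \<and> A = M * Q + S \<and> B = M' * Q' + S' \<and>
           (S = 0 \<or> degree S < degree M)"
  using A
proof (induction "degree A" arbitrary: A B rule: less_induct)
  case less
  show ?case
  proof (cases "A = 0 \<or> degree A < degree M")
    case True
    then show ?thesis using less.prems poly_graph_00
      by (intro exI[of _ 0] exI[of _ A] exI[of _ B]) auto
  next
    case False
    define n where "n = degree A"
    define m where "m = degree M"
    have mn: "m \<le> n" using False by (simp add: m_def n_def)
    have c: "(coeff M m, coeff M' m) \<in> R" "coeff M m \<noteq> 0"
      using M by (auto simp: poly_graph_def m_def)
    define T where "T = monom (coeff A n * inverse (coeff M m)) (n - m)"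
    define T' where "T' = monom (coeff B n * inverse (coeff M' m)) (n - m)"
    have "(coeff A n, coeff B n) \<in> R" using less.prems by (simp add: poly_graph_def)
    then have T: "poly_graph R T T'"
      unfolding T_def T'_def
      by (rule poly_graph_monom[OF hom_graph_mult[OF _ hom_graph_inverse(1)[OF c]]])
    define A1 where "A1 = A - M * T"
    define B1 where "B1 = B - M' * T'"
    have A1: "poly_graph R A1 B1"
      unfolding A1_def B1_def by (intro poly_graph_diff poly_graph_mult less.prems M T)
    have "coeff A n \<noteq> 0" using False by (simp add: n_def)
    then have T0: "T \<noteq> 0" using c by (auto simp: T_def)
    have degT: "degree T = n - m" using T0 unfolding T_def by (intro degree_monom_eq) auto
    have "degree A1 \<le> n"
      unfolding A1_def using M(2) T0 mn
      by (intro degree_diff_le) (auto simp: n_def[symmetric] degree_mult_eq degT m_def[symmetric])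
    moreover have "coeff A1 n = 0"
    proof -
      have "coeff (M * T) n = coeff (M * T) (degree M + degree T)" using mn by (simp add: degT m_def)
      also have "\<dots> = coeff M m * coeff T (n - m)" by (subst coeff_mult_degree_sum) (simp add: degT m_def)
      also have "\<dots> = coeff A n" using c by (simp add: T_def)
      finally show ?thesis by (simp add: A1_def)
    qed
    ultimately have "A1 = 0 \<or> degree A1 < degree A"
      by (metis le_neq_implies_less leading_coeff_0_iff n_def)
    then show ?thesis
    proof
      assume "A1 = 0"
      then have "B1 = 0" using A1 poly_graph_0 by simp
      then show ?thesis using \<open>A1 = 0\<close> T poly_graph_00
        by (intro exI[of _ T] exI[of _ T'] exI[of _ 0]) (auto simp: A1_def B1_def)
    next
      assume "degree A1 < degree A"
      from less.hyps[OF this A1] obtain Q Q' S S' where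
        Q: "poly_graph R Q Q'" "poly_graph R S S'" "A1 = M * Q + S" "B1 = M' * Q' + S'"
        "S = 0 \<or> degree S < degree M" by blast
      have "A = M * (Q + T) + S" using Q(3) by (simp add: A1_def algebra_simps)
      moreover have "B = M' * (Q' + T') + S'" using Q(4) by (simp add: B1_def algebra_simps)
      ultimately show ?thesis using Q poly_graph_add[OF Q(1) T] by blast
    qed
  qed
qed

text \<open>\<open>M\<close> is a minimal polynomial of z over the domain of \<open>R\<close>, and w
  is a root of its image \<open>M'\<close>. The extension sends A(z) to B(w). It is well defined
  because A(z) = 0 makes \<open>M\<close> divide \<open>A\<close>, and then \<open>M'\<close>
  divides \<open>B\<close>.\<close>

lemma hom_graph_extend:
  assumes z: "z \<in> Qbar"
  shows "\<exists>R' w. hom_graph R' \<and> R \<subseteq> R' \<and> (z, w) \<in> R'"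
proof -
  let ?good = "\<lambda>(M, M'). poly_graph R M M' \<and> M \<noteq> 0 \<and> poly M z = 0"
  obtain P where P: "poly_over \<rat> P" "P \<noteq> 0" "poly P z = 0" using mem_QbarE[OF z] .
  have ex: "?good (P, P)" using P by (auto intro: poly_graph_rat)
  define MM where "MM = arg_min (degree \<circ> fst) ?good"
  obtain M M' where MM': "MM = (M, M')" by force
  have "?good MM" unfolding MM_def by (rule arg_min_natI[of ?good, OF ex])
  then have M: "poly_graph R M M'" "M \<noteq> 0" "poly M z = 0" by (auto simp: MM')
  have min: "degree M \<le> degree A" if "poly_graph R A B" "A \<noteq> 0" "poly A z = 0" for A B
  proof -
    have "(degree \<circ> fst) MM \<le> (degree \<circ> fst) (A, B)"
      unfolding MM_def by (rule arg_min_nat_le) (use that in auto)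
    then show ?thesis by (simp add: MM')
  qed
  have "degree M > 0"
  proof (rule ccontr)
    assume "\<not> ?thesis"
    then obtain c where "M = [:c:]" using degree_eq_zeroE[of M] by auto
    then show False using M by simp
  qed
  moreover have "coeff M' (degree M) \<noteq> 0"
    using M hom_graph_inverse(2)[of "coeff M (degree M)" "coeff M' (degree M)"]
    by (auto simp: poly_graph_def)
  ultimately have "degree M' > 0" using le_degree[of M' "degree M"] by linarith
  then have "\<not> constant (poly M')" by (simp add: constant_degree)
  then obtain w where w: "poly M' w = 0" using fundamental_theorem_of_algebra by blast
  have zero: "poly B w = 0" if AB: "poly_graph R A B" "poly A z = 0" for A B
  proof -
    obtain Q Q' S S' where
      Q: "poly_graph R Q Q'" "poly_graph R S S'" "A = M * Q + S" "B = M' * Q' + S'"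
      "S = 0 \<or> degree S < degree M" using poly_graph_division[OF M(1,2) AB(1)] by blast
    have "poly S z = 0" using AB(2) M(3) by (simp add: Q(3))
    then have "S = 0" using Q(5) min[OF Q(2)] by linarith
    then have "S' = 0" using Q(2) poly_graph_0 by simp
    then show ?thesis using w by (simp add: Q(4))
  qed
  \<comment> \<open>A rational polynomial is related to itself, so any rational relation of z holds
    for w.\<close>
  have wQ: "w \<in> Qbar" using zero[OF poly_graph_rat[OF P(1)] P(3)] P by (intro mem_QbarI)
  let ?R = "{(poly A z, poly B w) |A B. poly_graph R A B}"
  have memR: "(poly A z, poly B w) \<in> ?R" if "poly_graph R A B" for A B using that by blast
  have sub: "R \<subseteq> ?R"
  proof
    fix ab assume ab: "ab \<in> R"
    obtain a b where "ab = (a, b)" by force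
    with ab memR[OF poly_graph_monom[of a b 0]] show "ab \<in> ?R" by (simp add: poly_monom)
  qed
  have "hom_graph ?R"
    unfolding hom_graph_def
  proof (intro conjI allI impI ballI)
    show "?R \<subseteq> Qbar \<times> Qbar"
    proof clarify
      fix A B assume "poly_graph R A B"
      then have "poly_over Qbar A" "poly_over Qbar B"
        using hom_graph_Qbar by (auto simp: poly_graph_def poly_over_def)
      then show "poly A z \<in> Qbar \<and> poly B w \<in> Qbar"
        using z wQ by (auto intro: subring_poly[OF subring_Qbar])
    qed
    show "(r, r) \<in> ?R" if "r \<in> \<rat>" for r using sub hom_graph_Rats[OF that] by blast
    show "b = 0" if "(0, b) \<in> ?R" for b using that zero by auto
  next
    fix a b c d assume "(a, b) \<in> ?R" "(c, d) \<in> ?R"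
    then obtain A B C D where *: "poly_graph R A B" "poly_graph R C D"
      "a = poly A z" "b = poly B w" "c = poly C z" "d = poly D w" by blast
    show "(a - c, b - d) \<in> ?R" using memR[OF poly_graph_diff[OF *(1,2)]] by (simp add: *)
    show "(a * c, b * d) \<in> ?R" using memR[OF poly_graph_mult[OF *(1,2)]] by (simp add: *)
  qed
  moreover have "(z, w) \<in> ?R" using memR[OF poly_graph_monom[OF hom_graph_11, of 1]]
    by (simp add: poly_monom)
  ultimately show ?thesis using sub by blast
qed

end

lemma hom_graph_simple:
  assumes x: "x \<in> Qbar" and y: "y \<in> conjugates x"
  shows "hom_graph {(poly P x, poly P y) |P. poly_over \<rat> P}" (is "hom_graph ?R")
  unfolding hom_graph_def
proof (intro conjI allI impI ballI)
  have yQ: "y \<in> Qbar" using conjugates_subset_Qbar x y by auto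
  show "?R \<subseteq> Qbar \<times> Qbar"
    using x yQ subsetD[OF Rats_subset_Qbar]
    by (auto simp: poly_over_def intro!: subring_poly[OF subring_Qbar])
  show "(r, r) \<in> ?R" if "r \<in> \<rat>" for r
    using that by (auto intro!: exI[of _ "[:r:]"] poly_over_const[OF subring_Rats])
  show "b = 0" if "(0, b) \<in> ?R" for b
    using that y by (auto simp: conjugates_iff[OF x])
  fix a b c d assume "(a, b) \<in> ?R" "(c, d) \<in> ?R"
  then obtain P Q where *: "poly_over \<rat> P" "poly_over \<rat> Q"
    "a = poly P x" "b = poly P y" "c = poly Q x" "d = poly Q y" by blast
  show "(a - c, b - d) \<in> ?R"
    using poly_over_diff[OF subring_Rats *(1,2)] by (auto simp: * intro!: exI[of _ "P - Q"])
  show "(a * c, b * d) \<in> ?R"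
    using poly_over_mult[OF subring_Rats *(1,2)] by (auto simp: * intro!: exI[of _ "P * Q"])
qed

text \<open>A maximal graph containing P(x) -> P(y) has all of \<open>Qbar\<close> as its domain,
  since any missing number could be adjoined.\<close>

lemma ex_qhom_conjugate:
  assumes x: "x \<in> Qbar" and y: "y \<in> conjugates x"
  shows "\<exists>\<sigma>. qhom \<sigma> \<and> \<sigma> x = y"
proof -
  let ?R0 = "{(poly P x, poly P y) |P. poly_over \<rat> P}"
  let ?\<A> = "{R. hom_graph R \<and> ?R0 \<subseteq> R}"
  have "\<exists>M\<in>?\<A>. \<forall>X\<in>?\<A>. M \<subseteq> X \<longrightarrow> X = M"
  proof (rule subset_Zorn_nonempty)
    show "?\<A> \<noteq> {}" using hom_graph_simple[OF x y] by auto
  next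
    fix C assume C: "C \<noteq> {}" "subset.chain ?\<A> C"
    then have Ch: "\<And>R. R \<in> C \<Longrightarrow> hom_graph R \<and> ?R0 \<subseteq> R" by (auto simp: subset.chain_def)
    have two: "\<exists>R\<in>C. u \<in> R \<and> v \<in> R" if "u \<in> \<Union>C" "v \<in> \<Union>C" for u v
      using chain_pair[OF C(2) that] .
    have "hom_graph (\<Union>C)"
      unfolding hom_graph_def
    proof (intro conjI allI impI ballI)
      show "\<Union>C \<subseteq> Qbar \<times> Qbar" using Ch unfolding hom_graph_def by blast
      show "(r, r) \<in> \<Union>C" if "r \<in> \<rat>" for r using that Ch C(1) hom_graph_Rats by blast
      show "b = 0" if "(0, b) \<in> \<Union>C" for b using that Ch hom_graph_zero by blast
      fix a b c d assume "(a, b) \<in> \<Union>C" "(c, d) \<in> \<Union>C"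
      then obtain R where "R \<in> C" "(a, b) \<in> R" "(c, d) \<in> R" using two by blast
      moreover from this have "hom_graph R" using Ch by blast
      ultimately show "(a - c, b - d) \<in> \<Union>C" "(a * c, b * d) \<in> \<Union>C"
        using hom_graph_diff[of R a b c d] hom_graph_mult[of R a b c d] by blast+
    qed
    moreover have "?R0 \<subseteq> \<Union>C" using Ch C(1) by blast
    ultimately show "\<Union>C \<in> ?\<A>" by simp
  qed
  then obtain R where R: "hom_graph R" "?R0 \<subseteq> R"
    and max: "\<And>R'. hom_graph R' \<Longrightarrow> R \<subseteq> R' \<Longrightarrow> R' = R"
    by auto
  have dom: "\<exists>w. (z, w) \<in> R" if "z \<in> Qbar" for z
    using hom_graph_extend[OF R(1) that] max by blast
  define \<sigma> where "\<sigma> = (\<lambda>z. SOME w. (z, w) \<in> R)"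
  have sR: "(z, \<sigma> z) \<in> R" if "z \<in> Qbar" for z
    unfolding \<sigma>_def using dom[OF that] by (rule someI_ex)
  have uniq: "w = \<sigma> z" if "(z, w) \<in> R" for z w
  proof -
    have "z \<in> Qbar" using that hom_graph_Qbar[OF R(1)] by blast
    then have "(z - z, w - \<sigma> z) \<in> R" using that sR hom_graph_diff[OF R(1)] by blast
    then show ?thesis using hom_graph_zero[OF R(1), of "w - \<sigma> z"] by simp
  qed
  have "(x, y) \<in> ?R0"
    by (auto intro!: exI[of _ "[:0, 1:]"] poly_over_pCons[OF subring_Rats] poly_over_0[OF subring_Rats])
  then have "\<sigma> x = y" using R(2) uniq by blast
  moreover have "qhom \<sigma>"
    unfolding qhom_def
  proof (intro conjI ballI)
    show "\<sigma> 1 = 1" using uniq[OF hom_graph_11[OF R(1)]] by simp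
    fix a assume a: "a \<in> Qbar"
    then show "\<sigma> a \<in> Qbar" using sR hom_graph_Qbar[OF R(1)] by blast
    fix b assume b: "b \<in> Qbar"
    show "\<sigma> (a - b) = \<sigma> a - \<sigma> b"
      using uniq[OF hom_graph_diff[OF R(1) sR[OF a] sR[OF b]]] by simp
    show "\<sigma> (a * b) = \<sigma> a * \<sigma> b"
      using uniq[OF hom_graph_mult[OF R(1) sR[OF a] sR[OF b]]] by simp
  qed
  ultimately show ?thesis by blast
qed

section \<open>Absolute values\<close>

text \<open>The function log^+ of height theory.\<close>

definition logp :: "real \<Rightarrow> real" where
  "logp t = ln (max 1 t)"

lemma logp_nonneg: "0 \<le> logp t"
  by (simp add: logp_def)

lemma logp_le_1: "t \<le> 1 \<Longrightarrow> logp t = 0"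
  by (simp add: logp_def max_def)

lemma exp_logp: "exp (logp t) = max 1 t"
  by (simp add: logp_def)

lemma logp_le_iff: "logp t \<le> c \<longleftrightarrow> max 1 t \<le> exp c"
proof -
  have "logp t \<le> c \<longleftrightarrow> exp (logp t) \<le> exp c" by simp
  then show ?thesis by (simp only: exp_logp)
qed

lemma logp_mult:
  assumes "0 \<le> s" "0 \<le> t" shows "logp (s * t) \<le> logp s + logp t"
proof -
  have "max 1 (s * t) \<le> max 1 s * max 1 t"
    using mult_mono[of s "max 1 s" t "max 1 t"] mult_mono[of 1 "max 1 s" 1 "max 1 t"] assms by simp
  then show ?thesis unfolding logp_le_iff by (simp add: exp_add exp_logp)
qed

text \<open>Summed over all absolute values, the correction \<open>ln t\<close> vanishes by the
  product formula; this gives the height of an inverse.\<close>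

lemma logp_inverse: "t > 0 \<Longrightarrow> logp (inverse t) = logp t - ln t"
  by (auto simp: logp_def max_def ln_inverse inverse_le_1_iff one_le_inverse_iff)

lemma ln_le_logp: "t > 0 \<Longrightarrow> ln t \<le> logp t"
  by (auto simp: logp_def)

context
  fixes w assumes w: "absolute_value_on Qbar w"
begin

lemma av_nonneg: "x \<in> Qbar \<Longrightarrow> 0 \<le> w x"
  and av_eq_0_iff: "x \<in> Qbar \<Longrightarrow> w x = 0 \<longleftrightarrow> x = 0"
  and av_mult: "x \<in> Qbar \<Longrightarrow> y \<in> Qbar \<Longrightarrow> w (x * y) = w x * w y"
  and av_add: "x \<in> Qbar \<Longrightarrow> y \<in> Qbar \<Longrightarrow> w (x + y) \<le> w x + w y"
  using w by (auto simp: absolute_value_on_def)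

lemma av_pos: "x \<in> Qbar \<Longrightarrow> x \<noteq> 0 \<Longrightarrow> 0 < w x"
  using av_nonneg[of x] av_eq_0_iff[of x] by simp

lemma av_0: "w 0 = 0"
  by (simp add: av_eq_0_iff)

lemma av_1: "w 1 = 1"
  using av_mult[of 1 1] av_pos[of 1] by simp

lemma av_minus: "x \<in> Qbar \<Longrightarrow> w (- x) = w x"
proof -
  assume x: "x \<in> Qbar"
  have "w (- 1) * w (- 1) = 1" using av_mult[of "-1" "-1"] av_1 by simp
  then have "w (- 1) = 1" using av_nonneg[of "-1"] by (simp add: square_eq_1_iff) 
  then show ?thesis using av_mult[of "-1" x] x by simp
qed

lemma av_inverse: "x \<in> Qbar \<Longrightarrow> w (inverse x) = inverse (w x)"
  using av_mult[of x "inverse x"] av_1 by (cases "x = 0") (auto simp: av_0 inverse_unique)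

lemma av_prod: "(\<And>i. i \<in> I \<Longrightarrow> f i \<in> Qbar) \<Longrightarrow> w (prod f I) = (\<Prod>i\<in>I. w (f i))"
  by (induction I rule: infinite_finite_induct) (auto simp: av_1 av_mult)

lemma av_power: "x \<in> Qbar \<Longrightarrow> w (x ^ n) = w x ^ n"
  by (induction n) (auto simp: av_1 av_mult)

lemma av_sum: "(\<And>i. i \<in> I \<Longrightarrow> f i \<in> Qbar) \<Longrightarrow> w (sum f I) \<le> (\<Sum>i\<in>I. w (f i))"
proof (induction I rule: infinite_finite_induct)
  case (insert i I)
  then show ?case using av_add[of "f i" "sum f I"] by auto
qed (auto simp: av_0)

text \<open>Composition with embeddings yields further extensions of the same place; the height
  frames consist of them.\<close>

lemma av_qhom: "qhom \<sigma> \<Longrightarrow> absolute_value_on Qbar (\<lambda>x. w (\<sigma> x))"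
  unfolding absolute_value_on_def
proof (intro ballI conjI)
  fix x y assume s: "qhom \<sigma>" and xy: "x \<in> Qbar" "y \<in> Qbar"
  note sQ = qhom_Qbar[OF s]
  show "0 \<le> w (\<sigma> x)" using av_nonneg[OF sQ[OF xy(1)]] .
  show "w (\<sigma> x) = 0 \<longleftrightarrow> x = 0"
    using av_eq_0_iff[OF sQ[OF xy(1)]] qhom_nonzero[OF s xy(1)] qhom_0[OF s] by auto
  show "w (\<sigma> (x * y)) = w (\<sigma> x) * w (\<sigma> y)" using xy by (simp add: qhom_mult[OF s] av_mult sQ)
  show "w (\<sigma> (x + y)) \<le> w (\<sigma> x) + w (\<sigma> y)" using xy by (simp add: qhom_add[OF s] av_add sQ)
qed

end

section \<open>Non-archimedean absolute values\<close>

definition nonarch :: "(complex \<Rightarrow> real) \<Rightarrow> bool" where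
  "nonarch w \<longleftrightarrow> (\<forall>x\<in>Qbar. \<forall>y\<in>Qbar. w (x + y) \<le> max (w x) (w y))"

lemma nonarch_sum:
  assumes "absolute_value_on Qbar w" "nonarch w" "0 \<le> B"
    and "\<And>i. i \<in> I \<Longrightarrow> f i \<in> Qbar" "\<And>i. i \<in> I \<Longrightarrow> w (f i) \<le> B"
  shows "w (sum f I) \<le> B"
  using assms(4,5)
proof (induction I rule: infinite_finite_induct)
  case (insert i I)
  then have "w (f i + sum f I) \<le> max (w (f i)) (w (sum f I))"
    using assms(2) by (auto simp: nonarch_def)
  then show ?case using insert by force
qed (use assms(1,3) in \<open>auto simp: av_0\<close>)

text \<open>\<open>padic_abs_ext\<close> is specified with the ordinary triangle inequality only, so
  the strong one has to be recovered. With M the larger of |x| and |y|, the binomial theorem gives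
  |x + y|^n <= (n + 1) M^n. If |x + y| > M, then t = M / |x + y| < 1 and (n + 1) t^n tends to 0
  while staying at least 1.\<close>

lemma nonarch_if_bounded_on_nat:
  assumes w: "absolute_value_on Qbar w" and nat: "\<And>n. w (of_nat n) \<le> 1"
  shows "nonarch w"
  unfolding nonarch_def
proof (intro ballI, rule ccontr)
  fix x y assume xy: "x \<in> Qbar" "y \<in> Qbar" and gt: "\<not> w (x + y) \<le> max (w x) (w y)"
  define M where "M = max (w x) (w y)"
  define s where "s = w (x + y)"
  have M0: "0 \<le> M" using av_nonneg[OF w xy(1)] by (auto simp: M_def)
  have sM: "s > M" using gt by (auto simp: s_def M_def max_def split: if_splits)
  then have s0: "s > 0" using M0 by simp
  have bound: "s ^ n \<le> real (Suc n) * M ^ n" for n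
  proof -
    have "s ^ n = w ((x + y) ^ n)" using xy by (simp add: s_def av_power[OF w])
    also have "(x + y) ^ n = (\<Sum>k\<le>n. of_nat (n choose k) * x ^ k * y ^ (n - k))"
      by (rule binomial_ring)
    also have "w \<dots> \<le> (\<Sum>k\<le>n. w (of_nat (n choose k) * x ^ k * y ^ (n - k)))"
      using xy by (intro av_sum[OF w]) auto
    also have "\<dots> \<le> (\<Sum>k\<le>n. M ^ n)"
    proof (rule sum_mono)
      fix k assume k: "k \<in> {..n}"
      have "w (of_nat (n choose k) * x ^ k * y ^ (n - k)) = w (of_nat (n choose k)) * w x ^ k * w y ^ (n - k)"
        using xy by (simp add: av_mult[OF w] av_power[OF w])
      also have "\<dots> \<le> 1 * M ^ k * M ^ (n - k)"
        using nat[of "n choose k"] xy M0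
        by (intro mult_mono power_mono) (auto simp: M_def av_nonneg[OF w])
      also have "\<dots> = M ^ n" using k by (simp add: power_add[symmetric])
      finally show "w (of_nat (n choose k) * x ^ k * y ^ (n - k)) \<le> M ^ n" .
    qed
    finally show ?thesis by simp
  qed
  define t where "t = M / s"
  have t: "0 \<le> t" "t < 1" using M0 sM s0 by (auto simp: t_def)
  have "1 \<le> real n * t ^ n + t ^ n" for n
    using bound[of n] s0 by (simp add: t_def power_divide field_simps)
  moreover have "(\<lambda>n. real n * t ^ n + t ^ n) \<longlonglongrightarrow> 0 + 0"
    using t by (intro tendsto_add powser_times_n_limit_0 LIMSEQ_realpow_zero) auto
  ultimately have "1 \<le> (0 + 0 :: real)" by (intro LIMSEQ_le_const) auto
  then show False by simp
qed

section \<open>Places of the rationals, with 0 as the archimedean place\<close>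

definition place_abs :: "nat \<Rightarrow> complex \<Rightarrow> real" where
  "place_abs v = (if v = 0 then cmod else padic_abs_ext v)"

definition is_place :: "nat \<Rightarrow> bool" where
  "is_place v \<longleftrightarrow> v = 0 \<or> prime v"

lemma place_abs_value: "is_place v \<Longrightarrow> absolute_value_on Qbar (place_abs v)"
proof (cases "v = 0")
  case True
  then show ?thesis
    by (auto simp: place_abs_def absolute_value_on_def norm_mult norm_triangle_ineq)
next
  case False
  then show "is_place v \<Longrightarrow> absolute_value_on Qbar (place_abs v)"
    using padic_abs_ext(1)[of v] by (auto simp: is_place_def place_abs_def)
qed

lemma place_abs_of_int:
  assumes p: "prime p" and a: "a \<noteq> 0"
  shows "place_abs p (of_int a) = real p powi - int (multiplicity (int p) a)"
proof -
  have "p \<noteq> 0" using p by auto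
  have "place_abs p (of_rat (of_int a)) = padic_abs p (of_int a)"
    using p \<open>p \<noteq> 0\<close> by (simp add: place_abs_def padic_abs_ext del: of_rat_of_int_eq)
  then show ?thesis using a by (simp add: padic_abs_def)
qed

lemma place_abs_of_int_le_1: "prime p \<Longrightarrow> place_abs p (of_int a) \<le> 1"
proof (cases "a = 0")
  case True
  assume p: "prime p"
  then show ?thesis using av_0[OF place_abs_value[of p]] True by (simp add: is_place_def)
next
  case False
  assume p: "prime p"
  have "real p \<ge> 1" using prime_gt_1_nat[OF p] by simp
  then show ?thesis
    by (simp add: place_abs_of_int[OF p False] power_int_minus inverse_le_1_iff one_le_power)
qed

lemma place_nonarch: "prime p \<Longrightarrow> nonarch (place_abs p)"
  using place_abs_of_int_le_1[of p "int n" for n]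
  by (intro nonarch_if_bounded_on_nat place_abs_value) (auto simp: is_place_def)

text \<open>If |x| > 1, the leading term, whose coefficient is a p-adic unit, would strictly
  dominate all other terms of the relation. So only primes dividing the leading coefficient can make
  |x| exceed 1, and these are finitely many.\<close>

lemma place_abs_le_1:
  assumes p: "prime p" and P: "\<And>i. coeff P i \<in> \<int>" "P \<noteq> 0" "poly P x = 0"
    and a: "lead_coeff P = of_int a" "\<not> int p dvd a" and x: "x \<in> Qbar"
  shows "place_abs p x \<le> 1"
proof (rule ccontr)
  let ?w = "place_abs p"
  assume "\<not> ?thesis"
  then have gt: "?w x > 1" by simp
  have w: "absolute_value_on Qbar ?w" using p by (intro place_abs_value) (simp add: is_place_def)
  define n where "n = degree P"
  have n: "n > 0"
  proof (rule ccontr)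
    assume "\<not> n > 0"
    then obtain c where "P = [:c:]" using degree_eq_zeroE[of P] by (auto simp: n_def)
    then show False using P by simp
  qed
  have cQ: "coeff P i \<in> Qbar" for i using P(1)[of i] by (elim Ints_cases) simp
  have c1: "?w (coeff P i) \<le> 1" for i
    using P(1)[of i] by (elim Ints_cases) (simp add: place_abs_of_int_le_1[OF p])
  have "a \<noteq> 0" using a by auto
  have "0 = (\<Sum>i\<le>n. coeff P i * x ^ i)" using P(3) by (simp add: poly_altdef n_def)
  also have "\<dots> = (\<Sum>i<n. coeff P i * x ^ i) + coeff P n * x ^ n"
    by (simp add: lessThan_Suc_atMost[symmetric])
  finally have eq: "coeff P n * x ^ n = - (\<Sum>i<n. coeff P i * x ^ i)"
    by (simp add: eq_neg_iff_add_eq_0 add.commute)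
  have "?w x ^ n = ?w (coeff P n * x ^ n)"
    using a x \<open>a \<noteq> 0\<close> cQ
    by (simp add: n_def av_mult[OF w] av_power[OF w] place_abs_of_int[OF p] not_dvd_imp_multiplicity_0)
  also have "\<dots> = ?w (\<Sum>i<n. coeff P i * x ^ i)"
    unfolding eq using cQ x by (intro av_minus[OF w]) auto
  also have "\<dots> \<le> ?w x ^ (n - 1)"
  proof (rule nonarch_sum[OF w place_nonarch[OF p]])
    fix i assume i: "i \<in> {..<n}"
    have "?w (coeff P i * x ^ i) = ?w (coeff P i) * ?w x ^ i"
      using cQ x by (simp add: av_mult[OF w] av_power[OF w])
    also have "\<dots> \<le> 1 * ?w x ^ (n - 1)"
      using c1[of i] gt i by (intro mult_mono power_increasing) auto
    finally show "?w (coeff P i * x ^ i) \<le> ?w x ^ (n - 1)" by simp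
  qed (use gt cQ x in auto)
  finally have "?w x ^ n \<le> ?w x ^ (n - 1)" .
  moreover have "?w x ^ (n - 1) < ?w x ^ n" using gt n by (intro power_strict_increasing) auto
  ultimately show False by simp
qed

lemma finite_place_gt_1:
  assumes x: "x \<in> Qbar"
  shows "finite {v. is_place v \<and> place_abs v x > 1}"
proof -
  obtain P where P: "\<And>i. coeff P i \<in> \<int>" "P \<noteq> 0" "poly P x = 0"
    using x by (auto simp: Qbar_def algebraic_def)
  obtain a where a: "lead_coeff P = of_int a" using P(1)[of "degree P"] by (rule Ints_cases)
  have a0: "a \<noteq> 0" using a P(2) by auto
  have "{v. is_place v \<and> place_abs v x > 1} \<subseteq> insert 0 {p. p dvd nat \<bar>a\<bar>}"
  proof (rule subsetI, rule ccontr)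
    fix v assume "v \<in> {v. is_place v \<and> place_abs v x > 1}" "v \<notin> insert 0 {p. p dvd nat \<bar>a\<bar>}"
    then have v: "is_place v" "1 < place_abs v x" "\<not> v dvd nat \<bar>a\<bar>" "v \<noteq> 0" by auto
    show False
    proof -
      from v have "prime v" using v by (simp add: is_place_def)
      moreover have "\<not> int v dvd a" using v(3) by (simp add: nat_dvd_iff int_dvd_int_iff[symmetric])
      ultimately have "place_abs v x \<le> 1" by (rule place_abs_le_1[OF _ P a _ x])
      then show False using v(2) by simp
    qed
  qed
  moreover have "finite {p. p dvd nat \<bar>a\<bar>}" using a0 by (intro finite_divisors_nat) auto
  ultimately show ?thesis using finite_subset by blast
qed

lemma finite_place_neq_1:
  assumes x: "x \<in> Qbar" "x \<noteq> 0"
  shows "finite {v. is_place v \<and> place_abs v x \<noteq> 1}"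
proof -
  have "{v. is_place v \<and> place_abs v x \<noteq> 1}
      \<subseteq> {v. is_place v \<and> place_abs v x > 1} \<union> {v. is_place v \<and> place_abs v (inverse x) > 1}"
  proof clarify
    fix v assume v: "is_place v" "place_abs v x \<noteq> 1" "\<not> 1 < place_abs v (inverse x)"
    note w = place_abs_value[OF v(1)]
    show "1 < place_abs v x"
      using v av_inverse[OF w x(1)] av_pos[OF w x] by (auto simp: one_less_inverse_iff)
  qed
  then show ?thesis using finite_place_gt_1[of x] finite_place_gt_1[of "inverse x"] x
    by (meson Qbar_closed(5) finite_UnI finite_subset)
qed

section \<open>The product formula over the rationals\<close>

lemma multiplicity_int_nat:
  assumes p: "prime p" and a: "a \<noteq> 0"
  shows "multiplicity (int p) a = multiplicity p (nat \<bar>a\<bar>)"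
proof (rule antisym)
  have dv: "int p ^ k dvd a \<longleftrightarrow> p ^ k dvd nat \<bar>a\<bar>" for k
    by (metis int_dvd_int_iff dvd_abs_iff abs_ge_zero int_nat_eq of_nat_power)
  show "multiplicity (int p) a \<le> multiplicity p (nat \<bar>a\<bar>)"
    using a prime_gt_1_nat[OF p]
    by (intro multiplicity_geI iffD1[OF dv] multiplicity_dvd) auto
  have "\<not> is_unit (int p)" using prime_gt_1_nat[OF p] by (simp add: zdvd1_eq)
  then show "multiplicity p (nat \<bar>a\<bar>) \<le> multiplicity (int p) a"
    using a by (intro multiplicity_geI iffD2[OF dv] multiplicity_dvd)
qed

text \<open>By the prime factorization of |a|, the p-adic terms add up to - ln |a|, which cancels
  the archimedean term.\<close>

lemma product_formula_int:
  assumes a: "a \<noteq> 0" and V: "finite V" "0 \<in> V" "\<And>v. v \<in> V \<Longrightarrow> is_place v"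
    and dv: "\<And>p. prime p \<Longrightarrow> int p dvd a \<Longrightarrow> p \<in> V"
  shows "(\<Sum>v\<in>V. ln (place_abs v (of_int a))) = 0"
proof -
  define m where "m = nat \<bar>a\<bar>"
  have m0: "m > 0" using a by (simp add: m_def)
  have mult: "multiplicity (int p) a = multiplicity p m" if "prime p" for p
    using that a by (simp add: m_def multiplicity_int_nat)
  have sub: "prime_factors m \<subseteq> V - {0}"
  proof
    fix p assume "p \<in> prime_factors m"
    then have p: "prime p" "p dvd m" by (auto simp: prime_factors_dvd)
    then have "int p dvd a" by (simp add: m_def nat_dvd_iff int_dvd_int_iff[symmetric])
    then show "p \<in> V - {0}" using p dv by auto
  qed
  have "(\<Sum>v\<in>V - {0}. ln (place_abs v (of_int a))) = (\<Sum>v\<in>V - {0}. - (real (multiplicity v m) * ln (real v)))"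
  proof (rule sum.cong)
    fix v assume v: "v \<in> V - {0}"
    then have p: "prime v" using V by (auto simp: is_place_def)
    then have "real v > 0" by (simp add: prime_gt_0_nat)
    then show "ln (place_abs v (of_int a)) = - (real (multiplicity v m) * ln (real v))"
      by (simp add: place_abs_of_int[OF p a] mult[OF p] power_int_minus ln_inverse ln_realpow)
  qed simp
  also have "\<dots> = (\<Sum>v\<in>prime_factors m. - (real (multiplicity v m) * ln (real v)))"
  proof (rule sum.mono_neutral_right)
    show "\<forall>i\<in>V - {0} - prime_factors m. - (real (multiplicity i m) * ln (real i)) = 0"
    proof
      fix i assume i: "i \<in> V - {0} - prime_factors m"
      then have "prime i" using V by (auto simp: is_place_def)
      then have "\<not> i dvd m" using i m0 by (auto simp: prime_factors_dvd)
      then show "- (real (multiplicity i m) * ln (real i)) = 0" by (simp add: not_dvd_imp_multiplicity_0)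
    qed
  qed (use V sub in auto)
  also have "\<dots> = - ln (\<Prod>v\<in>prime_factors m. real v ^ multiplicity v m)"
  proof -
    have "real v > 0" if "v \<in> prime_factors m" for v
      using that by (simp add: in_prime_factors_iff prime_gt_0_nat)
    then have "real v ^ multiplicity v m \<noteq> 0" "ln (real v ^ multiplicity v m) = multiplicity v m * ln v"
      if "v \<in> prime_factors m" for v using that by (force, simp add: ln_realpow)
    then show ?thesis by (subst ln_prod) (simp_all add: sum_negf)
  qed
  also have "(\<Prod>v\<in>prime_factors m. real v ^ multiplicity v m) = real (\<Prod>v\<in>prime_factors m. v ^ multiplicity v m)"
    by simp
  also have "(\<Prod>v\<in>prime_factors m. v ^ multiplicity v m) = m"
    using m0 by (rule prime_factorization_nat[symmetric])
  finally have "(\<Sum>v\<in>V - {0}. ln (place_abs v (of_int a))) = - ln (real m)" .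
  moreover have "ln (place_abs 0 (of_int a)) = ln (real m)"
    by (simp add: place_abs_def m_def)
  ultimately show ?thesis using V by (simp add: sum.remove)
qed

lemma product_formula_rat:
  assumes r: "r \<noteq> 0" and V: "finite V" "0 \<in> V" "\<And>v. v \<in> V \<Longrightarrow> is_place v"
    and dv: "\<And>v. is_place v \<Longrightarrow> place_abs v (of_rat r) \<noteq> 1 \<Longrightarrow> v \<in> V"
  shows "(\<Sum>v\<in>V. ln (place_abs v (of_rat r))) = 0"
proof -
  obtain a b where ab: "quotient_of r = (a, b)" by force
  then have r': "r = of_int a / of_int b" and b: "b > 0"
    by (auto simp: quotient_of_div quotient_of_denom_pos)
  have a: "a \<noteq> 0" using r r' by auto
  \<comment> \<open>Numerator and denominator need the primes dividing either of them; enlarging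
    \<open>V\<close> by these adds only zero terms for r.\<close>
  define W where "W = V \<union> {p. prime p \<and> int p dvd a * b}"
  have "{p. prime p \<and> int p dvd a * b} \<subseteq> {p. p dvd nat \<bar>a * b\<bar>}"
    by (auto simp: nat_dvd_iff int_dvd_int_iff[symmetric] prime_gt_0_nat)
  moreover have "finite {p. p dvd nat \<bar>a * b\<bar>}" using a b by (intro finite_divisors_nat) auto
  ultimately have W: "finite W" "0 \<in> W" "\<And>v. v \<in> W \<Longrightarrow> is_place v"
    using V by (auto simp: W_def is_place_def intro: finite_subset dest: prime_gt_0_nat)
  have "(\<Sum>v\<in>V. ln (place_abs v (of_rat r))) = (\<Sum>v\<in>W. ln (place_abs v (of_rat r)))"
  proof (rule sum.mono_neutral_left)
    show "\<forall>i\<in>W - V. ln (place_abs i (of_rat r)) = 0"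
      using dv W(3) by (metis DiffD1 DiffD2 ln_one)
  qed (use W in \<open>auto simp: W_def\<close>)
  also have "\<dots> = (\<Sum>v\<in>W. ln (place_abs v (of_int a)) - ln (place_abs v (of_int b)))"
  proof (rule sum.cong)
    fix v assume "v \<in> W"
    then have w: "absolute_value_on Qbar (place_abs v)" using W place_abs_value by auto
    have "place_abs v (of_int a) = place_abs v (of_rat r * of_int b)"
      using b by (simp add: r' of_rat_divide)
    also have "\<dots> = place_abs v (of_rat r) * place_abs v (of_int b)" by (simp add: av_mult[OF w])
    finally show "ln (place_abs v (of_rat r)) = ln (place_abs v (of_int a)) - ln (place_abs v (of_int b))"
      using av_pos[OF w, of "of_rat r"] av_pos[OF w, of "of_int b"] r b by (simp add: ln_mult)
  qed simp
  also have "\<dots> = 0"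
    using product_formula_int[OF a W] product_formula_int[of b W] b W
    by (simp add: sum_subtractf W_def)
  finally show ?thesis .
qed

text \<open>Any finite \<open>V\<close> containing the places that contribute will do, so several
  numbers can share one \<open>V\<close>.\<close>

lemma weil_height_finite_sum:
  assumes x: "x \<in> Qbar" and V: "finite V" "0 \<in> V" "\<And>v. v \<in> V \<Longrightarrow> is_place v"
    and supp: "\<And>v y. is_place v \<Longrightarrow> y \<in> conjugates x \<Longrightarrow> place_abs v y > 1 \<Longrightarrow> v \<in> V"
  shows "weil_height x = (\<Sum>y\<in>conjugates x. \<Sum>v\<in>V. logp (place_abs v y)) / real (card (conjugates x))"
proof -
  have c: "real (card (conjugates x)) \<noteq> 0"
    using finite_conjugates[OF x] conjugates_refl[OF x] by auto
  have "(\<Sum>\<^sub>\<infinity>p\<in>{p. prime p}. \<Sum>y\<in>conjugates x. ln (max 1 (padic_abs_ext p y)))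
      = (\<Sum>\<^sub>\<infinity>p\<in>V - {0}. \<Sum>y\<in>conjugates x. logp (place_abs p y))"
  proof (rule infsum_cong_neutral)
    fix p assume p: "p \<in> {p. prime p} - (V - {0})"
    have "ln (max 1 (padic_abs_ext p y)) = 0" if "y \<in> conjugates x" for y
    proof -
      have "p \<noteq> 0" "is_place p" using p by (auto simp: is_place_def dest: prime_gt_0_nat)
      then have "\<not> place_abs p y > 1" using supp[OF _ that] p by auto
      then show ?thesis using \<open>p \<noteq> 0\<close> by (simp add: place_abs_def max_def)
    qed
    then show "(\<Sum>y\<in>conjugates x. ln (max 1 (padic_abs_ext p y))) = 0" by simp
  next
    fix p assume "p \<in> V - {0} - {p. prime p}"
    then show "(\<Sum>y\<in>conjugates x. logp (place_abs p y)) = 0"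
      using V(3)[of p] by (auto simp: is_place_def)
  next
    fix p assume "p \<in> {p. prime p} \<inter> (V - {0})"
    then show "(\<Sum>y\<in>conjugates x. ln (max 1 (padic_abs_ext p y))) = (\<Sum>y\<in>conjugates x. logp (place_abs p y))"
      by (simp add: logp_def place_abs_def)
  qed
  also have "\<dots> = (\<Sum>p\<in>V - {0}. \<Sum>y\<in>conjugates x. logp (place_abs p y))"
    using V by simp
  finally have "weil_height x * card (conjugates x)
      = (\<Sum>y\<in>conjugates x. logp (place_abs 0 y)) + (\<Sum>p\<in>V - {0}. \<Sum>y\<in>conjugates x. logp (place_abs p y))"
    using c by (simp add: weil_height_def logp_def place_abs_def)
  also have "\<dots> = (\<Sum>p\<in>V. \<Sum>y\<in>conjugates x. logp (place_abs p y))"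
    using V by (simp add: sum.remove)
  also have "\<dots> = (\<Sum>y\<in>conjugates x. \<Sum>v\<in>V. logp (place_abs v y))"
    by (rule sum.swap)
  finally show ?thesis
    using c by (simp add: eq_divide_eq)
qed

section \<open>Heights through a common family of absolute values\<close>

text \<open>Separability in characteristic 0: write P = (X - z) Q. If \<open>Q\<close> were not
  constant, its root would again be z, so z would be a root of the derivative of \<open>P\<close>.
  Then \<open>P\<close> would divide its nonzero derivative, which has smaller degree. Hence
  \<open>P\<close> is linear.\<close>

lemma irreducible_unique_root_rational:
  assumes z: "z \<in> Qbar" and c: "conjugates z \<subseteq> {z}"
  shows "z \<in> \<rat>"
proof -
  let ?c = "map_poly of_rat :: rat poly \<Rightarrow> complex poly"
  obtain P where P: "irreducible P" "poly (?c P) z = 0" using ex_irreducible_root[OF z] by blast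
  have P0: "P \<noteq> 0" using P by auto
  have deg: "degree (?c P) = degree P" by (rule degree_map_poly) auto
  have dP: "degree P \<noteq> 0"
  proof
    assume "degree P = 0"
    then obtain a where "P = [:a:]" using degree_eq_zeroE by blast
    then show False using P P0 by (auto simp: map_poly_pCons)
  qed
  have only: "w = z" if "poly (?c P) w = 0" for w
    using that P c by (auto simp: conjugates_def)
  have "[:- z, 1:] dvd ?c P" using P(2) by (simp add: poly_eq_0_iff_dvd)
  then obtain Q where Q: "?c P = [:- z, 1:] * Q" by (rule dvdE)
  have Q0: "Q \<noteq> 0"
  proof
    assume "Q = 0"
    then have "degree (?c P) = 0" using Q by simp
    then show False using deg dP by simp
  qed
  have dQ: "degree P = Suc (degree Q)"
  proof -
    have "degree (?c P) = degree [:- z, 1:] + degree Q"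
      unfolding Q by (rule degree_mult_eq) (use Q0 in auto)
    then show ?thesis by (simp add: deg)
  qed
  have "degree Q = 0"
  proof (rule ccontr)
    assume "degree Q \<noteq> 0"
    then have "\<not> constant (poly Q)" by (simp add: constant_degree)
    then obtain w where w: "poly Q w = 0" using fundamental_theorem_of_algebra by blast
    then have "w = z" by (intro only) (simp add: Q)
    then have "poly (pderiv (?c P)) z = 0" using w unfolding Q pderiv_mult by (simp add: pderiv_pCons)
    moreover have "pderiv (?c P) = ?c (pderiv P)"
      by (rule poly_eqI) (simp add: coeff_pderiv coeff_map_poly of_rat_mult of_rat_add)
    ultimately have "P dvd pderiv P" by (intro irreducible_root_dvd[OF P]) simp
    moreover have "pderiv P \<noteq> 0" using dP by (simp add: pderiv_eq_0_iff)
    ultimately have "degree P \<le> degree (pderiv P)" by (rule dvd_imp_degree_le)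
    then show False using dP by (simp add: degree_pderiv)
  qed
  then have "degree P = 1" using dQ by simp
  then obtain a b where ab: "P = [:a, b:]" "b \<noteq> 0" using degree1_coeffs by metis
  have "of_rat a + z * of_rat b = (0 :: complex)" using P(2) by (simp add: ab map_poly_pCons)
  then have "z = of_rat (- a / b)"
    using ab(2) by (simp add: of_rat_divide of_rat_minus field_simps add_eq_0_iff)
  then show ?thesis by simp
qed

text \<open>Every conjugate is the image of z under some embedding, so a fixed z is its own only
  conjugate. This takes the place of a Galois correspondence.\<close>

lemma fixed_imp_rational:
  assumes z: "z \<in> Qbar" and fx: "\<And>\<tau>. qhom \<tau> \<Longrightarrow> \<tau> z = z"
  shows "z \<in> \<rat>"
  using ex_qhom_conjugate[OF z] fx by (intro irreducible_unique_root_rational[OF z]) force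

text \<open>
  On a finite set of algebraic numbers stable under conjugation the embeddings act through a
  finite group; the set \<open>G\<close> below represents it. Left translations being injective, each
  conjugate of \<open>x\<close> is hit equally often.
\<close>

lemma ex_galois_representatives:
  assumes X: "finite X" "X \<subseteq> Qbar"
  obtains G where "finite G" "\<And>g. g \<in> G \<Longrightarrow> qhom g"
    "\<And>x \<phi>. x \<in> X \<Longrightarrow> real (card (conjugates x)) * (\<Sum>g\<in>G. \<phi> (g x)) = real (card G) * (\<Sum>y\<in>conjugates x. \<phi> y :: real)"
    "\<And>x. x \<in> X \<Longrightarrow> (\<Prod>g\<in>G. g x) \<in> \<rat>" "G \<noteq> {}"
proof -
  define S where "S = (\<Union>x\<in>X. conjugates x)"
  have S: "finite S" "S \<subseteq> Qbar"
    using X finite_conjugates conjugates_subset_Qbar by (auto simp: S_def)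
  have stable: "\<tau> x \<in> S" if "qhom \<tau>" "x \<in> S" for \<tau> x
    using that X qhom_conjugates conjugates_eq S(2) unfolding S_def by (metis UN_iff subsetD)
  have XS: "x \<in> S" if "x \<in> X" for x using that X conjugates_refl by (auto simp: S_def)
  define A where "A = (\<lambda>\<sigma>. restrict \<sigma> S) ` Collect qhom"
  have "A \<subseteq> S \<rightarrow>\<^sub>E S" using stable by (auto simp: A_def)
  then have finA: "finite A" using finite_PiE[OF S(1), of "\<lambda>_. S"] S(1) finite_subset by auto
  \<comment> \<open>One embedding is chosen for each restriction to \<open>S\<close>, so that
    elements of \<open>G\<close> that agree on \<open>S\<close> are equal.\<close>
  define rep where "rep = (\<lambda>r. SOME \<sigma>. qhom \<sigma> \<and> restrict \<sigma> S = r)"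
  have rep: "qhom (rep r) \<and> restrict (rep r) S = r" if "r \<in> A" for r
  proof -
    have "\<exists>\<sigma>. qhom \<sigma> \<and> restrict \<sigma> S = r" using that unfolding A_def by blast
    then show ?thesis unfolding rep_def by (rule someI_ex)
  qed
  define G where "G = rep ` A"
  have finG: "finite G" using finA by (simp add: G_def)
  have Gq: "qhom g" if "g \<in> G" for g using that rep by (auto simp: G_def)
  have Geq: "g = h" if gh: "g \<in> G" "h \<in> G" "\<And>x. x \<in> S \<Longrightarrow> g x = h x" for g h
  proof -
    obtain r s where rs: "r \<in> A" "s \<in> A" "g = rep r" "h = rep s" using gh by (auto simp: G_def)
    have "restrict g S = restrict h S" using gh(3) by (auto simp: restrict_def)
    then have "r = s" using rep rs by metis
    then show ?thesis using rs by simp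
  qed
  \<comment> \<open>\<open>R\<close> returns a composite to \<open>G\<close>, replacing it by the
    representative with the same values on \<open>S\<close>.\<close>
  define R where "R = (\<lambda>\<sigma>. rep (restrict \<sigma> S))"
  have RG: "R \<sigma> \<in> G" and Rx: "x \<in> S \<Longrightarrow> R \<sigma> x = \<sigma> x" if "qhom \<sigma>" for \<sigma> x
  proof -
    have *: "restrict \<sigma> S \<in> A" using that by (auto simp: A_def)
    then show "R \<sigma> \<in> G" by (simp add: R_def G_def)
    have "restrict (R \<sigma>) S = restrict \<sigma> S" using rep[OF *] by (simp add: R_def)
    then show "x \<in> S \<Longrightarrow> R \<sigma> x = \<sigma> x" by (metis restrict_apply')
  qed
  have trans_inj: "inj_on (\<lambda>g. R (\<tau> \<circ> g)) G" and trans_app: "\<And>g x. g \<in> G \<Longrightarrow> x \<in> S \<Longrightarrow> R (\<tau> \<circ> g) x = \<tau> (g x)"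
    and trans_G: "\<And>g. g \<in> G \<Longrightarrow> R (\<tau> \<circ> g) \<in> G" if t: "qhom \<tau>" for \<tau>
  proof -
    show app: "R (\<tau> \<circ> g) x = \<tau> (g x)" if "g \<in> G" "x \<in> S" for g x
      using Rx[OF qhom_comp[OF t Gq[OF that(1)]] that(2)] by simp
    show "R (\<tau> \<circ> g) \<in> G" if "g \<in> G" for g
      using RG[OF qhom_comp[OF t Gq[OF that]]] .
    show "inj_on (\<lambda>g. R (\<tau> \<circ> g)) G"
    proof (rule inj_onI)
      fix g h assume gh: "g \<in> G" "h \<in> G" "R (\<tau> \<circ> g) = R (\<tau> \<circ> h)"
      have "g x = h x" if x: "x \<in> S" for x
      proof -
        have "\<tau> (g x) = \<tau> (h x)" using app[OF gh(1) x] app[OF gh(2) x] gh(3) by simp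
        then show ?thesis
          using inj_onD[OF qhom_inj[OF t]] stable Gq gh x S(2) by (meson subsetD)
      qed
      then show "g = h" using Geq gh by blast
    qed
  qed
  \<comment> \<open>Translation by an embedding that carries y to z bounds one fibre by the other;
    with y and z exchanged this gives equality of all fibres.\<close>
  define N where "N = (\<lambda>x y. card {g\<in>G. g x = y})"
  have Nle: "N x y \<le> N x z" if x: "x \<in> X" and yz: "y \<in> conjugates x" "z \<in> conjugates x" for x y z
  proof -
    have yQ: "y \<in> Qbar" using conjugates_subset_Qbar x X yz by blast
    have "z \<in> conjugates y" using conjugates_eq[OF _ yz(1)] yz(2) x X by auto
    then obtain \<tau> where t: "qhom \<tau>" "\<tau> y = z" using ex_qhom_conjugate[OF yQ] by blast
    show ?thesis
      unfolding N_def
    proof (rule card_inj_on_le)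
      show "inj_on (\<lambda>g. R (\<tau> \<circ> g)) {g\<in>G. g x = y}"
        using trans_inj[OF t(1)] by (rule inj_on_subset) auto
      show "(\<lambda>g. R (\<tau> \<circ> g)) ` {g\<in>G. g x = y} \<subseteq> {g\<in>G. g x = z}"
        using trans_G[OF t(1)] trans_app[OF t(1)] XS[OF x] t(2) by auto
      show "finite {g\<in>G. g x = z}" using finG by simp
    qed
  qed
  show thesis
  proof (rule that[OF finG Gq])
    fix x and \<phi> :: "complex \<Rightarrow> real" assume x: "x \<in> X"
    then have xQ: "x \<in> Qbar" using X by auto
    have fib: "(\<Sum>g\<in>G. \<psi> (g x)) = real (N x x) * (\<Sum>y\<in>conjugates x. \<psi> y)" for \<psi> :: "complex \<Rightarrow> real"
    proof -
      have "(\<Sum>g\<in>G. \<psi> (g x)) = (\<Sum>y\<in>conjugates x. \<Sum>g\<in>{g\<in>G. g x = y}. \<psi> (g x))"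
        using finG finite_conjugates[OF xQ] qhom_conjugates[OF Gq xQ]
        by (intro sum.group[symmetric]) auto
      also have "\<dots> = (\<Sum>y\<in>conjugates x. real (N x y) * \<psi> y)"
        by (intro sum.cong) (auto simp: N_def)
      also have "\<dots> = (\<Sum>y\<in>conjugates x. real (N x x) * \<psi> y)"
        using Nle[OF x] conjugates_refl[OF xQ] by (intro sum.cong) (auto intro: antisym)
      finally show ?thesis by (simp add: sum_distrib_left)
    qed
    have "real (card G) = real (N x x) * real (card (conjugates x))"
      using fib[of "\<lambda>_. 1"] by simp
    then show "real (card (conjugates x)) * (\<Sum>g\<in>G. \<phi> (g x)) = real (card G) * (\<Sum>y\<in>conjugates x. \<phi> y)"
      by (simp add: fib)
  next
    fix x assume x: "x \<in> X"
    \<comment> \<open>z is a power of the product of all conjugates of x. An embedding only permutes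
      the factors.\<close>
    define z where "z = (\<Prod>g\<in>G. g x)"
    have gQ: "g x \<in> Qbar" if "g \<in> G" for g using qhom_Qbar[OF Gq[OF that]] x X by auto
    have "z \<in> Qbar" unfolding z_def using gQ by auto
    moreover have "\<tau> z = z" if t: "qhom \<tau>" for \<tau>
    proof -
      have "\<tau> z = (\<Prod>g\<in>G. \<tau> (g x))" unfolding z_def using gQ by (rule qhom_prod[OF t])
      also have "\<dots> = (\<Prod>g\<in>G. (R (\<tau> \<circ> g)) x)" using trans_app[OF t _ XS[OF x]] by simp
      also have "\<dots> = (\<Prod>h\<in>(\<lambda>g. R (\<tau> \<circ> g)) ` G. h x)"
        using prod.reindex[OF trans_inj[OF t], of "\<lambda>h. h x"] by simp
      also have "(\<lambda>g. R (\<tau> \<circ> g)) ` G = G"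
        using trans_G[OF t] finG trans_inj[OF t] by (intro endo_inj_surj) auto
      finally show ?thesis by (simp add: z_def)
    qed
    ultimately show "(\<Prod>g\<in>G. g x) \<in> \<rat>" unfolding z_def by (rule fixed_imp_rational)
  next
    show "G \<noteq> {}" using RG[OF qhom_id] by auto
  qed
qed

text \<open>
  The absolute values \<open>w\<close> are indexed by pairs of an embedding and a place; \<open>A\<close> collects the
  archimedean ones, so that \<open>card A\<close> is the number of embeddings.
\<close>

type_synonym frame_index = "(complex \<Rightarrow> complex) \<times> nat"

definition height_frame :: "complex set \<Rightarrow> frame_index set \<Rightarrow> frame_index set \<Rightarrow>
    (frame_index \<Rightarrow> complex \<Rightarrow> real) \<Rightarrow> bool" where
  "height_frame X I A w \<longleftrightarrow> finite I \<and> A \<subseteq> I \<and> A \<noteq> {} \<and>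
     (\<forall>i\<in>I. absolute_value_on Qbar (w i)) \<and> (\<forall>i\<in>I - A. nonarch (w i)) \<and>
     (\<forall>x\<in>X. real (card A) * weil_height x = (\<Sum>i\<in>I. logp (w i x))) \<and>
     (\<forall>x\<in>X. x \<noteq> 0 \<longrightarrow> (\<Sum>i\<in>I. ln (w i x)) = 0)"

text \<open>The index (g, v) stands for the absolute value |g x|_v. Averaging over \<open>G\<close>
  is averaging over the conjugates, which gives the height of each element of
  \<open>X\<close>.\<close>

lemma ex_height_frame:
  assumes X: "finite X" "X \<subseteq> Qbar"
  shows "\<exists>I A w. height_frame X I A w"
proof -
  obtain G where G: "finite G" "\<And>g. g \<in> G \<Longrightarrow> qhom g"
    "\<And>x \<phi>. x \<in> X \<Longrightarrow> real (card (conjugates x)) * (\<Sum>g\<in>G. \<phi> (g x)) = real (card G) * (\<Sum>y\<in>conjugates x. \<phi> y :: real)"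
    "\<And>x. x \<in> X \<Longrightarrow> (\<Prod>g\<in>G. g x) \<in> \<rat>" "G \<noteq> {}"
    using ex_galois_representatives[OF X] by metis
  define S where "S = (\<Union>x\<in>X. conjugates x)"
  have S: "finite S" "S \<subseteq> Qbar"
    using X finite_conjugates conjugates_subset_Qbar by (auto simp: S_def)
  \<comment> \<open>The first family carries all heights of elements of \<open>X\<close>; the second
    ensures that logarithms of nonzero conjugates vanish outside \<open>V\<close>.\<close>
  define V where "V = insert 0 ((\<Union>y\<in>S. {v. is_place v \<and> place_abs v y > 1})
      \<union> (\<Union>y\<in>S - {0}. {v. is_place v \<and> place_abs v y \<noteq> 1}))"
  have V: "finite V" "0 \<in> V" "\<And>v. v \<in> V \<Longrightarrow> is_place v"
    using S finite_place_gt_1 finite_place_neq_1 by (auto simp: V_def is_place_def)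
  define I where "I = G \<times> V"
  define A where "A = G \<times> {0 :: nat}"
  define w where "w = (\<lambda>(g :: complex \<Rightarrow> complex, v) x. place_abs v (g x))"
  have cA: "card A = card G" using G by (simp add: A_def)
  have "height_frame X I A w"
    unfolding height_frame_def
  proof (intro conjI ballI impI)
    show "finite I" "A \<subseteq> I" "A \<noteq> {}" using G V by (auto simp: I_def A_def)
    show "absolute_value_on Qbar (w i)" if "i \<in> I" for i
      using that V(3) G(2) av_qhom[OF place_abs_value] by (auto simp: I_def w_def)
    show "nonarch (w i)" if iIA: "i \<in> I - A" for i
    proof -
      obtain g v where i: "i = (g, v)" "g \<in> G" "v \<in> V" "v \<noteq> 0"
        using iIA by (cases i) (auto simp: I_def A_def)
      then have "prime v" using V(3)[of v] by (simp add: is_place_def)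
      from place_nonarch[OF this] G(2)[OF i(2)] show ?thesis
        by (simp add: nonarch_def w_def i qhom_Qbar qhom_add)
    qed
    fix x assume x: "x \<in> X"
    then have xQ: "x \<in> Qbar" using X by auto
    have cc: "real (card (conjugates x)) > 0"
      using finite_conjugates[OF xQ] conjugates_refl[OF xQ] by (auto simp: card_gt_0_iff)
    have "weil_height x = (\<Sum>y\<in>conjugates x. \<Sum>v\<in>V. logp (place_abs v y)) / real (card (conjugates x))"
      by (rule weil_height_finite_sum[OF xQ V]) (use x in \<open>auto simp: V_def S_def\<close>)
    then have "real (card (conjugates x)) * (real (card A) * weil_height x)
        = real (card G) * (\<Sum>y\<in>conjugates x. \<Sum>v\<in>V. logp (place_abs v y))"
      using cc by (simp add: cA)
    also have "\<dots> = real (card (conjugates x)) * (\<Sum>g\<in>G. \<Sum>v\<in>V. logp (place_abs v (g x)))"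
      using G(3)[OF x, of "\<lambda>y. \<Sum>v\<in>V. logp (place_abs v y)"] by simp
    finally have "real (card A) * weil_height x = (\<Sum>g\<in>G. \<Sum>v\<in>V. logp (place_abs v (g x)))"
      using cc by simp
    then show "real (card A) * weil_height x = (\<Sum>i\<in>I. logp (w i x))"
      by (simp add: I_def w_def sum.cartesian_product split_beta)
    assume x0: "x \<noteq> 0"
    have gx: "g x \<in> Qbar" "g x \<noteq> 0" "g x \<in> S" if "g \<in> G" for g
      using qhom_Qbar[OF G(2)[OF that] xQ] qhom_nonzero[OF G(2)[OF that] xQ x0]
        qhom_conjugates[OF G(2)[OF that] xQ] x by (auto simp: S_def)
    \<comment> \<open>Multiplicativity collects the logarithms over \<open>G\<close> into those of
      the rational number z, where the product formula is known.\<close>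
    define z where "z = (\<Prod>g\<in>G. g x)"
    obtain r where r: "z = of_rat r" using G(4)[OF x] by (auto simp: z_def elim: Rats_cases)
    have z0: "z \<noteq> 0" using gx G(1) by (auto simp: z_def)
    have wz: "place_abs v z = (\<Prod>g\<in>G. place_abs v (g x))" if "is_place v" for v
      unfolding z_def by (intro av_prod place_abs_value that gx)
    have "(\<Sum>i\<in>I. ln (w i x)) = (\<Sum>g\<in>G. \<Sum>v\<in>V. ln (place_abs v (g x)))"
      by (simp add: I_def w_def sum.cartesian_product split_beta)
    also have "\<dots> = (\<Sum>v\<in>V. \<Sum>g\<in>G. ln (place_abs v (g x)))"
      by (rule sum.swap)
    also have "\<dots> = (\<Sum>v\<in>V. ln (place_abs v z))"
    proof (rule sum.cong)
      fix v assume v: "v \<in> V"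
      have "place_abs v (g x) \<noteq> 0" if "g \<in> G" for g
        using av_pos[OF place_abs_value[OF V(3)[OF v]] gx(1,2)[OF that]] by simp
      then show "(\<Sum>g\<in>G. ln (place_abs v (g x))) = ln (place_abs v z)"
        using G(1) by (simp add: wz[OF V(3)[OF v]] ln_prod)
    qed simp
    also have "\<dots> = 0"
      unfolding r
    proof (rule product_formula_rat[OF _ V])
      show "r \<noteq> 0" using z0 r by auto
      fix v assume v: "is_place v" "place_abs v (of_rat r) \<noteq> 1"
      then have "(\<Prod>g\<in>G. place_abs v (g x)) \<noteq> 1" using wz[OF v(1)] r by simp
      then obtain g where g: "g \<in> G" "place_abs v (g x) \<noteq> 1" by (metis prod.neutral)
      then show "v \<in> V" using gx[OF g(1)] v(1) by (auto simp: V_def)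
    qed
    finally show "(\<Sum>i\<in>I. ln (w i x)) = 0" .
  qed
  then show ?thesis by blast
qed

text \<open>A sum rather than a maximum on the right, because it becomes a sum of heights after
  summation over a frame.\<close>

lemma logp_sum_le:
  assumes w: "absolute_value_on Qbar w" and I: "finite I" "I \<noteq> {}" "\<And>i. i \<in> I \<Longrightarrow> f i \<in> Qbar"
  shows "logp (w (sum f I)) \<le> ln (real (card I)) + (\<Sum>i\<in>I. logp (w (f i)))"
    "nonarch w \<Longrightarrow> logp (w (sum f I)) \<le> (\<Sum>i\<in>I. logp (w (f i)))"
proof -
  define B where "B = (\<Sum>i\<in>I. logp (w (f i)))"
  have B: "w (f i) \<le> exp B" if i: "i \<in> I" for i
  proof -
    have "logp (w (f i)) \<le> B"
      unfolding B_def using I(1) i by (intro member_le_sum) (auto simp: logp_nonneg)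
    then show ?thesis by (simp add: logp_le_iff)
  qed
  have B0: "1 \<le> exp B" by (simp add: B_def sum_nonneg logp_nonneg)
  have c: "real (card I) \<ge> 1" using I by (simp add: Suc_le_eq card_gt_0_iff)
  have "w (sum f I) \<le> (\<Sum>i\<in>I. w (f i))" by (rule av_sum[OF w I(3)])
  also have "\<dots> \<le> real (card I) * exp B" using B by (intro sum_bounded_above) auto
  finally have "max 1 (w (sum f I)) \<le> real (card I) * exp B"
    using mult_mono[OF c B0] by simp
  also have "\<dots> = exp (ln (real (card I)) + B)" using c by (simp add: exp_add)
  finally show "logp (w (sum f I)) \<le> ln (real (card I)) + B" by (simp only: logp_le_iff)
  assume "nonarch w"
  then have "w (sum f I) \<le> exp B" by (intro nonarch_sum[OF w] I(3) B) auto
  then show "logp (w (sum f I)) \<le> B" using B0 by (simp add: logp_le_iff)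
qed

section \<open>Properties of the Weil height\<close>

lemma height_frameD:
  assumes "height_frame X I A w"
  shows "finite I" "A \<subseteq> I" "real (card A) > 0"
    "\<And>i. i \<in> I \<Longrightarrow> absolute_value_on Qbar (w i)" "\<And>i. i \<in> I - A \<Longrightarrow> nonarch (w i)"
    "\<And>x. x \<in> X \<Longrightarrow> real (card A) * weil_height x = (\<Sum>i\<in>I. logp (w i x))"
    "\<And>x. x \<in> X \<Longrightarrow> x \<noteq> 0 \<Longrightarrow> (\<Sum>i\<in>I. ln (w i x)) = 0"
proof -
  have "finite A" "A \<noteq> {}" using assms unfolding height_frame_def by (auto intro: finite_subset)
  then show "real (card A) > 0" by (simp add: card_gt_0_iff)
qed (use assms in \<open>auto simp: height_frame_def\<close>)

lemma weil_height_nonneg: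
  assumes "x \<in> Qbar" shows "0 \<le> weil_height x"
proof -
  obtain I A w where "height_frame {x} I A w"
    using ex_height_frame[of "{x}"] assms by auto
  note F = height_frameD[OF this]
  have "0 \<le> (\<Sum>i\<in>I. logp (w i x))" by (simp add: sum_nonneg logp_nonneg)
  then have "0 \<le> real (card A) * weil_height x" using F(6) by simp
  then show ?thesis using F(3) by (simp add: zero_le_mult_iff)
qed

lemma weil_height_conjugate: "x \<in> Qbar \<Longrightarrow> y \<in> conjugates x \<Longrightarrow> weil_height y = weil_height x"
  by (simp add: weil_height_def conjugates_eq)

lemma weil_height_mult:
  assumes x: "x \<in> Qbar" and y: "y \<in> Qbar"
  shows "weil_height (x * y) \<le> weil_height x + weil_height y"
proof -
  obtain I A w where "height_frame {x, y, x * y} I A w"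
    using ex_height_frame[of "{x, y, x * y}"] x y by auto
  note F = height_frameD[OF this]
  have "(\<Sum>i\<in>I. logp (w i (x * y))) \<le> (\<Sum>i\<in>I. logp (w i x) + logp (w i y))"
    using x y by (intro sum_mono) (simp add: av_mult[OF F(4)] logp_mult av_nonneg[OF F(4)])
  then have "real (card A) * weil_height (x * y) \<le> real (card A) * (weil_height x + weil_height y)"
    using F(6) by (simp add: sum.distrib distrib_left)
  then show ?thesis using F(3) by simp
qed

lemma weil_height_inverse:
  assumes x: "x \<in> Qbar"
  shows "weil_height (inverse x) = weil_height x"
proof (cases "x = 0")
  case False
  obtain I A w where "height_frame {x, inverse x} I A w"
    using ex_height_frame[of "{x, inverse x}"] x by auto
  note F = height_frameD[OF this]
  have "(\<Sum>i\<in>I. logp (w i (inverse x))) = (\<Sum>i\<in>I. logp (w i x) - ln (w i x))"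
    using x False by (intro sum.cong) (simp_all add: av_inverse[OF F(4)] logp_inverse av_pos[OF F(4)])
  then have "real (card A) * weil_height (inverse x) = real (card A) * weil_height x"
    using F(6,7) False by (simp add: sum_subtractf)
  then show ?thesis using F(3) by simp
qed simp

lemma weil_height_minus:
  assumes x: "x \<in> Qbar"
  shows "weil_height (- x) = weil_height x"
proof -
  obtain I A w where "height_frame {x, - x} I A w"
    using ex_height_frame[of "{x, - x}"] x by auto
  note F = height_frameD[OF this]
  have "(\<Sum>i\<in>I. logp (w i (- x))) = (\<Sum>i\<in>I. logp (w i x))"
    using x by (intro sum.cong) (simp_all add: av_minus[OF F(4)])
  then have "real (card A) * weil_height (- x) = real (card A) * weil_height x" using F(6) by simp
  then show ?thesis using F(3) by simp
qed

lemma weil_height_0: "weil_height 0 = 0"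
  and weil_height_1: "weil_height 1 = 0"
proof -
  obtain I A w where "height_frame {0, 1} I A w"
    using ex_height_frame[of "{0, 1}"] by auto
  note F = height_frameD[OF this]
  have "(\<Sum>i\<in>I. logp (w i 0)) = 0" "(\<Sum>i\<in>I. logp (w i 1)) = 0"
    by (simp_all add: av_0[OF F(4)] av_1[OF F(4)] logp_def)
  then show "weil_height 0 = 0" "weil_height 1 = 0" using F(6)[of 0] F(6)[of 1] F(3) by auto
qed

lemma weil_height_prod:
  "(\<And>j. j \<in> J \<Longrightarrow> f j \<in> Qbar) \<Longrightarrow> weil_height (prod f J) \<le> (\<Sum>j\<in>J. weil_height (f j))"
proof (induction J rule: infinite_finite_induct)
  case (insert j J)
  then show ?case using weil_height_mult[of "f j" "prod f J"] by auto
qed (auto simp: weil_height_1)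

lemma weil_height_sum:
  assumes J: "finite J" "J \<noteq> {}" "\<And>j. j \<in> J \<Longrightarrow> f j \<in> Qbar"
  shows "weil_height (sum f J) \<le> ln (real (card J)) + (\<Sum>j\<in>J. weil_height (f j))"
proof -
  obtain I A w where "height_frame (insert (sum f J) (f ` J)) I A w"
    using ex_height_frame[of "insert (sum f J) (f ` J)"] J by auto
  note F = height_frameD[OF this]
  \<comment> \<open>Only archimedean indices pay for the number of summands. Division by
    \<open>card A\<close> turns their total into exactly \<open>ln (card J)\<close>.\<close>
  have "(\<Sum>i\<in>I. logp (w i (sum f J)))
      \<le> (\<Sum>i\<in>I. (if i \<in> A then ln (real (card J)) else 0) + (\<Sum>j\<in>J. logp (w i (f j))))"
    using logp_sum_le[OF F(4) J] F(5) by (intro sum_mono) auto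
  also have "\<dots> = (\<Sum>i\<in>I. if i \<in> A then ln (real (card J)) else 0) + (\<Sum>j\<in>J. \<Sum>i\<in>I. logp (w i (f j)))"
    by (simp add: sum.distrib sum.swap[of _ I])
  also have "(\<Sum>i\<in>I. if i \<in> A then ln (real (card J)) else 0) = real (card A) * ln (real (card J))"
    using F(1,2) by (simp add: sum.If_cases Int_absorb1)
  finally have "real (card A) * weil_height (sum f J) \<le> real (card A) * (ln (real (card J)) + (\<Sum>j\<in>J. weil_height (f j)))"
    using F(6) by (simp add: distrib_left sum_distrib_left)
  then show ?thesis using F(3) by simp
qed

lemma weil_height_add:
  assumes "x \<in> Qbar" "y \<in> Qbar"
  shows "weil_height (x + y) \<le> ln 2 + weil_height x + weil_height y"
proof -
  let ?f = "\<lambda>i :: nat. if i = 0 then x else y"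
  have "weil_height (sum ?f {0, 1}) \<le> ln (real (card {0, 1 :: nat})) + (\<Sum>i\<in>{0, 1}. weil_height (?f i))"
    by (rule weil_height_sum) (use assms in auto)
  then show ?thesis by (simp add: numeral_2_eq_2)
qed

section \<open>Northcott's theorem\<close>

lemma conjugates_of_rat: "conjugates (of_rat r) = {of_rat r}"
proof -
  have "y = of_rat r" if "y \<in> conjugates (of_rat r)" for y
  proof -
    have "poly_over \<rat> [:- of_rat r, 1:]"
      using subring_Rats by (intro poly_over_pCons poly_over_0) auto
    then show ?thesis using that by (auto simp: conjugates_iff)
  qed
  then show ?thesis using conjugates_refl[of "of_rat r"] by auto
qed

text \<open>For r = a/b in lowest terms, |r|_v = 1/|b|_v at every prime v dividing b. By the product
  formula for b the finite places therefore contribute at least ln b, so b <= exp B. The archimedean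
  term gives |r| <= exp B and hence |a| <= exp B * exp B.\<close>

lemma finite_rats_bounded_height: "finite {r :: rat. weil_height (of_rat r) \<le> B}"
proof -
  define N :: int where "N = \<lceil>exp B\<rceil>"
  define M :: int where "M = \<lceil>exp B * exp B\<rceil>"
  have "{r :: rat. weil_height (of_rat r) \<le> B}
      \<subseteq> (\<lambda>(a, b). of_int a / of_int b) ` ({-M..M} \<times> {0..N})"
  proof clarify
    fix r :: rat assume h: "weil_height (of_rat r) \<le> B"
    obtain a b where ab: "quotient_of r = (a, b)" by force
    then have r: "r = of_int a / of_int b" and b: "b > 0" and cop: "coprime a b"
      by (auto simp: quotient_of_div quotient_of_denom_pos quotient_of_coprime)
    define V where "V = insert 0 ({v. is_place v \<and> place_abs v (of_rat r) > 1} \<union> {p. prime p \<and> int p dvd b})"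
    have "{p. prime p \<and> int p dvd b} \<subseteq> {p. p dvd nat \<bar>b\<bar>}"
      by (auto simp: nat_dvd_iff int_dvd_int_iff[symmetric] dest: prime_gt_0_nat)
    moreover have "finite {p. p dvd nat \<bar>b\<bar>}" using b by (intro finite_divisors_nat) auto
    ultimately have V: "finite V" "0 \<in> V" "\<And>v. v \<in> V \<Longrightarrow> is_place v"
      using finite_place_gt_1[of "of_rat r"]
      by (auto simp: V_def is_place_def intro: finite_subset)
    have h_eq: "weil_height (of_rat r) = (\<Sum>v\<in>V. logp (place_abs v (of_rat r)))"
      using weil_height_finite_sum[OF of_rat_Qbar V, of r] by (auto simp: conjugates_of_rat V_def)
    have ratio: "place_abs v (of_rat r) * place_abs v (of_int b) = place_abs v (of_int a)"
      if "is_place v" for v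
    proof -
      have "of_rat r * of_int b = (of_int a :: complex)" using b by (simp add: r of_rat_divide)
      then show ?thesis
        using av_mult[OF place_abs_value[OF that], of "of_rat r" "of_int b"] by simp
    qed
    have local: "- ln (place_abs v (of_int b)) \<le> logp (place_abs v (of_rat r))" if "prime v" for v
    proof -
      have w: "absolute_value_on Qbar (place_abs v)"
        using that by (intro place_abs_value) (simp add: is_place_def)
      show ?thesis
      proof (cases "int v dvd b")
        case True
        then have "\<not> int v dvd a"
          using that cop by (metis coprime_common_divisor not_prime_unit prime_int_nat_transfer
              prime_nat_int_transfer)
        then have "a \<noteq> 0" "place_abs v (of_int a) = 1"
          using place_abs_of_int[OF that, of a] by (auto simp: not_dvd_imp_multiplicity_0)
        then have *: "place_abs v (of_rat r) * place_abs v (of_int b) = 1"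
          using ratio[of v] that by (simp add: is_place_def)
        have "0 < place_abs v (of_int b)" using b by (intro av_pos[OF w]) auto
        then have "place_abs v (of_rat r) = inverse (place_abs v (of_int b))"
          using * by (simp add: field_simps)
        then have "- ln (place_abs v (of_int b)) = ln (place_abs v (of_rat r))"
          using \<open>0 < place_abs v (of_int b)\<close> by (simp add: ln_inverse)
        also have "\<dots> \<le> logp (place_abs v (of_rat r))"
          using \<open>0 < place_abs v (of_int b)\<close> \<open>place_abs v (of_rat r) = _\<close> by (intro ln_le_logp) simp
        finally show ?thesis .
      next
        case False
        then have "place_abs v (of_int b) = 1"
          using place_abs_of_int[OF that, of b] b by (simp add: not_dvd_imp_multiplicity_0)
        then show ?thesis by (simp add: logp_nonneg)
      qed
    qed
    have split: "weil_height (of_rat r) = logp (place_abs 0 (of_rat r)) + (\<Sum>v\<in>V - {0}. logp (place_abs v (of_rat r)))"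
      unfolding h_eq using V by (simp add: sum.remove)
    have "logp (place_abs 0 (of_rat r)) \<le> B"
      using split h sum_nonneg[of "V - {0}" "\<lambda>v. logp (place_abs v (of_rat r))"] logp_nonneg by force
    then have "cmod (of_rat r) \<le> exp B" by (simp add: logp_le_iff place_abs_def)
    moreover have "of_rat r = (of_int a / of_int b :: complex)" by (simp add: r of_rat_divide)
    ultimately have ab_le: "real_of_int \<bar>a\<bar> \<le> exp B * real_of_int b"
      using b by (simp add: norm_divide field_simps)
    have "(\<Sum>v\<in>V. ln (place_abs v (of_int b))) = 0"
      by (rule product_formula_int[OF _ V]) (use b in \<open>auto simp: V_def\<close>)
    then have "ln (real_of_int b) = (\<Sum>v\<in>V - {0}. - ln (place_abs v (of_int b)))"
      using V b by (simp add: sum.remove[of V 0] place_abs_def sum_negf)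
    also have "\<dots> \<le> (\<Sum>v\<in>V - {0}. logp (place_abs v (of_rat r)))"
      using V(3) by (intro sum_mono local) (auto simp: is_place_def)
    also have "\<dots> \<le> B" using split h logp_nonneg[of "place_abs 0 (of_rat r)"] by simp
    finally have b_le: "real_of_int b \<le> exp B" using b ln_le_cancel_iff[of b "exp B"] by simp
    have "b \<le> N" using b_le unfolding N_def by linarith
    moreover have "real_of_int \<bar>a\<bar> \<le> exp B * exp B"
      using order_trans[OF ab_le mult_left_mono[OF b_le]] by simp
    then have "\<bar>a\<bar> \<le> M" unfolding M_def by linarith
    ultimately show "r \<in> (\<lambda>(a, b). of_int a / of_int b) ` ({-M..M} \<times> {0..N})"
      using r b by (intro image_eqI[of _ _ "(a, b)"]) auto
  qed
  then show ?thesis by (rule finite_subset) auto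
qed

section \<open>The polynomial whose roots are the conjugates of a number\<close>

lemma coeff_linear_mult:
  fixes Q :: "complex poly"
  shows "coeff ([:- y, 1:] * Q) i = - y * coeff Q i + (if i = 0 then 0 else coeff Q (i - 1))"
  by (cases i) auto

lemma coeff_prod_linear_Qbar:
  assumes "finite Y" "Y \<subseteq> Qbar"
  shows "coeff (\<Prod>y\<in>Y. [:- y, 1:]) i \<in> Qbar"
  using assms
proof (induction Y arbitrary: i rule: finite_induct)
  case (insert y Y)
  then show ?case unfolding prod.insert[OF insert.hyps] coeff_linear_mult by auto
qed (auto simp: coeff_1)

lemma qhom_coeff_prod_linear:
  assumes s: "qhom \<sigma>" and "finite Y" "Y \<subseteq> Qbar"
  shows "\<sigma> (coeff (\<Prod>y\<in>Y. [:- y, 1:]) i) = coeff (\<Prod>y\<in>Y. [:- \<sigma> y, 1:]) i"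
  using assms(2,3)
proof (induction Y arbitrary: i rule: finite_induct)
  case empty
  then show ?case by (simp add: coeff_1 qhom_0[OF s] qhom_1[OF s])
next
  case (insert y Y)
  then have Q: "coeff (\<Prod>y\<in>Y. [:- y, 1:]) j \<in> Qbar" for j by (intro coeff_prod_linear_Qbar) auto
  have y: "y \<in> Qbar" "\<sigma> (- y) = - \<sigma> y" using insert.prems qhom_diff[OF s, of 0 y] by (auto simp: qhom_0[OF s])
  have IH: "\<sigma> (coeff (\<Prod>y\<in>Y. [:- y, 1:]) j) = coeff (\<Prod>y\<in>Y. [:- \<sigma> y, 1:]) j" for j
    using insert by auto
  define u where "u = (if i = 0 then 0 else coeff (\<Prod>y\<in>Y. [:- y, 1:]) (i - 1))"
  have u: "u \<in> Qbar" "\<sigma> u = (if i = 0 then 0 else coeff (\<Prod>y\<in>Y. [:- \<sigma> y, 1:]) (i - 1))"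
    using Q by (auto simp: u_def IH qhom_0[OF s])
  have "\<sigma> (- y * coeff (\<Prod>y\<in>Y. [:- y, 1:]) i + u) = \<sigma> (- y * coeff (\<Prod>y\<in>Y. [:- y, 1:]) i) + \<sigma> u"
    using Q y u by (intro qhom_add[OF s]) auto
  also have "\<sigma> (- y * coeff (\<Prod>y\<in>Y. [:- y, 1:]) i) = \<sigma> (- y) * \<sigma> (coeff (\<Prod>y\<in>Y. [:- y, 1:]) i)"
    using Q y by (intro qhom_mult[OF s]) auto
  finally show ?case
    unfolding prod.insert[OF insert.hyps] coeff_linear_mult by (simp add: y u u_def[symmetric] IH)
qed

text \<open>Embeddings permute the conjugates and thus fix the coefficients.\<close>

lemma coeff_conjugates_poly_rational:
  assumes x: "x \<in> Qbar"
  shows "coeff (\<Prod>y\<in>conjugates x. [:- y, 1:]) i \<in> \<rat>"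
proof (rule fixed_imp_rational)
  note fin = finite_conjugates[OF x] conjugates_subset_Qbar[OF x]
  show "coeff (\<Prod>y\<in>conjugates x. [:- y, 1:]) i \<in> Qbar" using fin by (rule coeff_prod_linear_Qbar)
  fix \<tau> assume t: "qhom \<tau>"
  have inj: "inj_on \<tau> (conjugates x)" using inj_on_subset[OF qhom_inj[OF t] fin(2)] .
  have "\<tau> y \<in> conjugates x" if "y \<in> conjugates x" for y
    using qhom_conjugates[OF t, of y] fin(2) that conjugates_eq[OF x that] by auto
  then have im: "\<tau> ` conjugates x = conjugates x"
    using fin(1) inj by (intro endo_inj_surj) auto
  have "\<tau> (coeff (\<Prod>y\<in>conjugates x. [:- y, 1:]) i) = coeff (\<Prod>y\<in>conjugates x. [:- \<tau> y, 1:]) i"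
    by (rule qhom_coeff_prod_linear[OF t fin])
  also have "(\<Prod>y\<in>conjugates x. [:- \<tau> y, 1:]) = (\<Prod>y\<in>\<tau> ` conjugates x. [:- y, 1:])"
    by (simp add: prod.reindex[OF inj])
  finally show "\<tau> (coeff (\<Prod>y\<in>conjugates x. [:- y, 1:]) i) = coeff (\<Prod>y\<in>conjugates x. [:- y, 1:]) i"
    by (simp only: im)
qed

text \<open>One more factor X - y turns the coefficients c_i into - y c_i + c_(i-1): a sum of two
  terms (\<open>ln 2\<close>), a sign, a root of height at most B, and two old coefficients.\<close>

primrec coeff_bound :: "real \<Rightarrow> nat \<Rightarrow> real" where
  "coeff_bound B 0 = 0"
| "coeff_bound B (Suc n) = ln 2 + weil_height (- 1) + B + 2 * coeff_bound B n"

lemma coeff_bound_nonneg: "0 \<le> B \<Longrightarrow> 0 \<le> coeff_bound B n"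
  by (induction n) (auto simp: weil_height_nonneg)

lemma coeff_bound_mono:
  assumes "0 \<le> B" "m \<le> n" shows "coeff_bound B m \<le> coeff_bound B n"
proof (rule lift_Suc_mono_le[of "coeff_bound B"])
  fix n show "coeff_bound B n \<le> coeff_bound B (Suc n)"
    using coeff_bound_nonneg[OF assms(1), of n] weil_height_nonneg[of "- 1"] assms(1) by simp
qed fact

lemma weil_height_coeff_prod_linear:
  assumes "finite Y" "Y \<subseteq> Qbar" "\<And>y. y \<in> Y \<Longrightarrow> weil_height y \<le> B" "0 \<le> B"
  shows "weil_height (coeff (\<Prod>y\<in>Y. [:- y, 1:]) i) \<le> coeff_bound B (card Y)"
  using assms(1-3)
proof (induction Y arbitrary: i rule: finite_induct)
  case empty
  then show ?case by (simp add: coeff_1 weil_height_0 weil_height_1)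
next
  case (insert y Y)
  let ?Q = "\<Prod>y\<in>Y. [:- y, 1:]"
  have Q: "coeff ?Q j \<in> Qbar" for j using insert by (intro coeff_prod_linear_Qbar) auto
  have IH: "weil_height (coeff ?Q j) \<le> coeff_bound B (card Y)" for j using insert by auto
  have y: "y \<in> Qbar" "weil_height y \<le> B" using insert.prems by auto
  define u where "u = (if i = 0 then 0 else coeff ?Q (i - 1))"
  have u: "u \<in> Qbar" "weil_height u \<le> coeff_bound B (card Y)"
    using Q IH coeff_bound_nonneg[OF assms(4), of "card Y"] by (auto simp: u_def weil_height_0)
  have "weil_height (coeff ([:- y, 1:] * ?Q) i) = weil_height ((- 1) * (y * coeff ?Q i) + u)"
    unfolding coeff_linear_mult u_def by simp
  also have "\<dots> \<le> ln 2 + weil_height ((- 1) * (y * coeff ?Q i)) + weil_height u"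
    using y Q u by (intro weil_height_add) auto
  also have "weil_height ((- 1) * (y * coeff ?Q i)) \<le> weil_height (- 1) + weil_height (y * coeff ?Q i)"
    using y Q by (intro weil_height_mult) auto
  also have "weil_height (y * coeff ?Q i) \<le> weil_height y + weil_height (coeff ?Q i)"
    using y Q by (intro weil_height_mult) auto
  finally have "weil_height (coeff ([:- y, 1:] * ?Q) i)
      \<le> ln 2 + (weil_height (- 1) + (weil_height y + weil_height (coeff ?Q i))) + weil_height u"
    by simp
  also have "\<dots> \<le> coeff_bound B (Suc (card Y))"
    using y(2) u(2) IH[of i] by simp
  finally show ?case using insert.hyps by simp
qed

lemma finite_polys_coeffs_in:
  assumes "finite F"
  shows "finite {P :: 'a :: zero poly. degree P \<le> D \<and> (\<forall>i. coeff P i \<in> F)}"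
proof (rule finite_subset)
  show "finite (Poly ` {xs. set xs \<subseteq> F \<and> length xs \<le> Suc D})"
    by (intro finite_imageI finite_lists_length_le assms)
  show "{P. degree P \<le> D \<and> (\<forall>i. coeff P i \<in> F)} \<subseteq> Poly ` {xs. set xs \<subseteq> F \<and> length xs \<le> Suc D}"
  proof clarify
    fix P :: "'a poly" assume P: "degree P \<le> D" "\<forall>i. coeff P i \<in> F"
    have "P = Poly (coeffs P)" by simp
    moreover have "set (coeffs P) \<subseteq> F" using P(2) by (auto simp: coeffs_def)
    moreover have "length (coeffs P) \<le> Suc D" using P(1) by (simp add: length_coeffs coeffs_def)
    ultimately show "P \<in> Poly ` {xs. set xs \<subseteq> F \<and> length xs \<le> Suc D}" by blast
  qed
qed

text \<open>Each x is a root of the product of the X - y over its conjugates y. Its coefficients are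
  rational of bounded height and its degree is at most D, so only finitely many such polynomials
  exist.\<close>

theorem northcott:
  assumes K: "number_field K"
  shows "finite {x\<in>K. weil_height x \<le> B}"
proof (cases "0 \<le> B")
  case True
  obtain D where D: "\<forall>x\<in>K. \<exists>P. poly_over \<rat> P \<and> P \<noteq> 0 \<and> poly P x = 0 \<and> degree P \<le> D"
    using number_field_degree_bound[OF K] by auto
  define F :: "complex set" where "F = of_rat ` {r. weil_height (of_rat r) \<le> coeff_bound B D}"
  have F: "finite F" unfolding F_def by (intro finite_imageI finite_rats_bounded_height)
  define \<P> where "\<P> = {P. degree P \<le> D \<and> (\<forall>i. coeff P i \<in> F)} - {0}"
  have "finite \<P>" unfolding \<P>_def using finite_polys_coeffs_in[OF F] by simp
  then have "finite (\<Union>P\<in>\<P>. {x. poly P x = 0})"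
    by (intro finite_UN_I poly_roots_finite) (auto simp: \<P>_def)
  moreover have "{x\<in>K. weil_height x \<le> B} \<subseteq> (\<Union>P\<in>\<P>. {x. poly P x = 0})"
  proof clarify
    fix x assume x: "x \<in> K" "weil_height x \<le> B"
    then have xQ: "x \<in> Qbar" using number_field_subset_Qbar[OF K] by auto
    note fin = finite_conjugates[OF xQ] conjugates_subset_Qbar[OF xQ]
    define P where "P = (\<Prod>y\<in>conjugates x. [:- y, 1:])"
    have card: "card (conjugates x) \<le> D"
    proof -
      obtain R where "poly_over \<rat> R" "R \<noteq> 0" "poly R x = 0" "degree R \<le> D" using D x(1) by auto
      then show ?thesis using card_conjugates_le[OF xQ, of R] by simp
    qed
    have "degree P = card (conjugates x)"
      unfolding P_def by (subst degree_prod_eq_sum_degree) auto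
    then have "degree P \<le> D" using card by simp
    moreover have "coeff P i \<in> F" for i
    proof -
      have "weil_height (coeff P i) \<le> coeff_bound B (card (conjugates x))"
        unfolding P_def using fin x(2) weil_height_conjugate[OF xQ] True
        by (intro weil_height_coeff_prod_linear) auto
      also have "\<dots> \<le> coeff_bound B D" using True card by (rule coeff_bound_mono)
      finally show ?thesis
        using coeff_conjugates_poly_rational[OF xQ, of i] by (auto simp: F_def P_def elim!: Rats_cases)
    qed
    moreover have "P \<noteq> 0" unfolding P_def using fin(1) by (subst prod_zero_iff) auto
    moreover have "poly P x = 0"
      unfolding P_def poly_prod using fin(1) conjugates_refl[OF xQ] by (intro prod_zero) auto
    ultimately show "x \<in> (\<Union>P\<in>\<P>. {x. poly P x = 0})" by (auto simp: \<P>_def)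
  qed
  ultimately show ?thesis by (rule rev_finite_subset)
next
  case False
  then have "{x\<in>K. weil_height x \<le> B} = {}"
    using weil_height_nonneg number_field_subset_Qbar[OF K] by force
  then show ?thesis by (simp only: finite.emptyI)
qed

section \<open>Heights under rational maps\<close>

text \<open>The identity, viewed as an embedding, turns \<open>poly_graph_division\<close> into
  division with remainder over \<open>Qbar\<close>.\<close>

lemma hom_graph_Id: "hom_graph (Id_on Qbar)"
  using Rats_subset_Qbar by (auto simp: hom_graph_def Id_on_def)

lemma poly_graph_Id: "poly_graph (Id_on Qbar) A A \<longleftrightarrow> poly_over Qbar A"
  by (auto simp: poly_graph_def poly_over_def)

lemma poly_over_Qbar_division:
  assumes "poly_over Qbar M" "M \<noteq> 0" "poly_over Qbar A"
  shows "\<exists>Q S. poly_over Qbar Q \<and> poly_over Qbar S \<and> A = M * Q + S \<and> (S = 0 \<or> degree S < degree M)"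
proof -
  obtain Q Q' S S' where "poly_graph (Id_on Qbar) Q Q'" "poly_graph (Id_on Qbar) S S'"
    "A = M * Q + S" "S = 0 \<or> degree S < degree M"
    using poly_graph_division[OF hom_graph_Id, of M M A A] assms unfolding poly_graph_Id by blast
  moreover from this have "poly_over Qbar Q" "poly_over Qbar S"
    by (auto simp: poly_graph_def poly_over_def)
  ultimately show ?thesis by blast
qed

text \<open>A nonzero combination g of least degree divides \<open>P\<close> and \<open>Q\<close>;
  if it were not constant, its complex root would be a common root. The coefficients have to stay
  algebraic because their heights enter the later constants.\<close>

lemma bezout_over_Qbar:
  assumes P: "poly_over Qbar P" and Q: "poly_over Qbar Q"
    and root: "\<And>z. poly P z = 0 \<Longrightarrow> poly Q z \<noteq> 0"
  shows "\<exists>A B. poly_over Qbar A \<and> poly_over Qbar B \<and> A * P + B * Q = 1"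
proof -
  let ?good = "\<lambda>g. g \<noteq> 0 \<and> (\<exists>A B. poly_over Qbar A \<and> poly_over Qbar B \<and> g = A * P + B * Q)"
  have one: "poly_over Qbar 1" using poly_over_const[OF subring_Qbar, of 1] by (simp add: one_pCons)
  note zero = poly_over_0[OF subring_Qbar]
  have PQ: "P \<noteq> 0 \<or> Q \<noteq> 0" using root[of 0] by auto
  have "\<exists>g. ?good g"
  proof (cases "P = 0")
    case False
    have "P = 1 * P + 0 * Q" by simp
    then show ?thesis using False one zero by blast
  next
    case True
    have "Q = 0 * P + 1 * Q" by simp
    then show ?thesis using True PQ one zero by blast
  qed
  then obtain g0 where g0: "?good g0" by blast
  define g where "g = arg_min degree ?good"
  have g: "?good g" unfolding g_def by (rule arg_min_natI[of ?good, OF g0])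
  have gmin: "degree g \<le> degree h" if "?good h" for h
    unfolding g_def by (rule arg_min_nat_le[of ?good, OF that])
  obtain A B where AB: "poly_over Qbar A" "poly_over Qbar B" "g = A * P + B * Q" using g by blast
  have gQ: "poly_over Qbar g"
    using AB P Q poly_over_diff[OF subring_Qbar, of "A * P" "0 - B * Q"]
      poly_over_diff[OF subring_Qbar zero, of "B * Q"] poly_over_mult[OF subring_Qbar] by simp
  have dvd: "g dvd R" if R: "poly_over Qbar R" "R = C * P + D * Q" "poly_over Qbar C" "poly_over Qbar D" for R C D
  proof -
    obtain U S where US: "poly_over Qbar U" "poly_over Qbar S" "R = g * U + S" "S = 0 \<or> degree S < degree g"
      using poly_over_Qbar_division[OF gQ _ R(1)] g by blast
    have "S = (C - A * U) * P + (D - B * U) * Q" using US(3) R(2) AB(3) by (simp add: algebra_simps)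
    moreover have "poly_over Qbar (C - A * U)" "poly_over Qbar (D - B * U)"
      using R AB US by (auto intro!: poly_over_diff poly_over_mult subring_Qbar)
    ultimately have "S \<noteq> 0 \<Longrightarrow> ?good S" by blast
    then have "S = 0" using US(4) gmin[of S] not_less by blast
    then show ?thesis using US(3) by simp
  qed
  have gP: "g dvd P" by (rule dvd[OF P _ one zero]) simp
  have gQ': "g dvd Q" by (rule dvd[OF Q _ zero one]) simp
  have "degree g = 0"
  proof (rule ccontr)
    assume "degree g \<noteq> 0"
    then have "\<not> constant (poly g)" by (simp add: constant_degree)
    then obtain z where z: "poly g z = 0" using fundamental_theorem_of_algebra by blast
    then have "poly P z = 0" "poly Q z = 0" using gP gQ' by (auto elim!: dvdE)
    then show False using root by blast
  qed
  then obtain c where c: "g = [:c:]" using degree_eq_zeroE by blast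
  have c0: "c \<noteq> 0" "c \<in> Qbar"   proof -
    show "c \<noteq> 0" using g c by auto
    have "coeff g 0 \<in> Qbar" using gQ by (simp add: poly_over_def)
    then show "c \<in> Qbar" by (simp add: c)
  qed
  have inv: "poly_over Qbar [:inverse c:]" using c0 by (intro poly_over_const subring_Qbar) auto
  have "[:inverse c:] * A * P + [:inverse c:] * B * Q = [:inverse c:] * g"
    by (simp only: AB(3) distrib_left mult.assoc)
  also have "\<dots> = 1" using c0 by (simp add: c one_pCons)
  finally have "[:inverse c:] * A * P + [:inverse c:] * B * Q = 1" .
  then show ?thesis using poly_over_mult[OF subring_Qbar inv] AB by blast
qed

text \<open>
  The factor \<open>e\<close> removes from the bounds below the number of summands of a sum, which only
  archimedean absolute values see.
\<close>

definition frame_av :: "real \<Rightarrow> (complex \<Rightarrow> real) \<Rightarrow> bool" where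
  "frame_av e w \<longleftrightarrow> absolute_value_on Qbar w \<and> (e = 1 \<or> e = 0 \<and> nonarch w)"

section \<open>Local estimates for values of polynomials\<close>

definition coeff_size :: "nat \<Rightarrow> complex poly \<Rightarrow> (complex \<Rightarrow> real) \<Rightarrow> real" where
  "coeff_size n P w = (\<Sum>j\<le>n. logp (w (coeff P j)))"

lemma coeff_size_nonneg: "0 \<le> coeff_size n P w"
  by (simp add: coeff_size_def sum_nonneg logp_nonneg)

lemma poly_value_bound:
  assumes w: "frame_av e w" and P: "poly_over Qbar P" "degree P \<le> n" and x: "x \<in> Qbar"
  shows "w (poly P x) \<le> exp (e * ln (real (Suc n)) + coeff_size n P w) * max 1 (w x) ^ n"
proof -
  have av: "absolute_value_on Qbar w" using w by (simp add: frame_av_def)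
  define L where "L = exp (coeff_size n P w) * max 1 (w x) ^ n"
  have L0: "0 \<le> L" by (simp add: L_def)
  have cQ: "coeff P j \<in> Qbar" for j using P by (simp add: poly_over_def)
  have eq: "poly P x = (\<Sum>j\<le>n. coeff P j * x ^ j)"
    unfolding poly_altdef using P(2) by (intro sum.mono_neutral_left) (auto simp: coeff_eq_0)
  have tm: "w (coeff P j * x ^ j) \<le> L" if "j \<in> {..n}" for j
  proof -
    have "logp (w (coeff P j)) \<le> coeff_size n P w"
      unfolding coeff_size_def using that by (intro member_le_sum) (auto simp: logp_nonneg)
    then have "w (coeff P j) \<le> exp (coeff_size n P w)" by (simp add: logp_le_iff)
    moreover have "w x ^ j \<le> max 1 (w x) ^ j"
      using av_nonneg[OF av x] by (intro power_mono) auto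
    moreover have "max 1 (w x) ^ j \<le> max 1 (w x) ^ n"
      using that by (intro power_increasing) auto
    ultimately have "w (coeff P j) * w x ^ j \<le> L"
      unfolding L_def using av_nonneg[OF av x] by (intro mult_mono) auto
    then show ?thesis using cQ x by (simp add: av_mult[OF av] av_power[OF av])
  qed
  have mem: "coeff P j * x ^ j \<in> Qbar" for j using cQ x by auto
  consider "e = 1" | "e = 0" "nonarch w" using w by (auto simp: frame_av_def)
  then show ?thesis
  proof cases
    case 1
    have "w (poly P x) \<le> (\<Sum>j\<le>n. w (coeff P j * x ^ j))"
      unfolding eq by (rule av_sum[OF av mem])
    also have "\<dots> \<le> real (card {..n}) * L" by (intro sum_bounded_above tm)
    also have "\<dots> = exp (e * ln (real (Suc n)) + coeff_size n P w) * max 1 (w x) ^ n"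
      using 1 by (simp add: L_def exp_add)
    finally show ?thesis .
  next
    case 2
    have "w (poly P x) \<le> L" unfolding eq by (rule nonarch_sum[OF av 2(2) L0 mem tm])
    then show ?thesis using 2 by (simp add: L_def)
  qed
qed

text \<open>Where |y| <= 1, the values A(y) and B(y) are bounded through their coefficients, so P(y)
  and Q(y) cannot both be small.\<close>

lemma bezout_value_bound:
  assumes w: "frame_av e w" and P: "poly_over Qbar P" and Q: "poly_over Qbar Q"
    and A: "poly_over Qbar A" and B: "poly_over Qbar B" and eq: "A * P + B * Q = 1"
    and y: "y \<in> Qbar" "w y \<le> 1"
  shows "1 \<le> exp (e * (ln 2 + ln (real (Suc (degree A))) + ln (real (Suc (degree B))))
               + coeff_size (degree A) A w + coeff_size (degree B) B w)
             * max (w (poly P y)) (w (poly Q y))"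
proof -
  have av: "absolute_value_on Qbar w" and e: "0 \<le> e" using w by (auto simp: frame_av_def)
  define M where "M = max (w (poly P y)) (w (poly Q y))"
  define a where "a = e * ln (real (Suc (degree A))) + coeff_size (degree A) A w"
  define b where "b = e * ln (real (Suc (degree B))) + coeff_size (degree B) B w"
  have ab: "0 \<le> a" "0 \<le> b" using e by (auto simp: a_def b_def coeff_size_nonneg)
  have pQ: "poly P y \<in> Qbar" "poly Q y \<in> Qbar" "poly A y \<in> Qbar" "poly B y \<in> Qbar"
    using P Q A B y by (auto intro: subring_poly[OF subring_Qbar])
  have M0: "0 \<le> M" unfolding M_def using av_nonneg[OF av pQ(1)] by simp
  have m1: "max 1 (w y) = 1" using y by simp
  have wA: "w (poly A y) \<le> exp (a + b)"
  proof -
    have "w (poly A y) \<le> exp a" using poly_value_bound[OF w A order_refl y(1)] unfolding m1 a_def by simp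
    also have "\<dots> \<le> exp (a + b)" using ab by simp
    finally show ?thesis .
  qed
  have wB: "w (poly B y) \<le> exp (a + b)"
  proof -
    have "w (poly B y) \<le> exp b" using poly_value_bound[OF w B order_refl y(1)] unfolding m1 b_def by simp
    also have "\<dots> \<le> exp (a + b)" using ab by simp
    finally show ?thesis .
  qed
  have t1: "w (poly A y * poly P y) \<le> exp (a + b) * M"
    unfolding av_mult[OF av pQ(3) pQ(1)] using wA M0 av_nonneg[OF av pQ(1)]
    by (intro mult_mono) (auto simp: M_def)
  have t2: "w (poly B y * poly Q y) \<le> exp (a + b) * M"
    unfolding av_mult[OF av pQ(4) pQ(2)] using wB M0 av_nonneg[OF av pQ(2)]
    by (intro mult_mono) (auto simp: M_def)
  have one: "1 = w (poly A y * poly P y + poly B y * poly Q y)"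
    using arg_cong[OF eq, of "\<lambda>R. poly R y"] by (simp add: av_1[OF av])
  have "1 \<le> exp (e * ln 2) * (exp (a + b) * M)"
  proof -
    consider "e = 1" | "e = 0" "nonarch w" using w by (auto simp: frame_av_def)
    then show ?thesis
    proof cases
      case 1
      have "1 \<le> w (poly A y * poly P y) + w (poly B y * poly Q y)"
        unfolding one using pQ by (intro av_add[OF av]) auto
      then show ?thesis using 1 t1 t2 by simp
    next
      case 2
      then have "1 \<le> max (w (poly A y * poly P y)) (w (poly B y * poly Q y))"
        unfolding one using pQ by (auto simp: nonarch_def)
      then show ?thesis using 2 t1 t2 by (simp split: if_splits)
    qed
  qed
  also have "exp (e * ln 2) * (exp (a + b) * M) = exp (e * ln 2 + (a + b)) * M"
    by (simp add: exp_add)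
  also have "e * ln 2 + (a + b) = e * (ln 2 + ln (real (Suc (degree A))) + ln (real (Suc (degree B))))
      + coeff_size (degree A) A w + coeff_size (degree B) B w"
    by (simp add: a_def b_def algebra_simps)
  finally show ?thesis by (simp add: M_def)
qed

text \<open>X^d P(1/X), the polynomial \<open>P\<close> of formal degree d seen in the chart at
  infinity.\<close>

definition reversed :: "nat \<Rightarrow> complex poly \<Rightarrow> complex poly" where
  "reversed d P = (\<Sum>j\<le>d. monom (coeff P (d - j)) j)"

lemma poly_over_reversed: "poly_over Qbar P \<Longrightarrow> poly_over Qbar (reversed d P)"
  by (auto simp: poly_over_def reversed_def coeff_sum)

lemma poly_reversed:
  assumes "degree P \<le> d" "x \<noteq> 0"
  shows "poly (reversed d P) (inverse x) = poly P x / x ^ d"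
proof -
  have "poly (reversed d P) (inverse x) = (\<Sum>j\<le>d. coeff P (d - j) * inverse x ^ j)"
    by (simp add: reversed_def poly_sum poly_monom)
  also have "\<dots> = (\<Sum>j\<le>d. coeff P j * inverse x ^ (d - j))"
    by (rule sum.reindex_bij_witness[of _ "\<lambda>j. d - j" "\<lambda>j. d - j"]) auto
  also have "\<dots> = (\<Sum>j\<le>d. coeff P j * x ^ j / x ^ d)"
    using assms(2) by (intro sum.cong) (auto simp: power_diff field_simps power_inverse)
  also have "\<dots> = (\<Sum>j\<le>d. coeff P j * x ^ j) / x ^ d" by (simp add: sum_divide_distrib)
  also have "(\<Sum>j\<le>d. coeff P j * x ^ j) = poly P x"
    unfolding poly_altdef using assms(1) by (intro sum.mono_neutral_right) (auto simp: coeff_eq_0)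
  finally show ?thesis .
qed

lemma poly_reversed_0: "poly (reversed d P) 0 = coeff P d"
proof -
  have "poly (reversed d P) 0 = (\<Sum>j\<le>d. if j = 0 then coeff P d else 0)"
    unfolding reversed_def poly_sum poly_monom by (intro sum.cong) (auto simp: power_0_left)
  then show ?thesis by simp
qed

text \<open>Away from 0 this is the hypothesis at 1/z. At 0 the values are the coefficients of X^d,
  one of which is nonzero as the larger degree is exactly d.\<close>

lemma reversed_no_common_root:
  assumes root: "\<And>z. poly P z = 0 \<Longrightarrow> poly Q z \<noteq> 0"
    and d: "max (degree P) (degree Q) = d" and z: "poly (reversed d P) z = 0"
  shows "poly (reversed d Q) z \<noteq> 0"
proof (cases "z = 0")
  case True
  have "coeff P d \<noteq> 0 \<or> coeff Q d \<noteq> 0"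
  proof (cases "P = 0 \<or> Q = 0")
    case True
    moreover have "P \<noteq> 0 \<or> Q \<noteq> 0" using root[of 0] by auto
    ultimately show ?thesis using d by auto
  next
    case False
    then show ?thesis using d by (auto simp: max_def split: if_splits)
  qed
  then show ?thesis using z True by (simp add: poly_reversed_0)
next
  case False
  have "poly (reversed d R) z = poly R (inverse z) / inverse z ^ d" if "degree R \<le> d" for R
    using poly_reversed[OF that, of "inverse z"] False by simp
  then show ?thesis using z root[of "inverse z"] d False by auto
qed

lemma coeff_size_sum:
  assumes "\<And>j. real n * weil_height (coeff P j) = (\<Sum>i\<in>I. logp (w i (coeff P j)))"
  shows "(\<Sum>i\<in>I. coeff_size m P (w i)) = real n * (\<Sum>j\<le>m. weil_height (coeff P j))"
  unfolding coeff_size_def by (subst sum.swap) (simp add: assms sum_distrib_left)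

text \<open>After the product formula for Q(x), the height of P(x)/Q(x) is the average of ln
  max(|P(x)|, |Q(x)|). Bounding each value by its coefficients gives the upper estimate. For the
  lower one, an absolute value with |x| <= 1 uses the Bezout identity of \<open>P\<close> and
  \<open>Q\<close>, and one with |x| > 1 that of the reversed polynomials at 1/x.\<close>

lemma height_rational_function:
  assumes P: "poly_over Qbar P" and Q: "poly_over Qbar Q"
    and root: "\<And>z. poly P z = 0 \<Longrightarrow> poly Q z \<noteq> 0"
    and d: "max (degree P) (degree Q) = d"
  shows "\<exists>C. \<forall>x\<in>Qbar. poly Q x \<noteq> 0 \<longrightarrow>
           \<bar>weil_height (poly P x / poly Q x) - real d * weil_height x\<bar> \<le> C"
proof -
  define P' where "P' = reversed d P"
  define Q' where "Q' = reversed d Q"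
  have P': "poly_over Qbar P'" and Q': "poly_over Qbar Q'"
    using poly_over_reversed P Q by (auto simp: P'_def Q'_def)
  have dP: "degree P \<le> d" and dQ: "degree Q \<le> d" using d by auto
  obtain A B where AB: "poly_over Qbar A" "poly_over Qbar B" "A * P + B * Q = 1"
    using bezout_over_Qbar[OF P Q root] by blast
  obtain A' B' where AB': "poly_over Qbar A'" "poly_over Qbar B'" "A' * P' + B' * Q' = 1"
    using bezout_over_Qbar[OF P' Q'] reversed_no_common_root[OF root d] unfolding P'_def Q'_def by blast
  define hs where "hs = (\<lambda>m R. \<Sum>j\<le>m. weil_height (coeff R j))"
  define C1 where "C1 = ln (real (Suc d)) + hs d P + hs d Q"
  define cA where "cA = ln 2 + ln (real (Suc (degree A))) + ln (real (Suc (degree B)))"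
  define cA' where "cA' = ln 2 + ln (real (Suc (degree A'))) + ln (real (Suc (degree B')))"
  \<comment> \<open>The constant carries both Bezout identities, hence is independent of which
    absolute values of x exceed 1.\<close>
  define C2 where "C2 = cA + cA' + (hs (degree A) A + hs (degree B) B + hs (degree A') A' + hs (degree B') B')"
  show ?thesis
  proof (intro exI[of _ "max C1 C2"] ballI impI)
    fix x assume x: "x \<in> Qbar" and Qx: "poly Q x \<noteq> 0"
    have pQ: "poly P x \<in> Qbar" "poly Q x \<in> Qbar" using P Q x by (auto intro: subring_poly[OF subring_Qbar])
    \<comment> \<open>The coefficients join the frame so that their \<open>logp\<close> terms add up
      to heights, which do not depend on x.\<close>
    define X where "X = {x, poly P x, poly Q x, poly P x / poly Q x} \<union>
      (\<Union>R\<in>{P, Q, A, B, A', B'}. range (coeff R))"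
    have finr: "finite (range (coeff R))" for R :: "complex poly"
    proof (rule finite_subset)
      show "range (coeff R) \<subseteq> insert 0 (coeff R ` {..degree R})"
        using coeff_eq_0[of R] by (auto simp: not_le) (metis atMost_iff image_eqI not_le)
    qed auto
    have "finite X" unfolding X_def using finr by simp
    moreover have "X \<subseteq> Qbar"
      unfolding X_def using x pQ P Q AB AB' by (auto simp: poly_over_def)
    ultimately obtain I S w where "height_frame X I S w" using ex_height_frame by blast
    note F = height_frameD[OF this]
    define n where "n = card S"
    have n0: "real n > 0" using F(3) by (simp add: n_def)
    define e where "e = (\<lambda>i. if i \<in> S then 1 else 0 :: real)"
    have fr: "frame_av (e i) (w i)" if "i \<in> I" for i
      using F(4,5) that by (auto simp: frame_av_def e_def)
    have se: "(\<Sum>i\<in>I. e i) = real n"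
      using F(1,2) by (simp add: e_def n_def sum.If_cases Int_absorb1)
    have size: "(\<Sum>i\<in>I. coeff_size m R (w i)) = real n * hs m R" if "R \<in> {P, Q, A, B, A', B'}" for m R
      unfolding hs_def using that
      by (intro coeff_size_sum) (auto simp: n_def X_def intro!: F(6))
    define M where "M = (\<lambda>i. max (w i (poly P x)) (w i (poly Q x)))"
    have wQ: "w i (poly Q x) > 0" if "i \<in> I" for i using av_pos[OF F(4)[OF that] pQ(2) Qx] .
    have M0: "M i > 0" if "i \<in> I" for i using wQ[OF that] by (simp add: M_def)
    have "real n * weil_height (poly P x / poly Q x) = (\<Sum>i\<in>I. logp (w i (poly P x / poly Q x)))"
      unfolding n_def by (rule F(6)) (simp add: X_def)
    also have "\<dots> = (\<Sum>i\<in>I. ln (M i) - ln (w i (poly Q x)))"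
    proof (rule sum.cong)
      fix i assume i: "i \<in> I"
      have "w i (poly P x / poly Q x) = w i (poly P x) / w i (poly Q x)"
        using pQ by (simp add: divide_inverse av_mult[OF F(4)[OF i]] av_inverse[OF F(4)[OF i]])
      moreover have "max 1 (a / b) = max a b / b" if "b > 0" for a b :: real
        using that by (simp add: max_def divide_simps)
      ultimately have "max 1 (w i (poly P x / poly Q x)) = M i / w i (poly Q x)"
        using wQ[OF i] by (simp add: M_def)
      then show "logp (w i (poly P x / poly Q x)) = ln (M i) - ln (w i (poly Q x))"
        using wQ[OF i] M0[OF i] by (simp add: logp_def ln_div)
    qed simp
    \<comment> \<open>The product formula for \<open>poly Q x\<close> removes the
      denominator.\<close>
    also have "\<dots> = (\<Sum>i\<in>I. ln (M i))"
      using F(7)[of "poly Q x"] Qx by (simp add: sum_subtractf X_def)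
    finally have hM: "real n * weil_height (poly P x / poly Q x) = (\<Sum>i\<in>I. ln (M i))" .
    have hx: "real n * weil_height x = (\<Sum>i\<in>I. logp (w i x))"
      unfolding n_def by (rule F(6)) (simp add: X_def)
    have up: "ln (M i) \<le> e i * ln (real (Suc d)) + coeff_size d P (w i) + coeff_size d Q (w i) + real d * logp (w i x)"
      (is "_ \<le> ?u") if i: "i \<in> I" for i
    proof -
      have m: "max 1 (w i x) ^ d = exp (real d * logp (w i x))"
        by (simp add: exp_of_nat_mult exp_logp)
      have "w i (poly R x) \<le> exp ?u" if R: "R = P \<or> R = Q" for R
      proof -
        have "w i (poly R x) \<le> exp (e i * ln (real (Suc d)) + coeff_size d R (w i)) * max 1 (w i x) ^ d"
          using R P Q dP dQ by (intro poly_value_bound fr i x) auto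
        also have "\<dots> = exp (e i * ln (real (Suc d)) + coeff_size d R (w i) + real d * logp (w i x))"
          by (simp add: m exp_add)
        also have "\<dots> \<le> exp ?u" using R coeff_size_nonneg[of d] by auto
        finally show ?thesis .
      qed
      then have "M i \<le> exp ?u" unfolding M_def by simp
      then show ?thesis using M0[OF i] ln_le_cancel_iff[of "M i" "exp ?u"] by simp
    qed
    have low: "real d * logp (w i x) \<le> e i * (cA + cA') + (coeff_size (degree A) A (w i) + coeff_size (degree B) B (w i)
        + coeff_size (degree A') A' (w i) + coeff_size (degree B') B' (w i)) + ln (M i)"
      if i: "i \<in> I" for i
    proof -
      have e0: "0 \<le> e i * cA" "0 \<le> e i * cA'" by (auto simp: e_def cA_def cA'_def)
      note nn = coeff_size_nonneg[of "degree A" A "w i"] coeff_size_nonneg[of "degree B" B "w i"]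
        coeff_size_nonneg[of "degree A'" A' "w i"] coeff_size_nonneg[of "degree B'" B' "w i"]
      show ?thesis
      proof (cases "w i x \<le> 1")
        case True
        define c where "c = e i * cA + coeff_size (degree A) A (w i) + coeff_size (degree B) B (w i)"
        have "1 \<le> exp c * M i"
          using bezout_value_bound[OF fr[OF i] P Q AB x True] unfolding c_def cA_def M_def .
        then have "0 \<le> ln (exp c * M i)" by simp
        also have "\<dots> = c + ln (M i)" using M0[OF i] by (simp add: ln_mult)
        finally show ?thesis using True nn e0 by (simp add: logp_le_1 c_def distrib_left)
      next
        case False
        then have x0: "x \<noteq> 0" using av_0[OF F(4)[OF i]] by auto
        have wx: "w i x > 1" using False by simp
        define c where "c = e i * cA' + coeff_size (degree A') A' (w i) + coeff_size (degree B') B' (w i)"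
        have iv: "inverse x \<in> Qbar" "w i (inverse x) \<le> 1"
          using x wx by (auto simp: av_inverse[OF F(4)[OF i]] inverse_le_1_iff)
        have "1 \<le> exp c * max (w i (poly P' (inverse x))) (w i (poly Q' (inverse x)))"
          using bezout_value_bound[OF fr[OF i] P' Q' AB' iv] unfolding c_def cA'_def .
        also have "max (w i (poly P' (inverse x))) (w i (poly Q' (inverse x))) = M i / w i x ^ d"
        proof -
          have "w i (poly R x / x ^ d) = w i (poly R x) / w i x ^ d" if "poly R x \<in> Qbar" for R
            using that x by (simp add: divide_inverse av_mult[OF F(4)[OF i]] av_inverse[OF F(4)[OF i]] av_power[OF F(4)[OF i]])
          then show ?thesis
            using pQ wx by (simp add: P'_def Q'_def poly_reversed[OF dP x0] poly_reversed[OF dQ x0] M_def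
                max_divide_distrib_right)
        qed
        finally have "w i x ^ d \<le> exp c * M i" using wx by (simp add: field_simps)
        then have "ln (w i x ^ d) \<le> ln (exp c * M i)" using wx M0[OF i] by (subst ln_le_cancel_iff) auto
        also have "ln (exp c * M i) = c + ln (M i)" using M0[OF i] by (simp add: ln_mult)
        also have "ln (w i x ^ d) = real d * logp (w i x)" using wx by (simp add: ln_realpow logp_def)
        finally show ?thesis using nn e0 by (simp add: c_def distrib_left)
      qed
    qed
    have "(\<Sum>i\<in>I. ln (M i)) \<le> (\<Sum>i\<in>I. e i * ln (real (Suc d)) + coeff_size d P (w i) + coeff_size d Q (w i) + real d * logp (w i x))"
      by (intro sum_mono up)
    also have "\<dots> = real n * ln (real (Suc d)) + real n * hs d P + real n * hs d Q + real d * (real n * weil_height x)"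
      by (simp add: sum.distrib size sum_distrib_left[symmetric] sum_distrib_right[symmetric] se hx)
    also have "\<dots> = real n * (C1 + real d * weil_height x)" by (simp add: C1_def algebra_simps)
    finally have "weil_height (poly P x / poly Q x) \<le> C1 + real d * weil_height x"
      using n0 by (simp only: hM[symmetric]) simp
    moreover have "(\<Sum>i\<in>I. real d * logp (w i x)) \<le> (\<Sum>i\<in>I. e i * (cA + cA') + (coeff_size (degree A) A (w i) + coeff_size (degree B) B (w i)
        + coeff_size (degree A') A' (w i) + coeff_size (degree B') B' (w i)) + ln (M i))"
      by (intro sum_mono low)
    then have "real d * (real n * weil_height x) \<le> real n * (cA + cA') + (real n * hs (degree A) A + real n * hs (degree B) B
        + real n * hs (degree A') A' + real n * hs (degree B') B') + real n * weil_height (poly P x / poly Q x)"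
      by (simp add: sum.distrib size sum_distrib_left[symmetric] sum_distrib_right[symmetric] se hx hM)
    then have "real n * (real d * weil_height x) \<le> real n * (C2 + weil_height (poly P x / poly Q x))"
      by (simp add: C2_def algebra_simps)
    then have "real d * weil_height x \<le> C2 + weil_height (poly P x / poly Q x)"
      using n0 by simp
    ultimately show "\<bar>weil_height (poly P x / poly Q x) - real d * weil_height x\<bar> \<le> max C1 C2" by linarith
  qed
qed

section \<open>The canonical height\<close>

lemma coprime_no_common_root:
  assumes "coprime p q" "poly p z = (0 :: complex)"
  shows "poly q z \<noteq> 0"
proof
  assume "poly q z = 0"
  then have "[:- z, 1:] dvd p" "[:- z, 1:] dvd q" using assms(2) by (auto simp: poly_eq_0_iff_dvd)
  then have "is_unit [:- z, 1:]" by (rule coprime_common_divisor[OF assms(1)])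
  then show False by (simp add: is_unit_iff_degree)
qed

lemma rat_map_P1:
  assumes L: "subfield L" and p: "poly_over L p" and q: "poly_over L q" and g: "\<gamma> \<in> P1 L"
  shows "rat_map p q \<gamma> \<in> P1 L"
proof (cases \<gamma>)
  case (Fin x)
  then have "x \<in> L" using g by (auto simp: P1_def)
  then show ?thesis
    using Fin subring_poly[OF subfield_imp_subring[OF L] p] subring_poly[OF subfield_imp_subring[OF L] q]
    by (auto simp: P1_def intro!: subfield_divide[OF L])
next
  case Infty
  then show ?thesis
    using p q by (auto simp: P1_def Let_def poly_over_def intro!: subfield_divide[OF L])
qed

lemma rat_map_iterate_P1:
  assumes "subfield L" "poly_over L p" "poly_over L q" "\<gamma> \<in> P1 L"
  shows "(rat_map p q ^^ n) \<gamma> \<in> P1 L"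
  by (induction n) (auto intro: rat_map_P1 assms)

lemma P1_height_nonneg: "\<gamma> \<in> P1 Qbar \<Longrightarrow> 0 \<le> P1_height \<gamma>"
  by (auto simp: P1_def weil_height_nonneg)

lemma height_rat_map:
  assumes p: "poly_over Qbar p" and q: "poly_over Qbar q" and cop: "coprime p q"
    and d: "rat_degree p q = d" "d \<ge> 1"
  shows "\<exists>C. \<forall>\<gamma>\<in>P1 Qbar. \<bar>P1_height (rat_map p q \<gamma>) - real d * P1_height \<gamma>\<bar> \<le> C"
proof -
  let ?D = "\<lambda>\<gamma>. \<bar>P1_height (rat_map p q \<gamma>) - real d * P1_height \<gamma>\<bar>"
  obtain C where C: "\<And>x. x \<in> Qbar \<Longrightarrow> poly q x \<noteq> 0 \<Longrightarrow>
      \<bar>weil_height (poly p x / poly q x) - real d * weil_height x\<bar> \<le> C"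
    using height_rational_function[OF p q coprime_no_common_root[OF cop], of d] d
    by (auto simp: rat_degree_def)
  have q0: "q \<noteq> 0"
  proof
    assume "q = 0"
    then have "is_unit p" using cop by simp
    then have "degree p = 0" by (metis is_unit_iff_degree not_is_unit_0)
    then show False using d \<open>q = 0\<close> by (simp add: rat_degree_def)
  qed
  \<comment> \<open>Infinity and the poles escape the formula for quotients. They are finitely many,
    so the sum of their deviations serves as a bound.\<close>
  define E where "E = insert Infty (Fin ` {x. poly q x = 0})"
  have E: "finite E" using poly_roots_finite[OF q0] by (simp add: E_def)
  show ?thesis
  proof (intro exI[of _ "max C (\<Sum>\<gamma>\<in>E. ?D \<gamma>)"] ballI)
    fix \<gamma> assume g: "\<gamma> \<in> P1 Qbar"
    show "?D \<gamma> \<le> max C (\<Sum>\<gamma>\<in>E. ?D \<gamma>)"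
    proof (cases "\<gamma> \<in> E")
      case True
      have "?D \<gamma> \<le> (\<Sum>\<gamma>\<in>E. ?D \<gamma>)" using E True by (intro member_le_sum) auto
      then show ?thesis by simp
    next
      case False
      then obtain x where "\<gamma> = Fin x" "x \<in> Qbar" "poly q x \<noteq> 0" using g by (auto simp: E_def P1_def)
      then have "?D \<gamma> \<le> C" using C[of x] by simp
      then show ?thesis by simp
    qed
  qed
qed

text \<open>Replacing d by 2 in the denominators leaves a geometric series whose sum is exactly
  C.\<close>

lemma telescoping_limit:
  fixes a :: "nat \<Rightarrow> real" and d :: real
  assumes step: "\<And>n. \<bar>a (Suc n) - a n\<bar> \<le> C / d ^ Suc n" and d: "d \<ge> 2"
  shows "convergent a" "\<bar>lim a - a 0\<bar> \<le> C"
proof -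
  define b where "b = (\<lambda>n. a (Suc n) - a n)"
  have C0: "0 \<le> C" using order_trans[OF abs_ge_zero step[of 0]] d by (simp add: zero_le_divide_iff)
  have "\<bar>b n\<bar> \<le> C / 2 * (1 / 2) ^ n" for n
  proof -
    have "\<bar>b n\<bar> \<le> C / d ^ Suc n" using step by (simp add: b_def)
    also have "\<dots> \<le> C / 2 ^ Suc n" using C0 d by (intro divide_left_mono power_mono) auto
    finally show ?thesis by (simp add: power_divide)
  qed
  note bn = this
  have geo: "(\<lambda>n. C / 2 * (1 / 2) ^ n) sums (C / 2 * (1 / (1 - 1 / 2)))"
    by (intro sums_mult geometric_sums) auto
  have sb: "summable b"
    by (rule summable_comparison_test'[OF sums_summable[OF geo], of 0]) (unfold real_norm_def, rule bn)
  have "(\<Sum>i<n. b i) = a n - a 0" for n by (induction n) (auto simp: b_def)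
  then have "(\<lambda>n. a n - a 0) \<longlonglongrightarrow> suminf b" using summable_LIMSEQ[OF sb] by simp
  then have "(\<lambda>n. (a n - a 0) + a 0) \<longlonglongrightarrow> suminf b + a 0" by (intro tendsto_add) auto
  then have lim: "a \<longlonglongrightarrow> suminf b + a 0" by simp
  then show "convergent a" by (rule convergentI)
  have "\<bar>suminf b\<bar> \<le> suminf (\<lambda>n. C / 2 * (1 / 2) ^ n)"
    unfolding real_norm_def[symmetric]
    by (rule norm_suminf_le[OF _ sums_summable[OF geo]]) (unfold real_norm_def, rule bn)
  also have "\<dots> = C" using sums_unique[OF geo] by simp
  finally show "\<bar>lim a - a 0\<bar> \<le> C" using limI[OF lim] by simp
qed

text \<open>The difference of two candidates is bounded along the orbit and is multiplied by the
  degree at each step, so it is 0.\<close>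

lemma is_canonical_height_unique:
  assumes f: "\<And>\<gamma>. \<gamma> \<in> P1 Qbar \<Longrightarrow> rat_map p q \<gamma> \<in> P1 Qbar" and d: "rat_degree p q \<ge> 2"
    and H: "is_canonical_height p q H" and H': "is_canonical_height p q H'" and g: "\<gamma> \<in> P1 Qbar"
  shows "H \<gamma> = H' \<gamma>"
proof -
  define D where "D = real (rat_degree p q)"
  have D: "D \<ge> 2" using d by (simp add: D_def)
  obtain B B' where B: "\<And>\<gamma>. \<gamma> \<in> P1 Qbar \<Longrightarrow> \<bar>H \<gamma> - P1_height \<gamma>\<bar> \<le> B"
    "\<And>\<gamma>. \<gamma> \<in> P1 Qbar \<Longrightarrow> \<bar>H' \<gamma> - P1_height \<gamma>\<bar> \<le> B'"
    using H H' unfolding is_canonical_height_def by blast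
  have inP: "(rat_map p q ^^ n) \<gamma> \<in> P1 Qbar" for n by (induction n) (auto intro: f g)
  have iter: "G ((rat_map p q ^^ n) \<gamma>) = D ^ n * G \<gamma>" if "is_canonical_height p q G" for G n
    using that inP by (induction n) (auto simp: is_canonical_height_def D_def)
  have "\<bar>H \<gamma> - H' \<gamma>\<bar> \<le> (B + B') * (1 / D) ^ n" for n
  proof -
    have "D ^ n * \<bar>H \<gamma> - H' \<gamma>\<bar> = \<bar>H ((rat_map p q ^^ n) \<gamma>) - H' ((rat_map p q ^^ n) \<gamma>)\<bar>"
      using D by (simp add: iter[OF H] iter[OF H'] right_diff_distrib[symmetric] abs_mult)
    also have "\<dots> \<le> B + B'" using B(1)[OF inP[of n]] B(2)[OF inP[of n]] by linarith
    finally show ?thesis using D by (simp add: field_simps)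
  qed
  moreover have "(\<lambda>n. (B + B') * (1 / D) ^ n) \<longlonglongrightarrow> (B + B') * 0"
    using D by (intro tendsto_mult LIMSEQ_realpow_zero) auto
  ultimately have "\<bar>H \<gamma> - H' \<gamma>\<bar> \<le> (B + B') * 0" by (intro LIMSEQ_le_const) auto
  then show ?thesis by simp
qed

text \<open>Existence is Tate's limit of h(f^n(x)) / d^n; together with uniqueness it makes the
  description in \<open>canonical_height\<close> denote.\<close>

lemma canonical_height:
  assumes p: "poly_over Qbar p" and q: "poly_over Qbar q" and cop: "coprime p q"
    and d: "rat_degree p q \<ge> 2"
  shows "is_canonical_height p q (canonical_height p q)"
proof -
  let ?f = "rat_map p q"
  define D where "D = real (rat_degree p q)"
  have D: "D \<ge> 2" using d by (simp add: D_def)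
  have f: "?f \<gamma> \<in> P1 Qbar" if "\<gamma> \<in> P1 Qbar" for \<gamma>
    using rat_map_P1[OF subfield_Qbar p q that] .
  have inP: "(?f ^^ n) \<gamma> \<in> P1 Qbar" if "\<gamma> \<in> P1 Qbar" for \<gamma> n
    using rat_map_iterate_P1[OF subfield_Qbar p q that] .
  obtain C where C: "\<And>\<gamma>. \<gamma> \<in> P1 Qbar \<Longrightarrow> \<bar>P1_height (?f \<gamma>) - D * P1_height \<gamma>\<bar> \<le> C"
    using height_rat_map[OF p q cop, of "rat_degree p q"] d by (auto simp: D_def)
  define a where "a = (\<lambda>\<gamma> n. P1_height ((?f ^^ n) \<gamma>) / D ^ n)"
  have step: "\<bar>a \<gamma> (Suc n) - a \<gamma> n\<bar> \<le> C / D ^ Suc n" if "\<gamma> \<in> P1 Qbar" for \<gamma> n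
  proof -
    have "a \<gamma> (Suc n) - a \<gamma> n = (P1_height (?f ((?f ^^ n) \<gamma>)) - D * P1_height ((?f ^^ n) \<gamma>)) / D ^ Suc n"
      using D by (simp add: a_def field_simps)
    then show ?thesis using C[OF inP[OF that, of n]] D by (simp add: abs_divide divide_right_mono)
  qed
  have conv: "a \<gamma> \<longlonglongrightarrow> lim (a \<gamma>)" if "\<gamma> \<in> P1 Qbar" for \<gamma>
    using telescoping_limit(1)[of "a \<gamma>" C D] step[OF that] D convergent_LIMSEQ_iff by blast
  define H where "H = (\<lambda>\<gamma>. if \<gamma> \<in> P1 Qbar then lim (a \<gamma>) else 0)"
  have "is_canonical_height p q H"
    unfolding is_canonical_height_def
  proof (intro conjI ballI exI[of _ C])
    fix \<gamma> assume g: "\<gamma> \<in> P1 Qbar"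
    have "0 \<le> a \<gamma> n" for n using P1_height_nonneg[OF inP[OF g]] D by (simp add: a_def)
    then have "0 \<le> lim (a \<gamma>)" by (intro LIMSEQ_le_const[OF conv[OF g]]) auto
    then show "0 \<le> H \<gamma>" using g by (simp add: H_def)
    show "\<bar>H \<gamma> - P1_height \<gamma>\<bar> \<le> C"
      using telescoping_limit(2)[of "a \<gamma>" C D] step[OF g] D g by (simp add: H_def a_def)
    \<comment> \<open>The sequence of the image point is the shifted sequence times the degree,
      which gives the functional equation in the limit.\<close>
    have "a (?f \<gamma>) n = D * a \<gamma> (Suc n)" for n
      using D by (simp add: a_def funpow_swap1)
    moreover have "(\<lambda>n. D * a \<gamma> (Suc n)) \<longlonglongrightarrow> D * lim (a \<gamma>)"
      using conv[OF g] by (intro tendsto_mult tendsto_const) (rule LIMSEQ_Suc)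
    ultimately have "a (?f \<gamma>) \<longlonglongrightarrow> D * lim (a \<gamma>)" by presburger
    then have "lim (a (?f \<gamma>)) = D * lim (a \<gamma>)" by (rule limI)
    then show "H (?f \<gamma>) = real (rat_degree p q) * H \<gamma>" using g f by (simp add: H_def D_def)
  qed
  moreover have "\<forall>\<gamma>. \<gamma> \<notin> P1 Qbar \<longrightarrow> H \<gamma> = 0" by (simp add: H_def)
  moreover have "H' = H" if "is_canonical_height p q H' \<and> (\<forall>\<gamma>. \<gamma> \<notin> P1 Qbar \<longrightarrow> H' \<gamma> = 0)" for H'
  proof
    fix \<gamma> show "H' \<gamma> = H \<gamma>"
      using that is_canonical_height_unique[OF f d, of H' H \<gamma>] \<open>is_canonical_height p q H\<close>
      by (cases "\<gamma> \<in> P1 Qbar") (auto simp: H_def)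
  qed
  ultimately have "\<exists>!H. is_canonical_height p q H \<and> (\<forall>\<gamma>. \<gamma> \<notin> P1 Qbar \<longrightarrow> H \<gamma> = 0)" by blast
  from theI'[OF this] show ?thesis by (simp add: canonical_height_def)
qed

section \<open>Vanishing of split multilinear polynomials along orbits\<close>

definition monomial_value :: "(nat \<Rightarrow>\<^sub>0 nat) \<Rightarrow> (nat \<Rightarrow> complex) \<Rightarrow> complex" where
  "monomial_value m x = (\<Prod>j\<in>Poly_Mapping.keys m. x j ^ Poly_Mapping.lookup m j)"

lemma meval_superset:
  assumes "finite S" "Poly_Mapping.keys F \<subseteq> S"
  shows "meval F x = (\<Sum>m\<in>S. Poly_Mapping.lookup F m * monomial_value m x)"
  unfolding meval_def monomial_value_def using assms by (intro sum.mono_neutral_left) (auto simp: in_keys_iff)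

lemma meval_add: "meval (F + G) x = meval F x + meval G x"
proof -
  let ?S = "Poly_Mapping.keys F \<union> Poly_Mapping.keys G"
  have "meval (F + G) x = (\<Sum>m\<in>?S. Poly_Mapping.lookup (F + G) m * monomial_value m x)"
    by (rule meval_superset) (auto simp: in_keys_iff lookup_add)
  moreover have "meval F x = (\<Sum>m\<in>?S. Poly_Mapping.lookup F m * monomial_value m x)"
    by (rule meval_superset) auto
  moreover have "meval G x = (\<Sum>m\<in>?S. Poly_Mapping.lookup G m * monomial_value m x)"
    by (rule meval_superset) auto
  ultimately show ?thesis by (simp add: lookup_add distrib_right sum.distrib)
qed

lemma meval_sum: "meval (sum F I) x = (\<Sum>i\<in>I. meval (F i) x)"
proof -
  have "meval 0 x = 0" by (simp add: meval_def)
  then show ?thesis by (induction I rule: infinite_finite_induct) (auto simp: meval_add)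
qed

lemma meval_monomial:
  assumes "finite J"
  shows "meval (mconst c * (\<Prod>j\<in>J. mvar j)) x = c * (\<Prod>j\<in>J. x j)"
proof -
  define e where "e = (\<Sum>j\<in>J. Poly_Mapping.single j (1 :: nat))"
  have look: "Poly_Mapping.lookup e j = (if j \<in> J then 1 else 0)" for j
    unfolding e_def by (rule lookup_sum_single[OF assms])
  have k: "Poly_Mapping.keys e = J"
    unfolding set_eq_iff in_keys_iff look by simp
  have F: "mconst c * (\<Prod>j\<in>J. mvar j) = Poly_Mapping.single e c"
    by (simp add: prod_mvar assms mconst_def mult_single e_def)
  have "meval (Poly_Mapping.single e c) x
      = (\<Sum>m\<in>{e}. Poly_Mapping.lookup (Poly_Mapping.single e c) m * monomial_value m x)"
    by (rule meval_superset) auto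
  also have "\<dots> = c * (\<Prod>j\<in>J. x j)"
    by (simp add: k look monomial_value_def)
  finally show ?thesis unfolding F .
qed

section \<open>Solving a split form for one variable\<close>

lemma split_form_finite:
  assumes "split_form K k F \<J> c"
  shows "finite \<J>" "\<And>J. J \<in> \<J> \<Longrightarrow> finite J" "\<And>J. J \<in> \<J> \<Longrightarrow> J \<subseteq> {..<k}" "\<Union>\<J> = {..<k}" "disjoint \<J>"
    "card \<J> \<le> k"
proof -
  have part: "partition_on {..<k} \<J>" using assms by (simp add: split_form_def)
  show fin: "finite \<J>" using part by (rule finite_elements[OF finite_lessThan])
  show un: "\<Union>\<J> = {..<k}" "disjoint \<J>" using part by (auto simp: partition_on_def)
  show sub: "\<And>J. J \<in> \<J> \<Longrightarrow> J \<subseteq> {..<k}" using un by auto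
  show "\<And>J. J \<in> \<J> \<Longrightarrow> finite J" by (rule finite_subset[OF sub]) auto
  have ne: "\<And>J. J \<in> \<J> \<Longrightarrow> J \<noteq> {}" using part by (auto simp: partition_on_def)
  \<comment> \<open>Disjoint nonempty blocks have distinct least elements, which bounds their number
    by k.\<close>
  have Min: "Min J \<in> J" if "J \<in> \<J>" for J
    using ne[OF that] finite_subset[OF sub[OF that]] by (intro Min_in) auto
  have "inj_on Min \<J>"
  proof (rule inj_onI, rule ccontr)
    fix I J assume IJ: "I \<in> \<J>" "J \<in> \<J>" "Min I = Min J" "I \<noteq> J"
    then have "Min I \<in> I \<inter> J" using Min[of I] Min[of J] by simp
    then show False using IJ un(2) by (auto simp: disjoint_def)
  qed
  moreover have "Min ` \<J> \<subseteq> {..<k}" using Min unfolding un(1)[symmetric] by blast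
  ultimately have "card \<J> \<le> card {..<k}" by (intro card_inj_on_le) auto
  then show "card \<J> \<le> k" by simp
qed

lemma meval_split_form:
  assumes "split_form K k F \<J> c"
  shows "meval F x = (\<Sum>J\<in>\<J>. c J * (\<Prod>j\<in>J. x j))"
proof -
  have "F = (\<Sum>J\<in>\<J>. mconst (c J) * (\<Prod>j\<in>J. mvar j))" using assms by (simp add: split_form_def)
  then show ?thesis
    using split_form_finite(2)[OF assms] by (simp add: meval_sum meval_monomial)
qed

text \<open>The variable \<open>x a\<close> occurs in a single block, so \<open>F = 0\<close> can be solved for it.\<close>

lemma height_solve_split_form:
  assumes F: "split_form K k F \<J> c" and K: "K \<subseteq> Qbar"
    and x: "\<And>j. j < k \<Longrightarrow> x j \<in> Qbar" "\<And>j. j < k \<Longrightarrow> x j \<noteq> 0"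
    and zero: "meval F x = 0" and a: "a < k"
  shows "card \<J> \<ge> 2"
    "weil_height (x a) \<le> (\<Sum>J\<in>\<J>. weil_height (c J)) + ln (real (card \<J> - 1))
       + (\<Sum>j\<in>{..<k} - {a}. weil_height (x j))"
proof -
  note fin = split_form_finite[OF F]
  have c: "c J \<in> Qbar" "c J \<noteq> 0" if "J \<in> \<J>" for J
    using that F K by (auto simp: split_form_def)
  obtain J1 where J1: "J1 \<in> \<J>" "a \<in> J1" using fin(4) a by auto
  have xJ: "x j \<in> Qbar" "x j \<noteq> 0" if "J \<in> \<J>" "j \<in> J" for J j using that fin(3) x by auto
  define \<J>' where "\<J>' = \<J> - {J1}"
  define T where "T = (\<lambda>J. c J * (\<Prod>j\<in>J. x j))"
  have T: "T J \<in> Qbar" if "J \<in> \<J>" for J unfolding T_def using c(1)[OF that] xJ(1)[OF that] by auto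
  have T0: "T J \<noteq> 0" if "J \<in> \<J>" for J unfolding T_def using c(2)[OF that] xJ(2)[OF that] fin(2)[OF that] by auto
  have sum0: "T J1 + (\<Sum>J\<in>\<J>'. T J) = 0"
    using zero sum.remove[OF fin(1) J1(1), of T] by (simp add: meval_split_form[OF F] T_def \<J>'_def)
  \<comment> \<open>A single block would be a product of nonzero factors equal to 0.\<close>
  then have ne: "\<J>' \<noteq> {}" using T0[OF J1(1)] by auto
  have cJ': "card \<J>' = card \<J> - 1" using fin(1) J1 by (simp add: \<J>'_def)
  moreover have "card \<J>' > 0" using ne fin(1) by (simp add: card_gt_0_iff \<J>'_def)
  ultimately show "card \<J> \<ge> 2" by linarith
  define R where "R = c J1 * (\<Prod>j\<in>J1 - {a}. x j)"
  have R: "R \<in> Qbar" "R \<noteq> 0"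
    unfolding R_def using c[OF J1(1)] xJ[OF J1(1)] fin(2)[OF J1(1)] by auto
  have "T J1 = x a * R"
    unfolding T_def R_def using J1 fin(2)[OF J1(1)] by (simp add: prod.remove mult.left_commute)
  then have "x a = (- (\<Sum>J\<in>\<J>'. T J)) * inverse R"
    using sum0 R(2) by (simp add: field_simps eq_neg_iff_add_eq_0)
  then have "weil_height (x a) \<le> weil_height (- (\<Sum>J\<in>\<J>'. T J)) + weil_height (inverse R)"
    using weil_height_mult[of "- (\<Sum>J\<in>\<J>'. T J)" "inverse R"] T R by (auto simp: \<J>'_def)
  also have "weil_height (- (\<Sum>J\<in>\<J>'. T J)) = weil_height (\<Sum>J\<in>\<J>'. T J)"
    using T by (intro weil_height_minus) (auto simp: \<J>'_def)
  also have "\<dots> \<le> ln (real (card \<J>')) + (\<Sum>J\<in>\<J>'. weil_height (T J))"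
    using fin(1) ne T by (intro weil_height_sum) (auto simp: \<J>'_def)
  also have "(\<Sum>J\<in>\<J>'. weil_height (T J)) \<le> (\<Sum>J\<in>\<J>'. weil_height (c J) + (\<Sum>j\<in>J. weil_height (x j)))"
  proof (rule sum_mono)
    fix J assume "J \<in> \<J>'"
    then have J: "J \<in> \<J>" by (simp add: \<J>'_def)
    have "weil_height (T J) \<le> weil_height (c J) + weil_height (\<Prod>j\<in>J. x j)"
      unfolding T_def using c(1)[OF J] xJ(1)[OF J] by (intro weil_height_mult) auto
    also have "weil_height (\<Prod>j\<in>J. x j) \<le> (\<Sum>j\<in>J. weil_height (x j))"
      using xJ(1)[OF J] by (rule weil_height_prod)
    finally show "weil_height (T J) \<le> weil_height (c J) + (\<Sum>j\<in>J. weil_height (x j))" by simp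
  qed
  also have "weil_height (inverse R) \<le> weil_height (c J1) + (\<Sum>j\<in>J1 - {a}. weil_height (x j))"
  proof -
    have "weil_height (inverse R) = weil_height R" by (rule weil_height_inverse[OF R(1)])
    also have "\<dots> \<le> weil_height (c J1) + weil_height (\<Prod>j\<in>J1 - {a}. x j)"
      unfolding R_def using c(1)[OF J1(1)] xJ(1)[OF J1(1)] by (intro weil_height_mult) auto
    also have "weil_height (\<Prod>j\<in>J1 - {a}. x j) \<le> (\<Sum>j\<in>J1 - {a}. weil_height (x j))"
      using xJ(1)[OF J1(1)] by (intro weil_height_prod) auto
    finally show ?thesis by simp
  qed
  finally have le: "weil_height (x a) \<le> ln (real (card \<J>'))
      + (\<Sum>J\<in>\<J>'. weil_height (c J) + (\<Sum>j\<in>J. weil_height (x j)))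
      + (weil_height (c J1) + (\<Sum>j\<in>J1 - {a}. weil_height (x j)))" by simp
  \<comment> \<open>Each variable other than \<open>x a\<close> occurs once, in the cofactor
    \<open>R\<close> or in another block, so its height is counted once.\<close>
  have "(\<Sum>j<k. weil_height (x j)) = (\<Sum>J\<in>\<J>. \<Sum>j\<in>J. weil_height (x j))"
    using fin(2,5) unfolding fin(4)[symmetric]
    by (subst sum.Union_disjoint) (auto simp: disjoint_def)
  also have "\<dots> = (\<Sum>j\<in>J1. weil_height (x j)) + (\<Sum>J\<in>\<J>'. \<Sum>j\<in>J. weil_height (x j))"
    using fin(1) J1 by (simp add: \<J>'_def sum.remove)
  also have "(\<Sum>j\<in>J1. weil_height (x j)) = weil_height (x a) + (\<Sum>j\<in>J1 - {a}. weil_height (x j))"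
    using fin(2)[OF J1(1)] J1 by (simp add: sum.remove)
  also have "(\<Sum>j<k. weil_height (x j)) = weil_height (x a) + (\<Sum>j\<in>{..<k} - {a}. weil_height (x j))"
    using a by (simp add: sum.remove)
  finally have "(\<Sum>j\<in>{..<k} - {a}. weil_height (x j))
      = (\<Sum>j\<in>J1 - {a}. weil_height (x j)) + (\<Sum>J\<in>\<J>'. \<Sum>j\<in>J. weil_height (x j))" by simp
  moreover have "(\<Sum>J\<in>\<J>. weil_height (c J)) = weil_height (c J1) + (\<Sum>J\<in>\<J>'. weil_height (c J))"
    using fin(1) J1 by (simp add: \<J>'_def sum.remove)
  ultimately show "weil_height (x a) \<le> (\<Sum>J\<in>\<J>. weil_height (c J)) + ln (real (card \<J> - 1))
       + (\<Sum>j\<in>{..<k} - {a}. weil_height (x j))"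
    using le unfolding cJ' by (simp add: sum.distrib)
qed

text \<open>Equality holds for the largest admissible exponents \<open>T = {N - card T..<N}\<close>.\<close>

lemma sum_distinct_powers:
  fixes d :: real
  assumes d: "d \<ge> 1"
  shows "T \<subseteq> {..<N} \<Longrightarrow> (d - 1) * (\<Sum>t\<in>T. d ^ t) + d ^ (N - card T) \<le> d ^ N"
proof (induction N arbitrary: T)
  case (Suc N)
  have finT: "finite T" using Suc.prems finite_subset by blast
  show ?case
  proof (cases "N \<in> T")
    case True
    have sub: "T - {N} \<subseteq> {..<N}" using Suc.prems by auto
    have "card T = Suc (card (T - {N}))" using True finT by (metis card.remove)
    then have "Suc N - card T = N - card (T - {N})" by simp
    moreover have "(\<Sum>t\<in>T. d ^ t) = d ^ N + (\<Sum>t\<in>T - {N}. d ^ t)" using True finT by (simp add: sum.remove)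
    ultimately have "(d - 1) * (\<Sum>t\<in>T. d ^ t) + d ^ (Suc N - card T)
        = (d - 1) * d ^ N + ((d - 1) * (\<Sum>t\<in>T - {N}. d ^ t) + d ^ (N - card (T - {N})))"
      by (simp add: distrib_left)
    also have "\<dots> \<le> (d - 1) * d ^ N + d ^ N" using Suc.IH[OF sub] by simp
    finally show ?thesis by (simp add: algebra_simps)
  next
    case False
    then have sub: "T \<subseteq> {..<N}" using Suc.prems by (auto simp: less_Suc_eq)
    have "card T \<le> N" using card_mono[OF _ sub] by simp
    then have "Suc N - card T = Suc (N - card T)" by simp
    then have "(d - 1) * (\<Sum>t\<in>T. d ^ t) + d ^ (Suc N - card T)
        = ((d - 1) * (\<Sum>t\<in>T. d ^ t) + d ^ (N - card T)) + (d - 1) * d ^ (N - card T)"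
      by (simp add: algebra_simps)
    also have "\<dots> \<le> d ^ N + (d - 1) * d ^ N"
      using Suc.IH[OF sub] d by (intro add_mono mult_left_mono power_increasing) auto
    finally show ?thesis by (simp add: algebra_simps)
  qed
qed simp

text \<open>The constant S(F): after solving for one variable, \<open>card \<J> - 1\<close> blocks
  remain in the sum.\<close>

definition orbit_const :: "nat set set \<Rightarrow> (nat set \<Rightarrow> complex) \<Rightarrow> real" where
  "orbit_const \<J> c = (\<Sum>J\<in>\<J>. weil_height (c J)) + ln (real (card \<J> - 1))"

section \<open>The height inequality along an orbit\<close>

context
  fixes K :: "complex set" and k d :: nat and F :: mpoly and p q :: "complex poly"
    and \<J> :: "nat set set" and c :: "nat set \<Rightarrow> complex" and B :: real
  assumes K: "K \<subseteq> Qbar" and k: "k \<ge> 1" and F: "split_form K k F \<J> c"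
    and p: "poly_over Qbar p" and q: "poly_over Qbar q" and cop: "coprime p q"
    and d: "rat_degree p q = d" "d \<ge> 2"
    and B: "\<And>\<gamma>. \<gamma> \<in> P1 Qbar \<Longrightarrow> \<bar>canonical_height p q \<gamma> - P1_height \<gamma>\<bar> \<le> B"
begin

lemma canonical_height_props:
  assumes g: "\<gamma> \<in> P1 Qbar"
  shows "0 \<le> canonical_height p q \<gamma>" "(rat_map p q ^^ n) \<gamma> \<in> P1 Qbar"
    "canonical_height p q ((rat_map p q ^^ n) \<gamma>) = real d ^ n * canonical_height p q \<gamma>"
proof -
  have H: "is_canonical_height p q (canonical_height p q)" using canonical_height[OF p q cop] d by simp
  show "0 \<le> canonical_height p q \<gamma>" using H g by (simp add: is_canonical_height_def)
  show inP: "(rat_map p q ^^ n) \<gamma> \<in> P1 Qbar" for n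
    by (rule rat_map_iterate_P1[OF subfield_Qbar p q g])
  show "canonical_height p q ((rat_map p q ^^ n) \<gamma>) = real d ^ n * canonical_height p q \<gamma>"
    using H inP d by (induction n) (auto simp: is_canonical_height_def)
qed

lemma height_difference_bound_nonneg: "0 \<le> B"
  using B[of Infty] by (simp add: P1_def)

text \<open>Here F = 0 may hold without being solvable for an iterate, but d^n H(\<gamma>) = H(0) <=
  B already bounds the height: one \<open>B\<close> for H(\<gamma>), another for the passage to
  h.\<close>

lemma orbit_hits_zero:
  assumes g: "\<gamma> \<in> P1 Qbar" and z: "(rat_map p q ^^ n) \<gamma> = Fin 0"
  shows "P1_height \<gamma> \<le> 2 * B"
proof -
  have "real d ^ n * canonical_height p q \<gamma> = canonical_height p q (Fin 0)"
    using canonical_height_props(3)[OF g, of n] z by simp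
  also have "\<dots> \<le> B" using B[of "Fin 0"] by (simp add: P1_def weil_height_0)
  finally have "real d ^ n * canonical_height p q \<gamma> \<le> B" .
  moreover have "1 * canonical_height p q \<gamma> \<le> real d ^ n * canonical_height p q \<gamma>"
    using d canonical_height_props(1)[OF g] by (intro mult_right_mono one_le_power) auto
  ultimately show ?thesis using B[OF g] by linarith
qed

lemma orbit_const_bounds:
  shows "0 \<le> orbit_const \<J> c"
    "orbit_const \<J> c \<le> real k * mpoly_height F + ln (real (k - 1))"
    "0 \<le> mpoly_height F"
proof -
  note fin = split_form_finite[OF F]
  have c: "0 \<le> weil_height (c J)" if "J \<in> \<J>" for J
    using that F K by (intro weil_height_nonneg) (auto simp: split_form_def)
  have "0 \<in> \<Union>\<J>" unfolding fin(4) using k by simp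
  then have ne: "\<J> \<noteq> {}" by auto
  \<comment> \<open>\<open>m = 0\<close> occurs when there is a single block.\<close>
  have ln0: "0 \<le> ln (real m)" for m by (cases m) auto
  show "0 \<le> orbit_const \<J> c"
    unfolding orbit_const_def using c ln0 by (intro add_nonneg_nonneg sum_nonneg)
  have hF: "mpoly_height F = Max ((\<lambda>J. weil_height (c J)) ` \<J>)" by (rule mpoly_height_split_form[OF F])
  have le: "weil_height (c J) \<le> mpoly_height F" if "J \<in> \<J>" for J
    unfolding hF using that fin(1) by (intro Max_ge) auto
  obtain J where "J \<in> \<J>" using ne by auto
  then show hF0: "0 \<le> mpoly_height F" using c le by force
  have "(\<Sum>J\<in>\<J>. weil_height (c J)) \<le> real (card \<J>) * mpoly_height F" by (intro sum_bounded_above le)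
  also have "\<dots> \<le> real k * mpoly_height F" using fin(6) hF0 by (intro mult_right_mono) auto
  finally have "(\<Sum>J\<in>\<J>. weil_height (c J)) \<le> real k * mpoly_height F" .
  moreover have "ln (real (card \<J> - 1)) \<le> ln (real (k - 1))"
  proof (cases "card \<J> - 1 = 0")
    case True then show ?thesis using ln0 by simp
  next
    case False then show ?thesis using fin(6) by (subst ln_le_cancel_iff) auto
  qed
  ultimately show "orbit_const \<J> c \<le> real k * mpoly_height F + ln (real (k - 1))"
    by (simp add: orbit_const_def)
qed

lemma orbit_inequality:
  assumes g: "\<gamma> \<in> P1 Qbar" and ns: "length ns = k" "distinct ns"
    and x: "\<And>j. j < k \<Longrightarrow> (rat_map p q ^^ (ns ! j)) \<gamma> = Fin (x j)" "\<And>j. j < k \<Longrightarrow> x j \<noteq> 0"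
    and zero: "meval F x = 0"
  obtains N where "k \<ge> 2" "k - 1 \<le> N" "set ns \<subseteq> {..N}"
    "real d ^ (N - (k - 1)) * canonical_height p q \<gamma> \<le> orbit_const \<J> c + real k * B"
    "d \<ge> 3 \<Longrightarrow> real d ^ N * canonical_height p q \<gamma> \<le> 2 * (orbit_const \<J> c + real k * B)"
proof -
  let ?H = "canonical_height p q \<gamma>"
  define N where "N = Max (set ns)"
  have ne: "ns \<noteq> []" using ns k by auto
  then have "N \<in> set ns" by (simp add: N_def)
  then obtain a where a: "a < k" "ns ! a = N" using ns(1) by (auto simp: in_set_conv_nth)
  have sub: "set ns \<subseteq> {..N}" by (auto simp: N_def)
  have xQ: "x j \<in> Qbar" if "j < k" for j
    using canonical_height_props(2)[OF g, of "ns ! j"] x(1)[OF that] by (auto simp: P1_def)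
  have hx: "\<bar>real d ^ (ns ! j) * ?H - weil_height (x j)\<bar> \<le> B" if "j < k" for j
    using B[OF canonical_height_props(2)[OF g, of "ns ! j"]] canonical_height_props(3)[OF g, of "ns ! j"]
      x(1)[OF that] by simp
  note solve = height_solve_split_form[OF F K xQ x(2) zero a(1)]
  have k2: "k \<ge> 2" using solve(1) split_form_finite(6)[OF F] by linarith
  define T where "T = (\<lambda>j. ns ! j) ` ({..<k} - {a})"
  have inj: "inj_on (\<lambda>j. ns ! j) {..<k}" using ns by (auto simp: inj_on_def nth_eq_iff_index_eq)
  have T: "T \<subseteq> {..<N}"
  proof
    fix t assume "t \<in> T"
    then obtain j where j: "j < k" "j \<noteq> a" "t = ns ! j" by (auto simp: T_def)
    then have "t \<noteq> N" using inj_onD[OF inj, of j a] a by auto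
    moreover have "t \<le> N" using subsetD[OF sub, of t] j ns(1) by simp
    ultimately show "t \<in> {..<N}" by simp
  qed
  have cT: "card T = k - 1"
    unfolding T_def using card_image[OF inj_on_subset[OF inj, of "{..<k} - {a}"]] a by auto
  have sT: "(\<Sum>j\<in>{..<k} - {a}. real d ^ (ns ! j)) = (\<Sum>t\<in>T. real d ^ t)"
    unfolding T_def using sum.reindex[OF inj_on_subset[OF inj, of "{..<k} - {a}"], of "\<lambda>t. real d ^ t"] by auto
  have "real d ^ N * ?H - B \<le> weil_height (x a)" using hx[OF a(1)] a(2) by simp
  also have "\<dots> \<le> orbit_const \<J> c + (\<Sum>j\<in>{..<k} - {a}. weil_height (x j))"
    using solve(2) by (simp add: orbit_const_def)
  also have "(\<Sum>j\<in>{..<k} - {a}. weil_height (x j)) \<le> (\<Sum>j\<in>{..<k} - {a}. real d ^ (ns ! j) * ?H + B)"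
  proof (rule sum_mono)
    fix j assume "j \<in> {..<k} - {a}"
    then show "weil_height (x j) \<le> real d ^ (ns ! j) * ?H + B" using hx[of j] by auto
  qed
  also have "\<dots> = (\<Sum>t\<in>T. real d ^ t) * ?H + real (k - 1) * B"
    using a by (simp add: sum.distrib sT[symmetric] sum_distrib_right)
  \<comment> \<open>The error is k B: each of the k iterates passes once between the Weil height and
    the canonical height.\<close>
  finally have main: "(real d ^ N - (\<Sum>t\<in>T. real d ^ t)) * ?H \<le> orbit_const \<J> c + real k * B"
    using k by (simp add: algebra_simps of_nat_diff)
  have pow: "(real d - 1) * (\<Sum>t\<in>T. real d ^ t) + real d ^ (N - (k - 1)) \<le> real d ^ N"
    using sum_distinct_powers[OF _ T, of "real d"] d by (simp add: cT)
  have S0: "0 \<le> (\<Sum>t\<in>T. real d ^ t)" by (simp add: sum_nonneg)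
  have H0: "0 \<le> ?H" by (rule canonical_height_props(1)[OF g])
  show thesis
  proof (rule that[OF k2 _ sub])
    \<comment> \<open>The k - 1 other exponents are distinct and lie below N.\<close>
    show "k - 1 \<le> N" using card_mono[OF _ T] cT by simp
    have "1 * (\<Sum>t\<in>T. real d ^ t) \<le> (real d - 1) * (\<Sum>t\<in>T. real d ^ t)"
      using d S0 by (intro mult_right_mono) auto
    then have "real d ^ (N - (k - 1)) \<le> real d ^ N - (\<Sum>t\<in>T. real d ^ t)" using pow by linarith
    from mult_right_mono[OF this H0] main
    show "real d ^ (N - (k - 1)) * ?H \<le> orbit_const \<J> c + real k * B" by linarith
    assume "d \<ge> 3"
    then have "2 * (\<Sum>t\<in>T. real d ^ t) \<le> (real d - 1) * (\<Sum>t\<in>T. real d ^ t)"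
      using S0 by (intro mult_right_mono) auto
    moreover have "0 \<le> real d ^ (N - (k - 1))" by simp
    \<comment> \<open>As d - 1 >= 2, the other powers add up to at most half of d^N.\<close>
    ultimately have "real d ^ N \<le> 2 * (real d ^ N - (\<Sum>t\<in>T. real d ^ t))" using pow by argo
    from mult_right_mono[OF this H0]
    have "real d ^ N * ?H \<le> 2 * ((real d ^ N - (\<Sum>t\<in>T. real d ^ t)) * ?H)"
      by (simp only: mult.assoc)
    then show "real d ^ N * ?H \<le> 2 * (orbit_const \<J> c + real k * B)"
      by (rule order_trans[OF _ mult_left_mono[OF main]]) simp
  qed
qed

lemma exceptional_set_cases:
  assumes \<alpha>: "\<alpha> \<in> exceptional_set k F p q"
  obtains (zero) "weil_height \<alpha> \<le> 2 * B"
  | (nonzero) N where "k \<ge> 2" "k - 1 \<le> N"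
    "real d ^ (N - (k - 1)) * canonical_height p q (Fin \<alpha>) \<le> orbit_const \<J> c + real k * B"
    "d \<ge> 3 \<Longrightarrow> real d ^ N * canonical_height p q (Fin \<alpha>) \<le> 2 * (orbit_const \<J> c + real k * B)"
proof -
  obtain ns where aQ: "\<alpha> \<in> Qbar" and ns: "length ns = k" "distinct ns" "orbit_zero F p q (Fin \<alpha>) ns"
    using \<alpha> by (auto simp: exceptional_set_def)
  have g: "Fin \<alpha> \<in> P1 Qbar" using aQ by (simp add: P1_def)
  obtain x where x: "\<And>j. j < k \<Longrightarrow> (rat_map p q ^^ (ns ! j)) (Fin \<alpha>) = Fin (x j)" "meval F x = 0"
    using ns by (auto simp: orbit_zero_def)
  show thesis
  proof (cases "\<exists>j<k. x j = 0")
    case True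
    then obtain j where "j < k" "x j = 0" by auto
    then have "(rat_map p q ^^ (ns ! j)) (Fin \<alpha>) = Fin 0" using x(1)[of j] by simp
    from orbit_hits_zero[OF g this] show ?thesis by (intro zero) simp
  next
    case False
    then have "\<And>j. j < k \<Longrightarrow> x j \<noteq> 0" by auto
    from orbit_inequality[OF g ns(1,2) x(1) this x(2)] show ?thesis by (metis nonzero)
  qed
qed

lemma exceptional_set_bounded:
  assumes \<alpha>: "\<alpha> \<in> exceptional_set k F p q"
  shows "weil_height \<alpha> \<le> 2 * B + orbit_const \<J> c + real k * B"
proof -
  have aQ: "\<alpha> \<in> Qbar" using \<alpha> by (simp add: exceptional_set_def)
  have g: "Fin \<alpha> \<in> P1 Qbar" using aQ by (simp add: P1_def)
  let ?H = "canonical_height p q (Fin \<alpha>)"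
  have S0: "0 \<le> orbit_const \<J> c + real k * B" using orbit_const_bounds(1) height_difference_bound_nonneg by simp
  from \<alpha> show ?thesis
  proof (cases rule: exceptional_set_cases)
    case zero
    then show ?thesis using S0 by linarith
  next
    case N: (nonzero N)
    have "1 * ?H \<le> real d ^ (N - (k - 1)) * ?H"
      using d canonical_height_props(1)[OF g] by (intro mult_right_mono one_le_power) auto
    then have "?H \<le> orbit_const \<J> c + real k * B" using N(3) by linarith
    then show ?thesis using B[OF g] height_difference_bound_nonneg by (simp add: abs_le_iff)
  qed
qed

end

section \<open>The explicit constants for degree at least 3\<close>

text \<open>The worst cases determine the constants: equality holds at k = 2 in the first bound and
  at k = 3 in the second.\<close>

lemma three_power_bounds:
  assumes "k \<ge> 2"
  shows "2 * real k \<le> 4 / 3 * 3 ^ (k - 1)" "2 * ln (real (k - 1)) \<le> 2 / 9 * ln 2 * 3 ^ (k - 1)"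
proof -
  obtain m where m: "k = Suc (Suc m)" using assms by (metis add_2_eq_Suc le_Suc_ex)
  have "real (Suc (Suc m)) \<le> 2 * 3 ^ m" for m
    by (induction m) auto
  from this[of m] show "2 * real k \<le> 4 / 3 * 3 ^ (k - 1)" by (simp add: m)
  have "9 * ln (real (Suc m)) \<le> ln 2 * 3 ^ Suc m"
  proof (induction m)
    case (Suc m)
    show ?case
    proof (cases m)
      case 0
      then show ?thesis by simp
    next
      case (Suc j)
      \<comment> \<open>Hence the logarithm at most triples in one step, just as the right side
        does. For m = 0 this fails since ln 1 = 0, so that case was settled directly.\<close>
      have "real (Suc (Suc m)) \<le> real (Suc m) ^ 3"
      proof -
        have "Suc (Suc m) \<le> Suc m * 2" by simp
        also have "\<dots> \<le> Suc m * (Suc m * Suc m)" using Suc by (intro mult_left_mono) auto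
        finally have "Suc (Suc m) \<le> Suc m ^ 3" by (simp only: power3_eq_cube mult.assoc)
        then have "real (Suc (Suc m)) \<le> real (Suc m ^ 3)" by (simp only: of_nat_le_iff)
        then show ?thesis by simp
      qed
      then have "ln (real (Suc (Suc m))) \<le> ln (real (Suc m) ^ 3)" by (subst ln_le_cancel_iff) auto
      also have "\<dots> = 3 * ln (real (Suc m))" by (subst ln_realpow) auto
      finally show ?thesis using Suc.IH by simp
    qed
  qed simp
  then show "2 * ln (real (k - 1)) \<le> 2 / 9 * ln 2 * 3 ^ (k - 1)" by (simp add: m)
qed

text \<open>Division of the orbit inequality by d^(k-1) <= d^N gives the first term. The factor 7/3
  is 4/3, the bound for 2 k / d^(k-1), plus 1 for the passage from H to h. An orbit through 0
  contributes only 2 \<open>B\<close>.\<close>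

lemma exceptional_set_height_explicit:
  assumes K: "K \<subseteq> Qbar" and k: "k \<ge> 1" and F: "split_form K k F \<J> c"
    and p: "poly_over Qbar p" and q: "poly_over Qbar q" and cop: "coprime p q"
    and d: "rat_degree p q = d" "d \<ge> 3"
    and B: "\<And>\<gamma>. \<gamma> \<in> P1 Qbar \<Longrightarrow> \<bar>canonical_height p q \<gamma> - P1_height \<gamma>\<bar> \<le> B"
    and \<alpha>: "\<alpha> \<in> exceptional_set k F p q"
  shows "weil_height \<alpha> \<le> 2 * real k / real d ^ (k - 1) * mpoly_height F + 7 / 3 * B + 2 / 9 * ln 2"
proof -
  let ?H = "canonical_height p q (Fin \<alpha>)"
  have d2: "d \<ge> 2" using d by simp
  note ctx = K k F p q cop d(1) d2 B
  have g: "Fin \<alpha> \<in> P1 Qbar" using \<alpha> by (simp add: P1_def exceptional_set_def)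
  have B0: "0 \<le> B" by (rule height_difference_bound_nonneg[OF ctx])
  have hF: "0 \<le> mpoly_height F" and S: "orbit_const \<J> c \<le> real k * mpoly_height F + ln (real (k - 1))"
    and S0: "0 \<le> orbit_const \<J> c"
    using orbit_const_bounds[OF ctx] by auto
  have H0: "0 \<le> ?H" by (rule canonical_height_props(1)[OF ctx g])
  have D: "real d ^ (k - 1) > 0" using d by simp
  show ?thesis
  proof (rule exceptional_set_cases[OF ctx \<alpha>])
    assume zero: "weil_height \<alpha> \<le> 2 * B"
    have "0 \<le> 2 * real k / real d ^ (k - 1) * mpoly_height F" using hF by simp
    moreover have "0 \<le> 2 / 9 * ln (2 :: real)" by simp
    ultimately show ?thesis using zero B0 by linarith
  next
    fix N
    assume N: "k \<ge> 2" "k - 1 \<le> N"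
      and le: "d \<ge> 3 \<Longrightarrow> real d ^ N * ?H \<le> 2 * (orbit_const \<J> c + real k * B)"
    have "real d ^ (k - 1) * ?H \<le> real d ^ N * ?H"
      using N(2) d H0 by (intro mult_right_mono power_increasing) auto
    also have "\<dots> \<le> 2 * (real k * mpoly_height F + ln (real (k - 1)) + real k * B)"
      by (rule order_trans[OF le[OF d(2)]]) (use S in simp)
    finally have "?H \<le> 2 * (real k * mpoly_height F + ln (real (k - 1)) + real k * B) / real d ^ (k - 1)"
      using D by (simp add: field_simps)
    also have "\<dots> = 2 * real k / real d ^ (k - 1) * mpoly_height F
        + 2 * ln (real (k - 1)) / real d ^ (k - 1) + 2 * real k / real d ^ (k - 1) * B"
      by (simp add: add_divide_distrib distrib_left)
    also have "2 * ln (real (k - 1)) / real d ^ (k - 1) \<le> 2 / 9 * ln 2"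
    proof -
      have "2 * ln (real (k - 1)) \<le> 2 / 9 * ln 2 * 3 ^ (k - 1)" by (rule three_power_bounds(2)[OF N(1)])
      also have "\<dots> \<le> 2 / 9 * ln 2 * real d ^ (k - 1)"
        using d by (intro mult_left_mono power_mono) auto
      finally show ?thesis using D by (simp add: pos_divide_le_eq)
    qed
    also have "2 * real k / real d ^ (k - 1) * B \<le> 4 / 3 * B"
    proof -
      have "2 * real k \<le> 4 / 3 * 3 ^ (k - 1)" by (rule three_power_bounds(1)[OF N(1)])
      also have "\<dots> \<le> 4 / 3 * real d ^ (k - 1)" using d by (intro mult_left_mono power_mono) auto
      finally have "2 * real k / real d ^ (k - 1) \<le> 4 / 3" using D by (simp add: pos_divide_le_eq)
      then show ?thesis using B0 by (rule mult_right_mono)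
    qed
    finally show ?thesis using B[OF g] by (simp add: abs_le_iff)
  qed
qed

section \<open>Wandering points over a number field\<close>

lemma finite_P1_bounded_height:
  assumes "number_field K"
  shows "finite {\<gamma>\<in>P1 K. P1_height \<gamma> \<le> B}"
proof -
  have "{\<gamma>\<in>P1 K. P1_height \<gamma> \<le> B} \<subseteq> insert Infty (Fin ` {x\<in>K. weil_height x \<le> B})"
    by (auto simp: P1_def)
  then show ?thesis by (rule finite_subset) (simp add: northcott[OF assms])
qed

text \<open>If H vanished at a point, its orbit would have bounded height in P1(K) and be finite by
  Northcott's theorem. Uniformity follows because H >= 1 outside the finitely many points of height
  at most B + 1.\<close>

lemma wandering_canonical_height_lower_bound:
  assumes K: "number_field K" and p: "poly_over K p" and q: "poly_over K q"
    and H: "is_canonical_height p q H" and d: "rat_degree p q \<ge> 2"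
  shows "\<exists>e>0. \<forall>\<alpha>\<in>Wander K p q. e \<le> H \<alpha>"
proof -
  note L = number_field_imp_subfield[OF K] and KQ = number_field_subset_Qbar[OF K]
  have PK: "P1 K \<subseteq> P1 Qbar" using KQ by (auto simp: P1_def)
  obtain B where B: "\<And>\<gamma>. \<gamma> \<in> P1 Qbar \<Longrightarrow> \<bar>H \<gamma> - P1_height \<gamma>\<bar> \<le> B"
    using H unfolding is_canonical_height_def by blast
  have H0: "0 \<le> H \<gamma>" if "\<gamma> \<in> P1 Qbar" for \<gamma> using that H by (simp add: is_canonical_height_def)
  have pos: "0 < H \<alpha>" if a: "\<alpha> \<in> Wander K p q" for \<alpha>
  proof (rule ccontr)
    assume "\<not> 0 < H \<alpha>"
    moreover have aK: "\<alpha> \<in> P1 K" using a by (simp add: Wander_def)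
    ultimately have z: "H \<alpha> = 0" using H0 PK by force
    have inP: "(rat_map p q ^^ n) \<alpha> \<in> P1 K" for n by (rule rat_map_iterate_P1[OF L p q aK])
    have "H ((rat_map p q ^^ n) \<alpha>) = 0" for n
    proof (induction n)
      case (Suc n)
      have "(rat_map p q ^^ n) \<alpha> \<in> P1 Qbar" using inP PK by blast
      then have "H (rat_map p q ((rat_map p q ^^ n) \<alpha>)) = real (rat_degree p q) * H ((rat_map p q ^^ n) \<alpha>)"
        using H by (simp add: is_canonical_height_def)
      then show ?case using Suc by simp
    qed (simp add: z)
    then have "P1_height ((rat_map p q ^^ n) \<alpha>) \<le> B" for n
      using B[of "(rat_map p q ^^ n) \<alpha>"] inP[of n] PK by force
    then have "range (\<lambda>n. (rat_map p q ^^ n) \<alpha>) \<subseteq> {\<gamma>\<in>P1 K. P1_height \<gamma> \<le> B}" using inP by auto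
    then have "finite (range (\<lambda>n. (rat_map p q ^^ n) \<alpha>))"
      using finite_P1_bounded_height[OF K] finite_subset by blast
    then show False using a by (simp add: Wander_def)
  qed
  define S where "S = {\<gamma>\<in>P1 K. P1_height \<gamma> \<le> B + 1} \<inter> Wander K p q"
  have S: "finite S" unfolding S_def using finite_P1_bounded_height[OF K] by simp
  \<comment> \<open>The 1 serves the wandering points outside \<open>S\<close> and keeps the minimum
    meaningful when \<open>S\<close> is empty.\<close>
  define e where "e = Min (insert 1 (H ` S))"
  have "0 < e" unfolding e_def using S pos by (subst Min_gr_iff) (auto simp: S_def)
  moreover have "e \<le> H \<alpha>" if a: "\<alpha> \<in> Wander K p q" for \<alpha>
  proof (cases "\<alpha> \<in> S")
    case True then show ?thesis unfolding e_def using S by (intro Min_le) auto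
  next
    case False
    have "\<alpha> \<in> P1 K" using a by (simp add: Wander_def)
    then have "P1_height \<alpha> > B + 1" using False a by (auto simp: S_def)
    then have "1 \<le> H \<alpha>" using B[of \<alpha>] \<open>\<alpha> \<in> P1 K\<close> PK by force
    moreover have "e \<le> 1" unfolding e_def using S by (intro Min_le) auto
    ultimately show ?thesis by simp
  qed
  ultimately show ?thesis by blast
qed

theorem theorem1p10:
  fixes K :: "complex set" and k d :: nat and F :: mpoly and p q :: "complex poly"
  assumes "number_field K"
    and "k \<ge> 1"
    and "split_multilinear K k F"
    and "set (coeffs p) \<subseteq> K" and "set (coeffs q) \<subseteq> K" and "coprime p q"
    and "rat_degree p q = d" and "d \<ge> 2"
  shows
    "(\<exists>B. \<forall>\<alpha>\<in>exceptional_set k F p q. weil_height \<alpha> \<le> B) \<and>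
     (d \<ge> 3 \<longrightarrow>
       (\<forall>C\<^sub>1 :: real.
          (\<forall>\<gamma>\<in>P1 Qbar. \<bar>canonical_height p q \<gamma> - P1_height \<gamma>\<bar> \<le> C\<^sub>1) \<longrightarrow>
          (\<forall>\<alpha>\<in>exceptional_set k F p q.
             weil_height \<alpha> \<le> 2 * real k / real d ^ (k - 1) * mpoly_height F
                              + 7 / 3 * C\<^sub>1 + 2 / 9 * ln 2))) \<and>
     (\<exists>N :: nat. \<forall>\<alpha>\<in>Wander K p q.
        Fin 0 \<notin> range (\<lambda>n. (rat_map p q ^^ n) \<alpha>) \<longrightarrow>
        finite {ns. length ns = k \<and> sorted_wrt (>) ns \<and> orbit_zero F p q \<alpha> ns} \<and>
        card {ns. length ns = k \<and> sorted_wrt (>) ns \<and> orbit_zero F p q \<alpha> ns} \<le> N)"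
proof -
  have KQ: "K \<subseteq> Qbar" by (rule number_field_subset_Qbar[OF assms(1)])
  have K0: "0 \<in> K" using subring_0[OF subfield_imp_subring[OF number_field_imp_subfield[OF assms(1)]]] .
  \<comment> \<open>\<open>coeffs\<close> does not list the zero coefficients beyond the degree;
    these need 0 in \<open>K\<close>.\<close>
  have "poly_over K r" if "set (coeffs r) \<subseteq> K" for r
    unfolding poly_over_def
  proof
    fix i
    have "coeff r i \<in> insert 0 (set (coeffs r))" unfolding range_coeff[symmetric] by simp
    then show "coeff r i \<in> K" using that K0 by auto
  qed
  then have pK: "poly_over K p" and qK: "poly_over K q" using assms(4,5) by auto
  then have p: "poly_over Qbar p" and q: "poly_over Qbar q" using KQ by (auto simp: poly_over_def)
  obtain \<J> c where F: "split_form K k F \<J> c" using assms(3) by (auto simp: split_multilinear_def)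
  have H: "is_canonical_height p q (canonical_height p q)"
    using canonical_height[OF p q assms(6)] assms(7,8) by simp
  then obtain B where B: "\<And>\<gamma>. \<gamma> \<in> P1 Qbar \<Longrightarrow> \<bar>canonical_height p q \<gamma> - P1_height \<gamma>\<bar> \<le> B"
    unfolding is_canonical_height_def by blast
  note ctx = KQ assms(2) F p q assms(6,7,8) B
  have part_a: "\<exists>B. \<forall>\<alpha>\<in>exceptional_set k F p q. weil_height \<alpha> \<le> B"
    using exceptional_set_bounded[OF ctx] by blast
  have part_b: "weil_height \<alpha> \<le> 2 * real k / real d ^ (k - 1) * mpoly_height F + 7 / 3 * C1 + 2 / 9 * ln 2"
    if "d \<ge> 3" "\<forall>\<gamma>\<in>P1 Qbar. \<bar>canonical_height p q \<gamma> - P1_height \<gamma>\<bar> \<le> C1" "\<alpha> \<in> exceptional_set k F p q"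
    for C1 \<alpha>
    using that by (intro exceptional_set_height_explicit[OF KQ assms(2) F p q assms(6,7)]) auto
  obtain e where e: "e > 0" "\<And>\<alpha>. \<alpha> \<in> Wander K p q \<Longrightarrow> e \<le> canonical_height p q \<alpha>"
    using wandering_canonical_height_lower_bound[OF assms(1) pK qK H] assms(7,8) by blast
  define S where "S = orbit_const \<J> c + real k * B"
  \<comment> \<open>n0 is fixed before any point is chosen, whence the uniformity in \<alpha>: from
    e <= H(\<alpha>) the orbit inequality gives d^(N-(k-1)) <= S/e < d^n0, so N <= n0 + k. All
    solutions thus lie in the one finite set \<open>Z\<close>.\<close>
  obtain n0 where n0: "S / e < real d ^ n0"
    using real_arch_pow[of "real d" "S / e"] assms(8) by auto
  define M where "M = n0 + k"
  define Z where "Z = {ns. set ns \<subseteq> {..M} \<and> length ns = k}"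
  have Z: "finite Z" unfolding Z_def by (rule finite_lists_length_eq) simp
  have "{ns. length ns = k \<and> sorted_wrt (>) ns \<and> orbit_zero F p q \<alpha> ns} \<subseteq> Z"
    if a: "\<alpha> \<in> Wander K p q" and no0: "Fin 0 \<notin> range (\<lambda>n. (rat_map p q ^^ n) \<alpha>)" for \<alpha>
  proof clarify
    fix ns assume ns: "k = length ns" "sorted_wrt (>) ns" "orbit_zero F p q \<alpha> ns"
    have g: "\<alpha> \<in> P1 Qbar" using a KQ by (auto simp: Wander_def P1_def)
    have len: "length ns = k" using ns(1) by simp
    have dist: "distinct ns" using ns(2) by (induction ns) auto
    obtain x where x: "\<And>j. j < k \<Longrightarrow> (rat_map p q ^^ (ns ! j)) \<alpha> = Fin (x j)" "meval F x = 0"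
      using ns(1,3) by (auto simp: orbit_zero_def)
    have nz: "x j \<noteq> 0" if "j < k" for j
    proof
      assume "x j = 0"
      then have "Fin 0 = (rat_map p q ^^ (ns ! j)) \<alpha>" using x(1)[OF that] by simp
      then show False using no0 by blast
    qed
    obtain N where N: "set ns \<subseteq> {..N}" "real d ^ (N - (k - 1)) * canonical_height p q \<alpha> \<le> S"
      using orbit_inequality[OF ctx g len dist x(1) nz x(2)] unfolding S_def by metis
    have "real d ^ (N - (k - 1)) * e \<le> S"
      using mult_left_mono[OF e(2)[OF a], of "real d ^ (N - (k - 1))"] N(2) by simp
    then have "real d ^ (N - (k - 1)) \<le> S / e" using e(1) by (simp add: field_simps)
    then have "real d ^ (N - (k - 1)) < real d ^ n0" using n0 by linarith
    then have "N - (k - 1) < n0" using assms(8) by (subst (asm) power_strict_increasing_iff) auto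
    then have "N \<le> M" by (simp add: M_def)
    then show "ns \<in> Z" using N(1) len by (auto simp: Z_def)
  qed
  then have part_c: "\<forall>\<alpha>\<in>Wander K p q.
        Fin 0 \<notin> range (\<lambda>n. (rat_map p q ^^ n) \<alpha>) \<longrightarrow>
        finite {ns. length ns = k \<and> sorted_wrt (>) ns \<and> orbit_zero F p q \<alpha> ns} \<and>
        card {ns. length ns = k \<and> sorted_wrt (>) ns \<and> orbit_zero F p q \<alpha> ns} \<le> card Z"
    using Z by (meson card_mono finite_subset)
  show ?thesis using part_a part_b part_c by blast
qed

end
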